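(* Let $\mathcal M\subset\mathbb R^N$ be an $n$-dimensional algebraic manifold, let $f\colon\mathcal M\to\mathbb R_{\ge 0}$ be a measurable function with finite integral over $\mathcal M$, and let $\varphi(A,b)$ be the probability density on $\mathbb R^{n\times N}\times\mathbb R^n$ for which the entries of $(A,b)$ are i.i.d. standard Gaussian. Let $\alpha$, $\overline f$ and $\mathcal L_{A,b}$ be as defined in the context. Then: (1) The integral of $f$ over $\mathcal M$ is the expected value of $\overline f$: $$\int_{\mathcal M} f(x)\,\mathrm dx=\mathbb E_{(A,b)\sim\varphi}\,\overline f(A,b).$$ (2) Assume that $f$ is nonnegative and that $\int_{\mathcal M}f(x)\,\mathrm dx$ is positive and finite. Let $X\in\mathcal M$ be the random variable obtained by choosing a pair $(A,b)\in\mathbb R^{n\times N}\times\mathbb R^n$ with probability density $$\psi(A,b):=\frac{\varphi(A,b)\,\overline f(A,b)}{\mathbb E_{(A,b)\sim\varphi}\,\overline f(A,b)}$$ and then choosing one of the finitely many points $x$ of the intersection $\mathcal M\cap\mathcal L_{A,b}$, each with probability $f(x)\,\alpha(x)^{-1}\,\overline f(A,b)^{-1}$, as the value of $X$. Then $X$ is distributed according to the density $f(x)/\int_{\mathcal M}f(y)\,\mathrm dy$ on $\mathcal M$.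
   Context: A (real affine) algebraic variety in $\mathbb R^N$ is the common zero set of a set of real polynomials in $N$ variables. An algebraic manifold is an open submanifold of the manifold of nonsingular points of a real affine algebraic variety in $\mathbb R^N$. $\mathcal M$ carries the Riemannian metric induced from the Euclidean metric of $\mathbb R^N$; $\mathrm dx$ is the associated volume measure, and densities on $\mathcal M$ are taken with respect to it. $\langle\cdot,\cdot\rangle$ and $\|\cdot\|$ are the Euclidean inner product and norm. For $(A,b)\in\mathbb R^{n\times N}\times\mathbb R^n$ put $\mathcal L_{A,b}=\{x\in\mathbb R^N: Ax=b\}$. For $x\in\mathcal M$ let $\mathrm N_x\mathcal M$ be the normal space of $\mathcal M$ at $x$ (the orthogonal complement in $\mathbb R^N$ of the tangent space $\mathrm T_x\mathcal M$), let $\Pi_{\mathrm N_x\mathcal M}\colon\mathbb R^N\to\mathrm N_x\mathcal M$ be the orthogonal projection, and define $$\alpha(x)=\frac{\sqrt{1+\langle x,\Pi_{\mathrm N_x\mathcal M}x\rangle}}{(1+\|x\|^2)^{\frac{n+1}{2}}}\cdot\frac{\Gamma\left(\frac{n+1}{2}\right)}{\sqrt{\pi}^{\,n+1}},\qquad \overline f(A,b)=\sum_{x\in\mathcal M\cap\mathcal L_{A,b}}\frac{f(x)}{\alpha(x)}.$$ The intersection $\mathcal M\cap\mathcal L_{A,b}$ is finite for almost all $(A,b)$, so $\overline f$ is defined almost everywhere; an empty sum is $0$. *)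

theory Defs
  imports "HOL-Probability.Probability"
begin

section \<open>Real affine varieties and algebraic manifolds\<close>

definition algebraic_variety :: "(real ^ 'N) set \<Rightarrow> bool" where
  "algebraic_variety V \<longleftrightarrow>
     (\<exists>S. (\<forall>p\<in>S. real_polynomial_function p) \<and> V = {x. \<forall>p\<in>S. p x = 0})"

text \<open>
  A point x of V is nonsingular in dimension n if V is, near x, the zero set of N - n polynomials
  that vanish on all of V and whose gradients at x are linearly independent; equivalently, the
  local ring of V at x is regular of dimension n (Bochnak, Coste, Roy, Real Algebraic Geometry,
  Section 3.3). That the polynomials lie in the vanishing ideal of V, and do not merely vanish on
  V near x, matters: it excludes for instance the isolated real point of y^2 = x^2 (x - 1).
  Different components of V may have different dimensions; n refers to the dimension at x.
\<close>
definition nonsingular_points :: "nat \<Rightarrow> (real ^ 'N) set \<Rightarrow> (real ^ 'N) set" where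
  "nonsingular_points n V =
     {x \<in> V. \<exists>P U. finite P \<and> card P + n = CARD('N) \<and>
        (\<forall>p\<in>P. real_polynomial_function p \<and> (\<forall>y\<in>V. p y = 0)) \<and>
        dim {D. \<exists>p\<in>P. GDERIV p x :> D} = card P \<and>
        open U \<and> x \<in> U \<and> V \<inter> U = {y \<in> U. \<forall>p\<in>P. p y = 0}}"

definition algebraic_manifold :: "nat \<Rightarrow> (real ^ 'N) set \<Rightarrow> bool" where
  "algebraic_manifold n M \<longleftrightarrow>
     (\<exists>V. algebraic_variety V \<and> openin (top_of_set (nonsingular_points n V)) M)"

section \<open>Tangent and normal spaces\<close>

definition tangent_space :: "(real ^ 'N) set \<Rightarrow> real ^ 'N \<Rightarrow> (real ^ 'N) set" where
  "tangent_space M x =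
     {v. \<exists>\<gamma> e. 0 < e \<and> \<gamma> differentiable_on {-e<..<e} \<and> (\<forall>t\<in>{-e<..<e}. \<gamma> t \<in> M) \<and>
           \<gamma> 0 = x \<and> (\<gamma> has_vector_derivative v) (at (0::real))}"

definition normal_space :: "(real ^ 'N) set \<Rightarrow> real ^ 'N \<Rightarrow> (real ^ 'N) set" where
  "normal_space M x = (tangent_space M x)\<^sup>\<bottom>"

definition orthogonal_projection :: "(real ^ 'N) set \<Rightarrow> real ^ 'N \<Rightarrow> real ^ 'N" where
  "orthogonal_projection W x = (THE y. y \<in> W \<and> (\<forall>z\<in>W. orthogonal (x - y) z))"

section \<open>Riemannian volume\<close>

definition local_parametrization ::
    "(real ^ 'N) set \<Rightarrow> (real ^ 'n) set \<Rightarrow> (real ^ 'n \<Rightarrow> real ^ 'N) \<Rightarrow> bool" where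
  "local_parametrization M U \<psi> \<longleftrightarrow>
     open U \<and> openin (top_of_set M) (\<psi> ` U) \<and> (\<exists>\<phi>. homeomorphism U (\<psi> ` U) \<psi> \<phi>) \<and>
     (\<forall>u\<in>U. \<psi> differentiable (at u)) \<and> continuous_on U (\<lambda>u. jacobian \<psi> (at u)) \<and>
     (\<forall>u\<in>U. inj ((*v) (jacobian \<psi> (at u))))"

text \<open>
  In the coordinates of a parametrization with Jacobian matrix J, the metric tensor induced by
  the Euclidean metric is the Gram matrix of the columns of J.
\<close>
definition metric_tensor :: "(real ^ 'n \<Rightarrow> real ^ 'N) \<Rightarrow> real ^ 'n \<Rightarrow> real ^ 'n ^ 'n" where
  "metric_tensor \<psi> u = transpose (jacobian \<psi> (at u)) ** jacobian \<psi> (at u)"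

definition is_volume_measure :: "'n::finite itself \<Rightarrow> (real ^ 'N) set \<Rightarrow> (real ^ 'N) measure \<Rightarrow> bool" where
  "is_volume_measure _ M \<mu> \<longleftrightarrow>
     sets \<mu> = sets (restrict_space borel M) \<and>
     (\<forall>(U :: (real ^ 'n) set) \<psi>. local_parametrization M U \<psi> \<longrightarrow>
        (\<forall>E\<in>sets borel. E \<subseteq> U \<longrightarrow>
           emeasure \<mu> (\<psi> ` E) = (\<integral>\<^sup>+u\<in>E. ennreal (sqrt (det (metric_tensor \<psi> u))) \<partial>lborel)))"

text \<open>
  The Riemannian volume measure dx of a manifold of dimension \<open>CARD('n)\<close>. Like \<open>lebesgue\<close>, it is
  completed, so that measurability on M means Lebesgue measurability. The dimension enters only
  through the type \<open>real ^ 'n\<close> of the coordinates, hence the type argument.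
\<close>
definition volume_measure :: "'n::finite itself \<Rightarrow> (real ^ 'N) set \<Rightarrow> (real ^ 'N) measure" where
  "volume_measure T M = completion (THE \<mu>. is_volume_measure T M \<mu>)"

section \<open>Random linear sections\<close>

definition linear_section :: "real ^ 'N ^ 'n \<Rightarrow> real ^ 'n \<Rightarrow> (real ^ 'N) set" where
  "linear_section A b = {x. A *v x = b}"

definition alpha :: "nat \<Rightarrow> (real ^ 'N) set \<Rightarrow> real ^ 'N \<Rightarrow> real" where
  "alpha n M x =
     sqrt (1 + x \<bullet> orthogonal_projection (normal_space M x) x)
       / (1 + (norm x)\<^sup>2) powr ((real n + 1) / 2)
     * (Gamma ((real n + 1) / 2) / sqrt pi ^ (n + 1))"

text \<open>
  The sum is over a finite set for almost every pair \<open>(A, b)\<close>; on the exceptional null set,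
  where the intersection is infinite, \<open>sum\<close> takes the value 0.
\<close>
definition f_bar ::
    "(real ^ 'N) set \<Rightarrow> (real ^ 'N \<Rightarrow> real) \<Rightarrow> (real ^ 'N ^ 'n) \<times> (real ^ 'n) \<Rightarrow> real" where
  "f_bar M f = (\<lambda>(A, b). \<Sum>x\<in>M \<inter> linear_section A b. f x / alpha CARD('n) M x)"

definition gaussian_density :: "(real ^ 'N ^ 'n) \<times> (real ^ 'n) \<Rightarrow> real" where
  "gaussian_density = (\<lambda>(A, b).
     (\<Prod>i\<in>UNIV. \<Prod>j\<in>UNIV. std_normal_density (A $ i $ j)) * (\<Prod>i\<in>UNIV. std_normal_density (b $ i)))"

definition gaussian_measure :: "((real ^ 'N ^ 'n) \<times> (real ^ 'n)) measure" where
  "gaussian_measure = density lebesgue (\<lambda>z. ennreal (gaussian_density z))"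

definition psi ::
    "(real ^ 'N) set \<Rightarrow> (real ^ 'N \<Rightarrow> real) \<Rightarrow> (real ^ 'N ^ 'n) \<times> (real ^ 'n) \<Rightarrow> real" where
  "psi M f z = gaussian_density z * f_bar M f z
     / (\<integral>w. f_bar M f w \<partial>(gaussian_measure :: ((real ^ 'N ^ 'n) \<times> (real ^ 'n)) measure))"

definition psi_measure ::
    "(real ^ 'N) set \<Rightarrow> (real ^ 'N \<Rightarrow> real) \<Rightarrow> ((real ^ 'N ^ 'n) \<times> (real ^ 'n)) measure" where
  "psi_measure M f = density lebesgue (\<lambda>z. ennreal (psi M f z))"

text \<open>
  The distribution on M of a point x of the intersection of M with the linear section given by
  \<open>(A, b)\<close>, chosen with probability \<open>f x / (\<alpha> x * f_bar (A, b))\<close>. If \<open>f_bar\<close> vanishes at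
  \<open>(A, b)\<close>, this is the null measure; such pairs have probability 0 under \<open>psi_measure\<close>.
\<close>
definition point_choice ::
    "(real ^ 'N) set \<Rightarrow> (real ^ 'N \<Rightarrow> real) \<Rightarrow> (real ^ 'N ^ 'n) \<times> (real ^ 'n) \<Rightarrow> (real ^ 'N) measure" where
  "point_choice M f = (\<lambda>(A, b).
     distr (point_measure (M \<inter> linear_section A b)
              (\<lambda>x. ennreal (f x / alpha CARD('n) M x / f_bar M f (A, b))))
           (volume_measure TYPE('n) M) (\<lambda>x. x))"

end

theory Submission
  imports Defs "HOL-Combinatorics.Permutations"
begin

text \<open>
  For a parametrization psi of a piece of M and a fixed matrix A, the map u to A psi(u) is a map
  between spaces of the same dimension n, and the points of the fibre over b are the points of M
  on the linear section. The area formula for it, weighted with the Gaussian density of b and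
  integrated over A, turns the expected sum over the section into an integral over u whose weight
  is the Gaussian mean of |det (A psi')| times the density of A psi(u). The shear by the inverse
  square root of 1 + x x^T removes the latter factor, and the mean of |det (A Q)| for Q with
  orthonormal columns follows from the case that M is the span of Q, which meets almost every
  linear section in a single point; so the weight is alpha times the Riemannian volume density. Critical values are negligible by Sard's theorem, and
  a section by a regular value is finite since the real zeros of a polynomial system at which its
  Jacobian is invertible are finite in number. The averaged weighted point count over random
  sections thereby also provides a measure on M with the right volume in every parametrization.
\<close>

section \<open>Change of variables over arbitrary finite index types\<close>

text \<open>The factors of \<open>alpha\<close> come from rank-one determinants. For a row a of A,
  its density times the Gaussian density of <a, x> is an unnormalized Gaussian with precision matrix
  1 + x x^T; whitening it costs (1 + |x|^2)^(-1/2) per row. What remains is the volume of the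
  whitened tangent frame Q: the determinant of Q^T (1 + x x^T)^(-1) Q is 1 - |Q^T x|^2 / (1 +
  |x|^2), that is, 1 plus the squared length of the normal part of x, over 1 + |x|^2. So the factor
  (1 + |x|^2)^(-1/2) occurs n + 1 times in all. The quotient of Gamma and the power of sqrt pi is
  the reciprocal of the integral of (1 + |y|^2)^(-(n+1)/2) over R^n. Finiteness is the obstacle that
  calls for algebra: fibres over regular values are discrete, but on an infinite discrete section
  \<open>sum\<close> would return 0 and falsify \<open>f_bar\<close>. Additivity and limits are
  therefore handled by \<open>section_sum\<close>, an integral over counting measure without such a
  default value, which is matched with \<open>f_bar\<close> only almost everywhere.\<close>

text \<open>The library proves Sard's theorem and the change of variables formula on real^'n only for index
  types of class wellorder; a well-ordered copy of the index type removes this restriction.\<close>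
typedef 'a wo = "UNIV :: 'a set" by simp

instance wo :: (finite) finite
proof
  have "(UNIV :: 'a wo set) = Abs_wo ` UNIV"
    by (metis Rep_wo_inverse surjI)
  then show "finite (UNIV :: 'a wo set)"
    by (metis finite finite_imageI)
qed

definition wo_index :: "'a::finite wo \<Rightarrow> nat" where
  "wo_index = (SOME f. inj f)"

lemma inj_wo_index: "inj wo_index"
proof -
  have "\<exists>f :: 'a wo \<Rightarrow> nat. inj f"
    using finite_imp_inj_to_nat_seg[of "UNIV :: 'a wo set"] by auto
  then show ?thesis
    unfolding wo_index_def by (rule someI_ex)
qed

instantiation wo :: (finite) wellorder
begin

definition "x \<le> y \<longleftrightarrow> wo_index x \<le> wo_index y"
definition "x < y \<longleftrightarrow> wo_index x < wo_index y"

instance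
proof (intro_classes, goal_cases)
  case (1 x y) then show ?case by (simp add: less_eq_wo_def less_wo_def less_le_not_le)
next
  case (2 x) then show ?case by (simp add: less_eq_wo_def)
next
  case (3 x y z) then show ?case by (simp add: less_eq_wo_def)
next
  case (4 x y) then show ?case by (simp add: less_eq_wo_def inj_eq[OF inj_wo_index])
next
  case (5 x y) then show ?case by (simp add: less_eq_wo_def linear)
next
  case (6 P a)
  show ?case
  proof (induction a rule: measure_induct_rule[of wo_index])
    case (less x)
    show ?case
    proof (rule 6)
      fix y assume "y < x"
      then show "P y" unfolding less_wo_def by (rule less)
    qed
  qed
qed

end

lemma bij_Rep_wo: "bij Rep_wo"
  by (metis Abs_wo_inverse Rep_wo_inverse UNIV_I bijI')

lemma all_wo: "(\<forall>i. P i) \<longleftrightarrow> (\<forall>i. P (Abs_wo i))"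
  by (metis Rep_wo_inverse)

text \<open>Conjugation by f carries the transposition of a and b to that of f a and f b, so signs
  agree by induction over a product of transpositions.\<close>

lemma sign_reindex:
  fixes f :: "'a::finite \<Rightarrow> 'b::finite"
  assumes f: "bij f" and p: "p permutes (UNIV::'a set)"
  shows "sign (f \<circ> p \<circ> inv f) = sign p"
  using p finite
proof (induction p rule: permutes_induct)
  case id
  then show ?case using f by (simp add: bij_is_surj surj_iff[THEN iffD1])
next
  case (swap a b p)
  have "f \<circ> (Transposition.transpose a b \<circ> p) \<circ> inv f
      = Transposition.transpose (f a) (f b) \<circ> (f \<circ> p \<circ> inv f)"
    using f by (auto simp: fun_eq_iff Transposition.transpose_def bij_inv_eq_iff inj_eq[OF bij_is_inj])
  moreover have "bij p" using swap permutes_bij by blast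
  moreover have "permutation (f \<circ> p \<circ> inv f)" "permutation p"
    using f \<open>bij p\<close> by (simp_all add: permutation bij_comp bij_imp_bij_inv del: o_apply)
  moreover have "f a = f b \<longleftrightarrow> a = b" using f by (simp add: inj_eq[OF bij_is_inj])
  ultimately show ?case
    using swap by (simp only: sign_compose permutation_swap_id sign_swap_id)
qed

text \<open>Conjugation by f is a bijection between the permutations of the two index sets; it keeps
  the sign and merely reorders the factors of each Leibniz term.\<close>

lemma det_reindex:
  fixes A :: "'a::comm_ring_1^'n^'n" and f :: "'m::finite \<Rightarrow> 'n"
  assumes f: "bij f"
  shows "det (\<chi> i j. A $ f i $ f j) = det A"
proof -
  have inj: "inj f" and surj: "surj f" using f by (auto simp: bij_def)
  have "det A = (\<Sum>p | p permutes (UNIV::'n set). of_int (sign p) * (\<Prod>i\<in>UNIV. A $ i $ p i))"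
    by (simp add: det_def)
  also have "\<dots> = (\<Sum>q | q permutes (UNIV::'m set).
      of_int (sign (f \<circ> q \<circ> inv f)) * (\<Prod>i\<in>UNIV. A $ i $ (f \<circ> q \<circ> inv f) i))"
  proof (rule sum.reindex_bij_witness[where j = "\<lambda>p. inv f \<circ> p \<circ> f" and i = "\<lambda>q. f \<circ> q \<circ> inv f"])
    fix p assume p: "p \<in> {p. p permutes (UNIV::'n set)}"
    show eq: "f \<circ> (inv f \<circ> p \<circ> f) \<circ> inv f = p"
      using surj by (auto simp: fun_eq_iff surj_f_inv_f)
    show "inv f \<circ> p \<circ> f \<in> {q. q permutes UNIV}"
    proof -
      have "bij p" using p permutes_bij by blast
      then have "bij (inv f \<circ> p \<circ> f)" by (intro bij_comp f bij_imp_bij_inv[OF f])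
      then show ?thesis by (intro CollectI bij_imp_permutes) simp_all
    qed
    show "of_int (sign (f \<circ> (inv f \<circ> p \<circ> f) \<circ> inv f)) *
         (\<Prod>i\<in>UNIV. A $ i $ (f \<circ> (inv f \<circ> p \<circ> f) \<circ> inv f) i) = of_int (sign p) * (\<Prod>i\<in>UNIV. A $ i $ p i)"
      unfolding eq ..
  next
    fix q assume q: "q \<in> {p. p permutes (UNIV::'m set)}"
    show "inv f \<circ> (f \<circ> q \<circ> inv f) \<circ> f = q"
      using inj by (auto simp: fun_eq_iff)
    show "f \<circ> q \<circ> inv f \<in> {p. p permutes UNIV}"
    proof -
      have "bij q" using q permutes_bij by blast
      then have "bij (f \<circ> q \<circ> inv f)" by (intro bij_comp f bij_imp_bij_inv[OF f])
      then show ?thesis by (intro CollectI bij_imp_permutes) simp_all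
    qed
  qed
  also have "\<dots> = (\<Sum>q | q permutes (UNIV::'m set). of_int (sign q) * (\<Prod>i\<in>UNIV. A $ f i $ f (q i)))"
  proof (rule sum.cong[OF refl])
    fix q assume q: "q \<in> {p. p permutes (UNIV::'m set)}"
    have "(\<Prod>i\<in>UNIV. A $ i $ (f \<circ> q \<circ> inv f) i) = (\<Prod>i\<in>UNIV. A $ f i $ f (q i))"
      by (rule prod.reindex_bij_betw[OF f, symmetric, THEN trans]) (simp add: inv_f_f[OF inj])
    then show "of_int (sign (f \<circ> q \<circ> inv f)) * (\<Prod>i\<in>UNIV. A $ i $ (f \<circ> q \<circ> inv f) i) =
         of_int (sign q) * (\<Prod>i\<in>UNIV. A $ f i $ f (q i))"
      using sign_reindex[OF f, of q] q by simp
  qed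
  finally show ?thesis by (simp add: det_def)
qed

section \<open>Vectors, Lebesgue measure and derivatives under a renaming of coordinates\<close>

definition to_wo :: "real ^ 'n \<Rightarrow> real ^ 'n wo" where "to_wo x = (\<chi> i. x $ Rep_wo i)"
definition of_wo :: "real ^ 'n wo \<Rightarrow> real ^ 'n" where "of_wo x = (\<chi> i. x $ Abs_wo i)"

lemma of_wo_to_wo [simp]: "of_wo (to_wo x) = x"
  by (simp add: of_wo_def to_wo_def Abs_wo_inverse)

lemma to_wo_of_wo [simp]: "to_wo (of_wo x) = x"
  by (simp add: of_wo_def to_wo_def Rep_wo_inverse)

lemma linear_to_wo: "linear to_wo"
  by (rule linearI) (auto simp: to_wo_def vec_eq_iff)

lemma linear_of_wo: "linear of_wo"
  by (rule linearI) (auto simp: of_wo_def vec_eq_iff)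

lemma of_wo_measurable [measurable]: "of_wo \<in> borel_measurable borel"
  by (intro borel_measurable_continuous_onI linear_continuous_on linear_conv_bounded_linear[THEN iffD1] linear_of_wo)

lemma Basis_vec: "(Basis :: (real^'n) set) = range (\<lambda>i. axis i 1)"
  by (auto simp: Basis_vec_def)

lemma prod_Basis_vec: "(\<Prod>b\<in>(Basis :: (real^'n) set). g (x \<bullet> b)) = (\<Prod>i\<in>UNIV. g (x $ i))"
proof -
  have "inj_on (\<lambda>i. axis i (1::real) :: real^'n) UNIV"
    by (auto simp: inj_on_def axis_eq_axis)
  then show ?thesis
    unfolding Basis_vec by (subst prod.reindex) (auto simp: inner_axis)
qed

lemma to_wo_image_eq: "to_wo ` X = of_wo -` X"
  by (metis (no_types, lifting) antisym image_eqI image_subsetI of_wo_to_wo subsetI to_wo_of_wo vimage_eq)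

text \<open>Renaming coordinates sends boxes to boxes with the same side lengths, and the measures
  of boxes determine \<open>lborel\<close>.\<close>

lemma lborel_of_wo: "(lborel :: (real^'n) measure) = distr lborel borel of_wo"
proof (rule lborel_eqI)
  fix l u :: "real^'n"
  assume le: "\<And>b. b \<in> Basis \<Longrightarrow> l \<bullet> b \<le> u \<bullet> b"
  have lu: "l $ i \<le> u $ i" for i using le[of "axis i 1"] by (auto simp: inner_axis Basis_vec)
  have "of_wo -` box l u = box (to_wo l) (to_wo u)"
    unfolding box_def Basis_vec
    by (auto simp: inner_axis of_wo_def to_wo_def Rep_wo_inverse all_wo[of "\<lambda>i. _ $ Rep_wo i < _ $ i \<and> _ $ i < _ $ Rep_wo i"] Abs_wo_inverse)
  then have "emeasure (distr lborel borel of_wo) (box l u) = emeasure lborel (box (to_wo l) (to_wo u))"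
    by (simp add: emeasure_distr)
  also have "\<dots> = (\<Prod>b\<in>Basis. (to_wo u - to_wo l) \<bullet> b)"
    by (subst emeasure_lborel_box) (auto simp: Basis_vec inner_axis to_wo_def lu)
  also have "(\<Prod>b\<in>Basis. (to_wo u - to_wo l) \<bullet> b) = (\<Prod>i\<in>UNIV. (u - l) $ Rep_wo i)"
    by (subst prod_Basis_vec) (simp add: to_wo_def)
  also have "\<dots> = (\<Prod>i\<in>UNIV. (u - l) $ i)"
    by (rule prod.reindex_bij_betw[OF bij_Rep_wo])
  also have "\<dots> = (\<Prod>b\<in>Basis. (u - l) \<bullet> b)"
    by (subst prod_Basis_vec) simp
  finally show "emeasure (distr lborel borel of_wo) (box l u) = (\<Prod>b\<in>Basis. (u - l) \<bullet> b)" .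
qed simp

lemma det_matrix_wo:
  fixes g' :: "real^'n \<Rightarrow> real^'n"
  shows "det (matrix (to_wo \<circ> g' \<circ> of_wo)) = det (matrix g')"
proof -
  have "of_wo (axis j 1) = axis (Rep_wo j) 1" for j :: "'n wo"
    by (auto simp: of_wo_def axis_def vec_eq_iff Abs_wo_inverse Rep_wo_inverse)
  then have "matrix (to_wo \<circ> g' \<circ> of_wo) = (\<chi> i j. matrix g' $ Rep_wo i $ Rep_wo j)"
    by (simp add: matrix_def to_wo_def)
  then show ?thesis
    by (simp add: det_reindex[OF bij_Rep_wo])
qed

lemma has_derivative_wo:
  assumes "(g has_derivative g') (at (of_wo x) within of_wo ` S)"
  shows "((to_wo \<circ> g \<circ> of_wo) has_derivative (to_wo \<circ> g' \<circ> of_wo)) (at x within S)"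
  unfolding comp_assoc
  by (intro diff_chain_within linear_imp_has_derivative linear_of_wo linear_to_wo assms)

text \<open>Sard's theorem is applied to the renamed map; the linear map \<open>of_wo\<close>
  between spaces of equal dimension carries negligibility back.\<close>

lemma Sard_equidim:
  fixes g :: "real^'n \<Rightarrow> real^'n"
  assumes der: "\<And>x. x \<in> S \<Longrightarrow> (g has_derivative g' x) (at x within S)"
    and det0: "\<And>x. x \<in> S \<Longrightarrow> det (matrix (g' x)) = 0"
  shows "negligible (g ` S)"
proof -
  have ofto: "of_wo ` to_wo ` S = S" by (auto simp: image_image)
  have "negligible ((to_wo \<circ> g \<circ> of_wo) ` to_wo ` S)"
  proof (rule baby_Sard)
    fix x assume "x \<in> to_wo ` S"
    then have x: "of_wo x \<in> S" by auto
    show "((to_wo \<circ> g \<circ> of_wo) has_derivative (to_wo \<circ> g' (of_wo x) \<circ> of_wo)) (at x within to_wo ` S)"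
      using der[OF x] by (intro has_derivative_wo) (simp add: ofto)
    have "det (matrix (to_wo \<circ> g' (of_wo x) \<circ> of_wo)) = 0"
      using det0[OF x] by (simp add: det_matrix_wo)
    then show "rank (matrix (to_wo \<circ> g' (of_wo x) \<circ> of_wo)) < CARD('n wo)"
      by (simp add: det_eq_0_rank)
  qed simp
  then have "negligible (of_wo ` (to_wo \<circ> g \<circ> of_wo) ` to_wo ` S)"
    by (rule negligible_differentiable_image_negligible[rotated])
       (auto simp: bij_betw_same_card[OF bij_Rep_wo] intro: linear_imp_differentiable_on linear_of_wo)
  then show ?thesis by (simp add: image_image)
qed


lemma emeasure_lborel_to_wo:
  fixes S :: "(real^'n) set"
  assumes "S \<in> sets borel"
  shows "emeasure lborel (to_wo ` S) = emeasure lborel S"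
  by (subst (2) lborel_of_wo) (simp add: emeasure_distr assms to_wo_image_eq)

text \<open>\<open>has_measure_differentiable_image\<close> speaks of finite values only. An
  infinite integral is covered by contraposition: an image of finite measure would make the Jacobian
  determinant integrable.\<close>

lemma emeasure_injective_image_wo:
  fixes g :: "real^'n::{finite,wellorder} \<Rightarrow> real^'n::_"
  assumes S: "S \<in> sets borel" and gS: "g ` S \<in> sets borel"
    and der: "\<And>x. x \<in> S \<Longrightarrow> (g has_derivative g' x) (at x within S)"
    and inj: "inj_on g S"
    and meas: "(\<lambda>x. \<bar>det (matrix (g' x))\<bar> * indicator S x) \<in> borel_measurable borel"
  shows "emeasure lborel (g ` S) = (\<integral>\<^sup>+x. ennreal (\<bar>det (matrix (g' x))\<bar> * indicator S x) \<partial>lborel)"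
proof -
  let ?D = "\<lambda>x. \<bar>det (matrix (g' x))\<bar> * indicator S x"
  have Sl: "S \<in> sets lebesgue" using S by simp
  have key: "g ` S \<in> lmeasurable \<and> measure lebesgue (g ` S) = m \<longleftrightarrow> (?D has_integral m) UNIV" for m
  proof -
    have "((\<lambda>x. \<bar>det (matrix (g' x))\<bar>) has_integral m) S \<longleftrightarrow>
      ((\<lambda>x. if x \<in> S then \<bar>det (matrix (g' x))\<bar> else 0) has_integral m) UNIV"
      by (rule has_integral_restrict_UNIV[symmetric])
    also have "(\<lambda>x. if x \<in> S then \<bar>det (matrix (g' x))\<bar> else 0) = ?D"
      by (auto simp: fun_eq_iff)
    finally show ?thesis
      using has_measure_differentiable_image[OF Sl der inj, of m] by blast
  qed
  have eml: "emeasure lebesgue (g ` S) = emeasure lborel (g ` S)" using gS by simp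
  show ?thesis
  proof (cases "(\<integral>\<^sup>+x. ennreal (?D x) \<partial>lborel) = \<infinity>")
    case True
    have "emeasure lborel (g ` S) = \<infinity>"
    proof (rule ccontr)
      assume "emeasure lborel (g ` S) \<noteq> \<infinity>"
      then have "g ` S \<in> lmeasurable"
        using gS eml by (auto simp: fmeasurable_def top.not_eq_extremum)
      then have "(?D has_integral (measure lebesgue (g ` S))) UNIV"
        using key by blast
      then have "integral\<^sup>N lborel ?D = measure lebesgue (g ` S)"
        by (intro nn_integral_has_integral_lborel) (use meas in auto)
      then show False using True by simp
    qed
    then show ?thesis using True by simp
  next
    case False
    then obtain r where r: "(\<integral>\<^sup>+x. ennreal (?D x) \<partial>lborel) = ennreal r" "0 \<le> r"
      by (cases "\<integral>\<^sup>+x. ennreal (?D x) \<partial>lborel" rule: ennreal_cases) auto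
    have "(?D has_integral r) UNIV"
      by (rule nn_integral_has_integral) (use meas r in auto)
    then have "g ` S \<in> lmeasurable" "measure lebesgue (g ` S) = r" using key by blast+
    then show ?thesis using r eml by (simp add: emeasure_eq_measure2)
  qed
qed

lemma emeasure_injective_image:
  fixes g :: "real^'n \<Rightarrow> real^'n"
  assumes S: "S \<in> sets borel" and gS: "g ` S \<in> sets borel"
    and der: "\<And>x. x \<in> S \<Longrightarrow> (g has_derivative g' x) (at x within S)"
    and inj: "inj_on g S"
    and meas[measurable]: "(\<lambda>x. \<bar>det (matrix (g' x))\<bar> * indicator S x) \<in> borel_measurable borel"
  shows "emeasure lborel (g ` S) = (\<integral>\<^sup>+x. ennreal (\<bar>det (matrix (g' x))\<bar> * indicator S x) \<partial>lborel)"
proof -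
  have ofto: "of_wo ` to_wo ` S = S" by (auto simp: image_image)
  have bor: "to_wo ` X \<in> sets borel" if "X \<in> sets borel" for X :: "(real^'n) set"
    using measurable_sets[OF of_wo_measurable that] by (simp add: to_wo_image_eq)
  have eq: "to_wo ` g ` S = (to_wo \<circ> g \<circ> of_wo) ` to_wo ` S"
    by (simp add: image_image)
  have ind: "indicator (to_wo ` S) x = (indicator S (of_wo x) :: real)" for x
    by (simp add: to_wo_image_eq indicator_def)
  have "emeasure lborel (g ` S) = emeasure lborel ((to_wo \<circ> g \<circ> of_wo) ` to_wo ` S)"
    using emeasure_lborel_to_wo[OF gS] by (simp add: eq)
  also have "\<dots> = (\<integral>\<^sup>+x. ennreal (\<bar>det (matrix (to_wo \<circ> g' (of_wo x) \<circ> of_wo))\<bar> * indicator (to_wo ` S) x) \<partial>lborel)"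
  proof (rule emeasure_injective_image_wo)
    show "to_wo ` S \<in> sets borel" by (rule bor[OF S])
    show "(to_wo \<circ> g \<circ> of_wo) ` to_wo ` S \<in> sets borel"
      using bor[OF gS] by (simp add: eq)
    show "((to_wo \<circ> g \<circ> of_wo) has_derivative (to_wo \<circ> g' (of_wo x) \<circ> of_wo)) (at x within to_wo ` S)"
      if "x \<in> to_wo ` S" for x
      using that der by (intro has_derivative_wo) (auto simp: ofto)
    show "inj_on (to_wo \<circ> g \<circ> of_wo) (to_wo ` S)"
      using inj by (auto simp: inj_on_def) (metis of_wo_to_wo)
    show "(\<lambda>x. \<bar>det (matrix (to_wo \<circ> g' (of_wo x) \<circ> of_wo))\<bar> * indicator (to_wo ` S) x) \<in> borel_measurable borel"
      unfolding det_matrix_wo ind by (rule measurable_compose[OF of_wo_measurable meas])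
  qed
  also have "\<dots> = (\<integral>\<^sup>+x. ennreal (\<bar>det (matrix (g' (of_wo x)))\<bar> * indicator S (of_wo x)) \<partial>lborel)"
    unfolding det_matrix_wo ind ..
  also have "\<dots> = (\<integral>\<^sup>+x. ennreal (\<bar>det (matrix (g' x))\<bar> * indicator S x) \<partial>distr lborel borel of_wo)"
    by (subst nn_integral_distr) auto
  finally show ?thesis by (simp add: lborel_of_wo[symmetric])
qed

text \<open>Two measures on the target are compared: Lebesgue measure on the image, and the
  push-forward of the Jacobian density. They agree on each Borel set B by the volume formula for the
  part of S that g maps into B.\<close>

lemma nn_integral_injective_image:
  fixes g :: "real^'n \<Rightarrow> real^'n" and q :: "real^'n \<Rightarrow> ennreal"
  assumes S[measurable]: "S \<in> sets borel" and gS[measurable]: "g ` S \<in> sets borel"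
    and der: "\<And>x. x \<in> S \<Longrightarrow> (g has_derivative g' x) (at x within S)"
    and inj: "inj_on g S"
    and meas[measurable]: "(\<lambda>x. \<bar>det (matrix (g' x))\<bar> * indicator S x) \<in> borel_measurable borel"
    and q[measurable]: "q \<in> borel_measurable borel"
  shows "(\<integral>\<^sup>+y. q y * indicator (g ` S) y \<partial>lborel) =
         (\<integral>\<^sup>+x. q (g x) * (ennreal \<bar>det (matrix (g' x))\<bar> * indicator S x) \<partial>lborel)"
proof -
  \<comment> \<open>The extension by 0 is Borel on the whole space, and the density
    \<open>?D\<close> vanishes where it differs from g.\<close>
  define g0 where "g0 x = (if x \<in> S then g x else 0)" for x
  let ?D = "\<lambda>x. ennreal (\<bar>det (matrix (g' x))\<bar> * indicator S x)"
  have "continuous_on S g"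
    using der by (meson continuous_on_eq_continuous_within has_derivative_continuous)
  then have g0[measurable]: "g0 \<in> borel_measurable borel"
    unfolding g0_def using S by (intro borel_measurable_continuous_on_if) auto
  have "density lborel (indicator (g ` S)) = distr (density lborel ?D) borel g0"
  proof (rule measure_eqI)
    fix B assume "B \<in> sets (density lborel (indicator (g ` S)))"
    then have B[measurable]: "B \<in> sets borel" by simp
    define T where "T = S \<inter> g0 -` B"
    have T[measurable]: "T \<in> sets borel"
      unfolding T_def using measurable_sets[OF g0 B] by auto
    \<comment> \<open>This makes the image of T Borel, given that the image of S is.\<close>
    have gT: "g ` T = g ` S \<inter> B" by (auto simp: T_def g0_def)
    have TS: "T \<subseteq> S" by (auto simp: T_def)
    have indT: "\<bar>det (matrix (g' x))\<bar> * indicator T x = \<bar>det (matrix (g' x))\<bar> * indicator S x * indicator T x" for x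
      using TS by (auto simp: indicator_def)
    have "emeasure (density lborel (indicator (g ` S))) B = emeasure lborel (g ` T)"
      by (subst emeasure_density) (auto simp: gT indicator_inter_arith[symmetric] nn_integral_indicator)
    also have "\<dots> = (\<integral>\<^sup>+x. ennreal (\<bar>det (matrix (g' x))\<bar> * indicator T x) \<partial>lborel)"
    proof (rule emeasure_injective_image)
      show "T \<in> sets borel" "g ` T \<in> sets borel" using gT by auto
      show "(g has_derivative g' x) (at x within T)" if "x \<in> T" for x
        using der that TS by (meson has_derivative_subset subsetD)
      show "inj_on g T" using inj TS by (rule inj_on_subset)
      show "(\<lambda>x. \<bar>det (matrix (g' x))\<bar> * indicator T x) \<in> borel_measurable borel"
        unfolding indT by measurable
    qed
    also have "\<dots> = (\<integral>\<^sup>+x. ?D x * indicator (g0 -` B) x \<partial>lborel)"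
      by (rule nn_integral_cong) (auto simp: T_def indicator_def)
    also have "\<dots> = emeasure (distr (density lborel ?D) borel g0) B"
      using measurable_sets[OF g0 B] by (simp add: emeasure_distr emeasure_density)
    finally show "emeasure (density lborel (indicator (g ` S))) B = emeasure (distr (density lborel ?D) borel g0) B" .
  qed simp
  then have "(\<integral>\<^sup>+y. q y \<partial>density lborel (indicator (g ` S))) = (\<integral>\<^sup>+y. q y \<partial>distr (density lborel ?D) borel g0)"
    by simp
  then have "(\<integral>\<^sup>+y. indicator (g ` S) y * q y \<partial>lborel) = (\<integral>\<^sup>+x. ?D x * q (g0 x) \<partial>lborel)"
    by (simp add: nn_integral_density nn_integral_distr)
  also have "\<dots> = (\<integral>\<^sup>+x. q (g x) * (ennreal \<bar>det (matrix (g' x))\<bar> * indicator S x) \<partial>lborel)"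
    by (rule nn_integral_cong) (auto simp: g0_def indicator_def mult.commute)
  finally show ?thesis by (simp add: mult.commute)
qed

lemma nn_integral_linear_change:
  fixes B :: "real^'n^'n" and q :: "real^'n \<Rightarrow> ennreal"
  assumes B: "det B \<noteq> 0" and q[measurable]: "q \<in> borel_measurable borel"
  shows "(\<integral>\<^sup>+y. q y \<partial>lborel) = ennreal \<bar>det B\<bar> * (\<integral>\<^sup>+x. q (B *v x) \<partial>lborel)"
proof -
  have inv: "invertible B" using B by (simp add: invertible_det_nz)
  then have surj: "range ((*v) B) = UNIV" and inj: "inj ((*v) B)"
    by (simp_all add: invertible_eq_bij bij_def)
  have [measurable]: "(*v) B \<in> borel_measurable borel"
    by (intro borel_measurable_continuous_onI matrix_vector_mult_linear_continuous_on)
  have "(\<integral>\<^sup>+y. q y * indicator (range ((*v) B)) y \<partial>lborel) =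
        (\<integral>\<^sup>+x. q (B *v x) * (ennreal \<bar>det (matrix ((*v) B))\<bar> * indicator UNIV x) \<partial>lborel)"
    by (rule nn_integral_injective_image)
       (auto simp: surj inj intro!: linear_imp_has_derivative)
  then show ?thesis
    by (simp add: surj nn_integral_multc nn_integral_cmult mult.commute)
qed

section \<open>Noetherian rings of functions\<close>

definition function_ring :: "('x \<Rightarrow> real) set \<Rightarrow> bool" where
  "function_ring R \<longleftrightarrow> (\<forall>c. (\<lambda>x. c) \<in> R) \<and>
     (\<forall>f\<in>R. \<forall>g\<in>R. (\<lambda>x. f x + g x) \<in> R \<and> (\<lambda>x. f x * g x) \<in> R)"

definition gen_ideal :: "('x \<Rightarrow> real) set \<Rightarrow> (nat \<Rightarrow> 'x \<Rightarrow> real) \<Rightarrow> nat \<Rightarrow> ('x \<Rightarrow> real) set" where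
  "gen_ideal R a m = {f. \<exists>r. (\<forall>k<m. r k \<in> R) \<and> f = (\<lambda>x. \<Sum>k<m. r k x * a k x)}"

text \<open>The ascending chain condition in terms of sequences. Both the basis theorem and the
  choice of finite subfamilies build a sequence none of whose members lies in the ideal of its
  predecessors.\<close>

definition noetherian :: "('x \<Rightarrow> real) set \<Rightarrow> bool" where
  "noetherian R \<longleftrightarrow> (\<forall>a. (\<forall>k. a k \<in> R) \<longrightarrow> (\<exists>m. a m \<in> gen_ideal R a m))"

text \<open>Here d counts coefficients: it is one more than a degree bound, and \<open>d = 0\<close>
  is left to the zero function. As g is a function and not an indeterminate, one function can have
  several representations.\<close>

definition poly_rep :: "('x \<Rightarrow> real) set \<Rightarrow> ('x \<Rightarrow> real) \<Rightarrow> nat \<Rightarrow> ('x \<Rightarrow> real) \<Rightarrow> bool" where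
  "poly_rep R g d f \<longleftrightarrow> (\<exists>c. (\<forall>i<d. c i \<in> R) \<and> f = (\<lambda>x. \<Sum>i<d. c i x * g x ^ i))"

definition adjoin :: "('x \<Rightarrow> real) set \<Rightarrow> ('x \<Rightarrow> real) \<Rightarrow> ('x \<Rightarrow> real) set" where
  "adjoin R g = {f. \<exists>d. poly_rep R g d f}"

lemma function_ring_sum:
  assumes "function_ring R" "finite I" "\<And>i. i \<in> I \<Longrightarrow> f i \<in> R"
  shows "(\<lambda>x. \<Sum>i\<in>I. f i x) \<in> R"
  using assms(2,3)
proof (induction I rule: finite_induct)
  case empty
  then show ?case using assms(1) by (simp add: function_ring_def)
next
  case (insert i I)
  then show ?case using assms(1) by (simp add: function_ring_def)
qed

lemma poly_rep_mono:
  assumes R: "function_ring R" and "poly_rep R g d f" "d \<le> d'"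
  shows "poly_rep R g d' f"
proof -
  from assms(2) obtain c where c: "\<And>i. i < d \<Longrightarrow> c i \<in> R" "f = (\<lambda>x. \<Sum>i<d. c i x * g x ^ i)"
    by (auto simp: poly_rep_def)
  let ?c = "\<lambda>i. if i < d then c i else (\<lambda>x. 0)"
  have "(\<Sum>i<d. c i x * g x ^ i) = (\<Sum>i<d'. ?c i x * g x ^ i)" for x
    using \<open>d \<le> d'\<close> by (intro sum.mono_neutral_cong_left) auto
  then have "f = (\<lambda>x. \<Sum>i<d'. ?c i x * g x ^ i)" using c by auto
  moreover have "\<forall>i<d'. ?c i \<in> R" using c R by (auto simp: function_ring_def)
  ultimately show ?thesis unfolding poly_rep_def by (intro exI[of _ ?c] conjI)
qed

lemma poly_rep_add:
  assumes R: "function_ring R" and f: "poly_rep R g d f" and f': "poly_rep R g d' f'"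
  shows "poly_rep R g (max d d') (\<lambda>x. f x + f' x)"
proof -
  obtain c where c: "\<forall>i<max d d'. c i \<in> R" "f = (\<lambda>x. \<Sum>i<max d d'. c i x * g x ^ i)"
    using poly_rep_mono[OF R f, of "max d d'"] by (auto simp: poly_rep_def)
  obtain c' where c': "\<forall>i<max d d'. c' i \<in> R" "f' = (\<lambda>x. \<Sum>i<max d d'. c' i x * g x ^ i)"
    using poly_rep_mono[OF R f', of "max d d'"] by (auto simp: poly_rep_def)
  show ?thesis unfolding poly_rep_def
    using c c' R
    by (intro exI[of _ "\<lambda>i x. c i x + c' i x"]) (auto simp: function_ring_def sum.distrib algebra_simps)
qed

lemma poly_rep_scale:
  assumes R: "function_ring R" and f: "poly_rep R g d f" and r: "r \<in> R"
  shows "poly_rep R g d (\<lambda>x. r x * f x)"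
proof -
  obtain c where c: "\<forall>i<d. c i \<in> R" "f = (\<lambda>x. \<Sum>i<d. c i x * g x ^ i)"
    using f by (auto simp: poly_rep_def)
  show ?thesis unfolding poly_rep_def
    using c R r by (intro exI[of _ "\<lambda>i x. r x * c i x"]) (auto simp: function_ring_def sum_distrib_left algebra_simps)
qed

lemma poly_rep_shift:
  assumes R: "function_ring R" and f: "poly_rep R g d f"
  shows "poly_rep R g (d + k) (\<lambda>x. g x ^ k * f x)"
proof -
  obtain c where c: "\<forall>i<d. c i \<in> R" "f = (\<lambda>x. \<Sum>i<d. c i x * g x ^ i)"
    using f by (auto simp: poly_rep_def)
  let ?c = "\<lambda>i. if k \<le> i then c (i - k) else (\<lambda>x. 0)"
  have "g x ^ k * (\<Sum>i<d. c i x * g x ^ i) = (\<Sum>i<d + k. ?c i x * g x ^ i)" for x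
  proof -
    have "(\<Sum>i<d + k. ?c i x * g x ^ i) = (\<Sum>i\<in>{k..<d + k}. ?c i x * g x ^ i)"
      by (rule sum.mono_neutral_right) auto
    also have "\<dots> = (\<Sum>i<d. ?c (i + k) x * g x ^ (i + k))"
      by (simp add: sum.shift_bounds_nat_ivl[of _ 0 k d, simplified] lessThan_atLeast0)
    finally show ?thesis by (simp add: sum_distrib_left power_add mult_ac)
  qed
  then show ?thesis unfolding poly_rep_def
    using c R by (intro exI[of _ ?c]) (auto simp: function_ring_def)
qed

lemma function_ring_adjoin:
  assumes R: "function_ring R"
  shows "function_ring (adjoin R g)" "R \<subseteq> adjoin R g" "g \<in> adjoin R g"
proof -
  show sub: "R \<subseteq> adjoin R g"
  proof
    fix f assume "f \<in> R"
    then have "poly_rep R g 1 f" unfolding poly_rep_def by (intro exI[of _ "\<lambda>_. f"]) auto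
    then show "f \<in> adjoin R g" by (auto simp: adjoin_def)
  qed
  have one: "(\<lambda>x. 1) \<in> R" using R by (auto simp: function_ring_def)
  have "poly_rep R g 1 (\<lambda>x. 1)" unfolding poly_rep_def using one by (intro exI[of _ "\<lambda>_ x. 1"]) auto
  from poly_rep_shift[OF R this, of 1] show "g \<in> adjoin R g" by (auto simp: adjoin_def)
  have mul: "(\<lambda>x. f x * f' x) \<in> adjoin R g" if f: "f \<in> adjoin R g" and f': "f' \<in> adjoin R g" for f f'
  proof -
    obtain c d where c: "\<forall>i<d. c i \<in> R" "f = (\<lambda>x. \<Sum>i<d. c i x * g x ^ i)"
      using f by (auto simp: adjoin_def poly_rep_def)
    have "(\<lambda>x. (\<Sum>i<k. c i x * g x ^ i) * f' x) \<in> adjoin R g" if "k \<le> d" for k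
      using that
    proof (induction k)
      case 0
      have "(\<lambda>x. 0) \<in> R" using R by (auto simp: function_ring_def)
      then show ?case using sub by auto
    next
      case (Suc k)
      obtain d' where "poly_rep R g d' f'" using f' by (auto simp: adjoin_def)
      then have 1: "poly_rep R g (d' + k) (\<lambda>x. c k x * (g x ^ k * f' x))"
        using Suc.prems c by (intro poly_rep_scale[OF R] poly_rep_shift[OF R]) auto
      obtain d2 where 2: "poly_rep R g d2 (\<lambda>x. (\<Sum>i<k. c i x * g x ^ i) * f' x)"
        using Suc by (auto simp: adjoin_def)
      show ?case using poly_rep_add[OF R 2 1] by (auto simp: adjoin_def algebra_simps)
    qed
    from this[of d] show ?thesis using c by simp
  qed
  have cst: "(\<lambda>x. c) \<in> adjoin R g" for c
    using R sub by (auto simp: function_ring_def)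
  have add: "(\<lambda>x. f x + f' x) \<in> adjoin R g" if "f \<in> adjoin R g" "f' \<in> adjoin R g" for f f'
    using that poly_rep_add[OF R] unfolding adjoin_def by blast
  show "function_ring (adjoin R g)"
    unfolding function_ring_def using cst add mul by blast
qed

lemma gen_ideal_mono:
  assumes R: "function_ring R" and "m \<le> m'"
  shows "gen_ideal R a m \<subseteq> gen_ideal R a m'"
proof
  fix f assume "f \<in> gen_ideal R a m"
  then obtain r where r: "\<forall>k<m. r k \<in> R" "f = (\<lambda>x. \<Sum>k<m. r k x * a k x)"
    by (auto simp: gen_ideal_def)
  let ?r = "\<lambda>i. if i < m then r i else (\<lambda>x. 0)"
  have "(\<Sum>k<m. r k x * a k x) = (\<Sum>k<m'. ?r k x * a k x)" for x
    using \<open>m \<le> m'\<close> by (intro sum.mono_neutral_cong_left) auto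
  then show "f \<in> gen_ideal R a m'" unfolding gen_ideal_def
    using r R by (intro CollectI exI[of _ ?r]) (auto simp: function_ring_def)
qed

lemma gen_ideal_add:
  assumes R: "function_ring R" and "f \<in> gen_ideal R a m" "f' \<in> gen_ideal R a m"
  shows "(\<lambda>x. f x + f' x) \<in> gen_ideal R a m"
proof -
  obtain r where r: "\<forall>k<m. r k \<in> R" "f = (\<lambda>x. \<Sum>k<m. r k x * a k x)"
    using assms by (auto simp: gen_ideal_def)
  obtain r' where r': "\<forall>k<m. r' k \<in> R" "f' = (\<lambda>x. \<Sum>k<m. r' k x * a k x)"
    using assms by (auto simp: gen_ideal_def)
  show ?thesis unfolding gen_ideal_def
    using r r' R by (intro CollectI exI[of _ "\<lambda>k x. r k x + r' k x"])
      (auto simp: function_ring_def sum.distrib algebra_simps)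
qed

lemma gen_ideal_scale:
  assumes R: "function_ring R" and "f \<in> gen_ideal R a m" "s \<in> R"
  shows "(\<lambda>x. s x * f x) \<in> gen_ideal R a m"
proof -
  obtain r where r: "\<forall>k<m. r k \<in> R" "f = (\<lambda>x. \<Sum>k<m. r k x * a k x)"
    using assms by (auto simp: gen_ideal_def)
  show ?thesis unfolding gen_ideal_def
    using r assms by (intro CollectI exI[of _ "\<lambda>k x. s x * r k x"])
      (auto simp: function_ring_def sum_distrib_left algebra_simps)
qed

lemma gen_ideal_zero: "function_ring R \<Longrightarrow> (\<lambda>x. 0) \<in> gen_ideal R a m"
  unfolding gen_ideal_def
  by (intro CollectI exI[of _ "\<lambda>k x. 0"]) (auto simp: function_ring_def)

lemma gen_ideal_sum:
  assumes R: "function_ring R" and "finite K" "\<And>k. k \<in> K \<Longrightarrow> f k \<in> gen_ideal R a m"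
  shows "(\<lambda>x. \<Sum>k\<in>K. f k x) \<in> gen_ideal R a m"
  using assms(2,3)
proof (induction K rule: finite_induct)
  case empty
  then show ?case using gen_ideal_zero[OF R] by simp
next
  case (insert k K)
  then show ?case using gen_ideal_add[OF R] by simp
qed

lemma gen_ideal_base:
  assumes R: "function_ring R" and "k < m"
  shows "a k \<in> gen_ideal R a m"
proof -
  have "(\<Sum>j<m. (if j = k then 1 else 0) * a j x) = a k x" for x
    using \<open>k < m\<close> by (simp add: if_distrib[of "\<lambda>z. z * _"] sum.delta cong: if_cong)
  then show ?thesis unfolding gen_ideal_def using R
    by (intro CollectI exI[of _ "\<lambda>j x. if j = k then 1 else 0"]) (auto simp: function_ring_def)
qed

text \<open>Hilbert's basis theorem: elements of minimal degree outside the ideal generated by their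
  predecessors have leading coefficients that violate the Noetherian property of R.\<close>
lemma noetherian_adjoin:
  fixes R :: "('x \<Rightarrow> real) set"
  assumes R: "function_ring R" and N: "noetherian R"
  shows "noetherian (adjoin R g)"
  unfolding noetherian_def
proof (intro allI impI, rule ccontr)
  let ?A = "adjoin R g"
  note A = function_ring_adjoin[OF R, of g]
  fix s :: "nat \<Rightarrow> 'x \<Rightarrow> real"
  assume s: "\<forall>k. s k \<in> ?A" and "\<nexists>m. s m \<in> gen_ideal ?A s m"
  then have s_not: "s m \<notin> gen_ideal ?A s m" for m by blast
  define I where "I = (\<Union>m. gen_ideal ?A s m)"
  \<comment> \<open>Representations are not unique, so the degree has to be a minimum over all of
    them; it is shifted by one, as d counts coefficients.\<close>
  define dg where "dg f = (LEAST d. poly_rep R g d f)" for f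
  have I_sub: "I \<subseteq> ?A"
  proof
    fix f assume "f \<in> I"
    then obtain m r where "\<forall>k<m. r k \<in> ?A" "f = (\<lambda>x. \<Sum>k<m. r k x * s k x)"
      by (auto simp: I_def gen_ideal_def)
    moreover from this have "(\<lambda>x. \<Sum>k<m. r k x * s k x) \<in> ?A"
      using s A(1) by (intro function_ring_sum[OF A(1)]) (auto simp: function_ring_def)
    ultimately show "f \<in> ?A" by simp
  qed
  have dg: "poly_rep R g (dg f) f" if "f \<in> I" for f
    unfolding dg_def by (rule LeastI_ex) (use that I_sub in \<open>auto simp: adjoin_def\<close>)
  \<comment> \<open>Finitely many members of I already lie in one stage of the chain given by s, so
    s always supplies a further member of I outside the ideal that they generate.\<close>
  have I_fin: "\<exists>M. \<forall>k<m. f k \<in> gen_ideal ?A s M" if "\<And>k. k < m \<Longrightarrow> f k \<in> I" for f and m :: nat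
    using that
  proof (induction m)
    case (Suc m)
    then obtain M where M: "\<forall>k<m. f k \<in> gen_ideal ?A s M" by auto
    obtain M' where M': "f m \<in> gen_ideal ?A s M'" using Suc.prems[of m] by (auto simp: I_def)
    have "\<forall>k<Suc m. f k \<in> gen_ideal ?A s (max M M')"
      using M M' gen_ideal_mono[OF A(1), of M "max M M'" s] gen_ideal_mono[OF A(1), of M' "max M M'" s]
      by (auto simp: less_Suc_eq)
    then show ?case by blast
  qed auto
  have "\<exists>f. \<forall>m. f m \<in> I \<and> f m \<notin> gen_ideal ?A f m \<and> (\<forall>h\<in>I. h \<notin> gen_ideal ?A f m \<longrightarrow> dg (f m) \<le> dg h)"
  proof (rule dependent_wellorder_choice)
    fix r and f f' :: "nat \<Rightarrow> 'x \<Rightarrow> real" and m :: nat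
    assume "\<And>k. k < m \<Longrightarrow> f k = f' k"
    then have "(\<Sum>k<m. r k x * f k x) = (\<Sum>k<m. r k x * f' k x)" for r x
      by (intro sum.cong) auto
    then have "gen_ideal ?A f m = gen_ideal ?A f' m"
      by (simp add: gen_ideal_def)
    then show "(r \<in> I \<and> r \<notin> gen_ideal ?A f m \<and> (\<forall>h\<in>I. h \<notin> gen_ideal ?A f m \<longrightarrow> dg r \<le> dg h)) =
       (r \<in> I \<and> r \<notin> gen_ideal ?A f' m \<and> (\<forall>h\<in>I. h \<notin> gen_ideal ?A f' m \<longrightarrow> dg r \<le> dg h))"
      by simp
  next
    fix m and f :: "nat \<Rightarrow> 'x \<Rightarrow> real"
    assume *: "\<And>k. k < m \<Longrightarrow> f k \<in> I \<and> f k \<notin> gen_ideal ?A f k \<and>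
      (\<forall>h\<in>I. h \<notin> gen_ideal ?A f k \<longrightarrow> dg (f k) \<le> dg h)"
    then have "\<And>k. k < m \<Longrightarrow> f k \<in> I" by blast
    from I_fin[of m f, OF this] obtain M where M: "\<forall>k<m. f k \<in> gen_ideal ?A s M" by blast
    have "gen_ideal ?A f m \<subseteq> gen_ideal ?A s M"
    proof
      fix h assume "h \<in> gen_ideal ?A f m"
      then obtain r where "\<forall>k<m. r k \<in> ?A" "h = (\<lambda>x. \<Sum>k<m. r k x * f k x)"
        by (auto simp: gen_ideal_def)
      moreover from this have "(\<lambda>x. \<Sum>k<m. r k x * f k x) \<in> gen_ideal ?A s M"
        using M by (intro gen_ideal_sum[OF A(1)] gen_ideal_scale[OF A(1)]) auto
      ultimately show "h \<in> gen_ideal ?A s M" by simp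
    qed
    then have "s M \<notin> gen_ideal ?A f m" using s_not by blast
    moreover have "s M \<in> I"
      unfolding I_def using gen_ideal_base[OF A(1), of M "Suc M" s] by auto
    ultimately have ex: "\<exists>h. h \<in> I \<and> h \<notin> gen_ideal ?A f m" by blast
    from exists_least_iff[of "\<lambda>n. \<exists>h. h \<in> I \<and> h \<notin> gen_ideal ?A f m \<and> dg h = n"] ex
    obtain n where "\<exists>h. h \<in> I \<and> h \<notin> gen_ideal ?A f m \<and> dg h = n"
      and "\<And>k. k < n \<Longrightarrow> \<not> (\<exists>h. h \<in> I \<and> h \<notin> gen_ideal ?A f m \<and> dg h = k)" by auto
    then show "\<exists>r. r \<in> I \<and> r \<notin> gen_ideal ?A f m \<and> (\<forall>h\<in>I. h \<notin> gen_ideal ?A f m \<longrightarrow> dg r \<le> dg h)"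
      by (metis not_le_imp_less)
  qed
  then obtain f where fI: "\<And>m. f m \<in> I" and f_not: "\<And>m. f m \<notin> gen_ideal ?A f m"
    and f_min: "\<And>m h. h \<in> I \<Longrightarrow> h \<notin> gen_ideal ?A f m \<Longrightarrow> dg (f m) \<le> dg h"
    by blast
  \<comment> \<open>\<open>f m\<close> was already a candidate when \<open>f k\<close> was chosen,
    so minimality of \<open>f k\<close> applies to it.\<close>
  have dg_mono: "dg (f k) \<le> dg (f m)" if "k \<le> m" for k m
    using f_min[OF fI[of m], of k] f_not[of m] gen_ideal_mono[OF A(1) that, of f] by blast
  have "\<exists>c. (\<forall>i<dg (f m). c i \<in> R) \<and> f m = (\<lambda>x. \<Sum>i<dg (f m). c i x * g x ^ i)" for m
    using dg[OF fI[of m]] by (simp add: poly_rep_def)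
  then obtain c where c: "\<And>m i. i < dg (f m) \<Longrightarrow> c m i \<in> R"
    "\<And>m. f m = (\<lambda>x. \<Sum>i<dg (f m). c m i x * g x ^ i)"
    by metis
  have dpos: "0 < dg (f m)" for m
  proof (rule ccontr)
    assume "\<not> 0 < dg (f m)"
    then have "f m = (\<lambda>x. 0)" by (subst c(2)) simp
    then show False using f_not[of m] gen_ideal_zero[OF A(1)] by metis
  qed
  define a where "a m = c m (dg (f m) - 1)" for m
  have "\<forall>m. a m \<in> R" using c(1) dpos by (simp add: a_def)
  then obtain m where "a m \<in> gen_ideal R a m" using N by (auto simp: noetherian_def)
  then obtain r where r: "\<And>k. k < m \<Longrightarrow> r k \<in> R" and am: "a m = (\<lambda>x. \<Sum>k<m. r k x * a k x)"
    by (auto simp: gen_ideal_def)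
  define D where "D = dg (f m) - 1"
  define low where "low k x = (\<Sum>i<dg (f k) - 1. c k i x * g x ^ i)" for k x
  have split: "f k x = low k x + a k x * g x ^ (dg (f k) - 1)" for k x
  proof -
    have "dg (f k) = Suc (dg (f k) - 1)" using dpos[of k] by simp
    then have "(\<Sum>i<dg (f k). c k i x * g x ^ i) = (\<Sum>i<Suc (dg (f k) - 1). c k i x * g x ^ i)"
      by simp
    then show ?thesis by (subst c(2)) (simp add: low_def a_def)
  qed
  have low_rep: "poly_rep R g (dg (f k) - 1) (low k)" for k
    unfolding poly_rep_def low_def[abs_def] using c(1) by (intro exI[of _ "c k"]) auto
  \<comment> \<open>Multiples of the earlier members, raised to the degree of \<open>f m\<close> by
    powers of g, cancel its leading coefficient. So h has smaller degree, yet it differs from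
    \<open>f m\<close> by an element of the ideal and hence is still outside of it, against the
    minimality of \<open>f m\<close>.\<close>
  define h where "h x = f m x + (\<Sum>k<m. (-1) * (r k x * (g x ^ (dg (f m) - dg (f k)) * f k x)))" for x
  have h_eq: "h x = low m x + (\<Sum>k<m. (-1) * (r k x * (g x ^ (dg (f m) - dg (f k)) * low k x)))" for x
  proof -
    have "g x ^ (dg (f m) - dg (f k)) * g x ^ (dg (f k) - 1) = g x ^ D" if "k < m" for k
      using dg_mono[of k m] dpos[of k] that by (simp add: D_def power_add[symmetric])
    then have "g x ^ (dg (f m) - dg (f k)) * f k x = g x ^ (dg (f m) - dg (f k)) * low k x + a k x * g x ^ D"
      if "k < m" for k
      using that by (subst split) (simp add: algebra_simps)
    then have "h x = low m x + a m x * g x ^ D +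
      (\<Sum>k<m. (-1) * (r k x * (g x ^ (dg (f m) - dg (f k)) * low k x + a k x * g x ^ D)))"
      by (simp add: h_def split[of m] D_def)
    also have "\<dots> = low m x + a m x * g x ^ D - (\<Sum>k<m. r k x * a k x) * g x ^ D +
      (\<Sum>k<m. (-1) * (r k x * (g x ^ (dg (f m) - dg (f k)) * low k x)))"
      by (simp add: distrib_left sum_distrib_right sum_distrib_left sum.distrib sum_negf sum_subtractf mult_ac)
    finally show ?thesis using am by (simp add: fun_eq_iff)
  qed
  have sum_rep: "poly_rep R g D (\<lambda>x. \<Sum>k<j. (-1) * (r k x * (g x ^ (dg (f m) - dg (f k)) * low k x)))" if "j \<le> m" for j
    using that
  proof (induction j)
    case 0
    then show ?case unfolding poly_rep_def using R
      by (intro exI[of _ "\<lambda>_ x. 0"]) (auto simp: function_ring_def)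
  next
    case (Suc j)
    have e: "dg (f j) - 1 + (dg (f m) - dg (f j)) = D"
      using dg_mono[of j m] dpos[of j] Suc.prems by (simp add: D_def)
    have m1: "(\<lambda>x. -1) \<in> R" using R by (auto simp: function_ring_def)
    have "poly_rep R g D (\<lambda>x. g x ^ (dg (f m) - dg (f j)) * low j x)"
      using poly_rep_shift[OF R low_rep[of j], of "dg (f m) - dg (f j)"] unfolding e .
    then have "poly_rep R g D (\<lambda>x. (-1) * (r j x * (g x ^ (dg (f m) - dg (f j)) * low j x)))"
      using r[of j] Suc.prems m1
      by (intro poly_rep_scale[OF R, where r = "\<lambda>x. -1"] poly_rep_scale[OF R, where r = "r j"]) auto
    from poly_rep_add[OF R Suc.IH this] Suc.prems show ?case by simp
  qed
  have "poly_rep R g D h"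
    using poly_rep_add[OF R low_rep[of m] sum_rep[of m]] by (simp add: h_eq[abs_def] D_def)
  moreover have g_pow: "(\<lambda>x. g x ^ n) \<in> ?A" for n
    by (induction n) (use A in \<open>auto simp: function_ring_def\<close>)
  have rA: "r k \<in> ?A" if "k < m" for k using r that A(2) by auto
  have h_ideal: "(\<lambda>x. \<Sum>k<m. (-1) * (r k x * (g x ^ (dg (f m) - dg (f k)) * f k x))) \<in> gen_ideal ?A b M"
    if "\<forall>k<m. f k \<in> gen_ideal ?A b M" for b M
  proof (intro gen_ideal_sum[OF A(1)])
    fix k assume k: "k \<in> {..<m}"
    have m1: "(\<lambda>x. -1) \<in> ?A" using A by (auto simp: function_ring_def)
    show "(\<lambda>x. (-1) * (r k x * (g x ^ (dg (f m) - dg (f k)) * f k x))) \<in> gen_ideal ?A b M"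
      using k that rA[of k] m1 g_pow[of "dg (f m) - dg (f k)"]
      by (intro gen_ideal_scale[OF A(1), where s = "\<lambda>x. -1"] gen_ideal_scale[OF A(1), where s = "r k"]
          gen_ideal_scale[OF A(1), where s = "\<lambda>x. g x ^ (dg (f m) - dg (f k))"]) auto
  qed simp
  obtain M where M: "\<forall>k<Suc m. f k \<in> gen_ideal ?A s M" using I_fin[of "Suc m" f] fI by blast
  have "h \<in> gen_ideal ?A s M"
    unfolding h_def[abs_def] using M h_ideal[of s M] by (intro gen_ideal_add[OF A(1)]) auto
  then have "h \<in> I" by (auto simp: I_def)
  moreover have "h \<notin> gen_ideal ?A f m"
  proof
    assume hin: "h \<in> gen_ideal ?A f m"
    let ?t = "\<lambda>x. \<Sum>k<m. (-1) * (r k x * (g x ^ (dg (f m) - dg (f k)) * f k x))"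
    have "?t \<in> gen_ideal ?A f m" using h_ideal gen_ideal_base[OF A(1)] by blast
    then have "(\<lambda>x. -1 * ?t x) \<in> gen_ideal ?A f m"
      using A by (intro gen_ideal_scale[OF A(1), where s = "\<lambda>x. -1"]) (auto simp: function_ring_def)
    from gen_ideal_add[OF A(1) hin this] have "f m \<in> gen_ideal ?A f m"
      by (simp add: h_def)
    then show False using f_not by blast
  qed
  ultimately have "dg (f m) \<le> dg h" "dg h \<le> D"
    using f_min by (auto simp: dg_def intro: Least_le)
  then show False using dpos[of m] by (simp add: D_def)
qed

lemma noetherian_const: "noetherian (range (\<lambda>c (x::'x). c))"
  unfolding noetherian_def
proof (intro allI impI)
  fix a :: "nat \<Rightarrow> 'x \<Rightarrow> real"
  assume "\<forall>k. a k \<in> range (\<lambda>c x. c)"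
  then have "\<forall>k. \<exists>c. a k = (\<lambda>x. c)" by blast
  then obtain c where c: "\<And>k. a k = (\<lambda>x. c k)" by metis
  show "\<exists>m. a m \<in> gen_ideal (range (\<lambda>c x. c)) a m"
  proof (cases "c 0 = 0")
    case True
    then show ?thesis by (intro exI[of _ 0]) (auto simp: gen_ideal_def c)
  next
    case False
    then show ?thesis
      by (intro exI[of _ 1]) (auto simp: gen_ideal_def c intro!: exI[of _ "\<lambda>_ x. c 1 / c 0"])
  qed
qed

text \<open>Starting from the constants, the coordinate functions are adjoined one at a
  time.\<close>

lemma polynomial_functions_noetherian:
  obtains R :: "(real^'N \<Rightarrow> real) set" where "function_ring R" "noetherian R"
    "\<And>p. real_polynomial_function p \<Longrightarrow> p \<in> R"
proof -
  have "\<exists>R :: (real^'N \<Rightarrow> real) set. function_ring R \<and> noetherian R \<and> (\<forall>i\<in>S. (\<lambda>x. x $ i) \<in> R)"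
    if "finite S" for S :: "'N set"
    using that
  proof (induction S rule: finite_induct)
    case empty
    then show ?case
      using noetherian_const by (intro exI[of _ "range (\<lambda>c x. c)"]) (auto simp: function_ring_def)
  next
    case (insert i S)
    then obtain R :: "(real^'N \<Rightarrow> real) set"
      where R: "function_ring R" "noetherian R" "\<forall>i\<in>S. (\<lambda>x. x $ i) \<in> R" by blast
    show ?case
      using function_ring_adjoin[OF R(1), of "\<lambda>x. x $ i"] noetherian_adjoin[OF R(1,2), of "\<lambda>x. x $ i"] R(3)
      by (intro exI[of _ "adjoin R (\<lambda>x. x $ i)"]) auto
  qed
  from this[of UNIV] obtain R :: "(real^'N \<Rightarrow> real) set"
    where R: "function_ring R" "noetherian R" "\<And>i. (\<lambda>x. x $ i) \<in> R" by auto
  have "p \<in> R" if "real_polynomial_function p" for p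
    using that
  proof (induction rule: real_polynomial_function.induct)
    case (linear f)
    have "f = (\<lambda>x. \<Sum>i\<in>UNIV. x $ i * f (axis i 1))"
    proof
      fix x
      have "f x = f (\<Sum>i\<in>UNIV. x $ i *\<^sub>R axis i 1)" by (metis basis_expansion scalar_mult_eq_scaleR)
      also have "\<dots> = (\<Sum>i\<in>UNIV. x $ i * f (axis i 1))"
        using linear by (simp add: linear_sum[OF bounded_linear.linear] linear_cmul[OF bounded_linear.linear])
      finally show "f x = (\<Sum>i\<in>UNIV. x $ i * f (axis i 1))" .
    qed
    moreover have "(\<lambda>x. \<Sum>i\<in>UNIV. x $ i * f (axis i 1)) \<in> R"
      using R by (intro function_ring_sum[OF R(1)]) (auto simp: function_ring_def)
    ultimately show ?case by simp
  qed (use R in \<open>auto simp: function_ring_def\<close>)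
  with R show ?thesis using that by blast
qed

text \<open>Otherwise one could go on choosing a member together with a point at which it is nonzero
  while all earlier members vanish; such a member never lies in the ideal of its
  predecessors.\<close>

lemma finite_subfamily_same_zeros:
  fixes \<H> :: "(real^'N \<Rightarrow> real) set"
  assumes poly: "\<And>h. h \<in> \<H> \<Longrightarrow> real_polynomial_function h"
  shows "\<exists>F\<subseteq>\<H>. finite F \<and> (\<forall>h\<in>\<H>. \<forall>x. h x \<noteq> 0 \<longrightarrow> (\<exists>f\<in>F. f x \<noteq> 0))"
proof (rule ccontr)
  assume no: "\<not> ?thesis"
  have step: "\<exists>h\<in>\<H>. \<exists>x. h x \<noteq> 0 \<and> (\<forall>f\<in>F. f x = 0)" if "F \<subseteq> \<H>" "finite F" for F
    using no that by meson
  have "\<exists>f. \<forall>m::nat. f m \<in> \<H> \<and> (\<exists>x. f m x \<noteq> 0 \<and> (\<forall>k<m. f k x = 0))"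
  proof (rule dependent_wellorder_choice)
    fix m :: nat and f
    assume *: "\<And>k. k < m \<Longrightarrow> f k \<in> \<H> \<and> (\<exists>x. f k x \<noteq> 0 \<and> (\<forall>j<k. f j x = 0))"
    then have "f ` {..<m} \<subseteq> \<H>" by auto
    from step[OF this] show "\<exists>r. r \<in> \<H> \<and> (\<exists>x. r x \<noteq> 0 \<and> (\<forall>k<m. f k x = 0))" by auto
  qed auto
  then obtain f where f: "\<And>m::nat. f m \<in> \<H>" "\<And>m. \<exists>x. f m x \<noteq> 0 \<and> (\<forall>k<m. f k x = 0)" by blast
  obtain R :: "(real^'N \<Rightarrow> real) set" where R: "noetherian R"
    "\<And>p. real_polynomial_function p \<Longrightarrow> p \<in> R"
    using polynomial_functions_noetherian by metis
  obtain m where "f m \<in> gen_ideal R f m" using R f poly by (force simp: noetherian_def)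
  then obtain r where r: "f m = (\<lambda>x. \<Sum>k<m. r k x * f k x)" by (auto simp: gen_ideal_def)
  obtain x where "f m x \<noteq> 0" "\<forall>k<m. f k x = 0" using f by blast
  then show False using r by simp
qed

section \<open>Zeros of polynomials\<close>

lemma finite_zeros_real_polynomial_function:
  fixes q :: "real \<Rightarrow> real"
  assumes "real_polynomial_function q" "q t0 \<noteq> 0"
  shows "finite {t. q t = 0}"
proof -
  obtain a n where q: "q = (\<lambda>x. \<Sum>i\<le>n. a i * x ^ i)"
    using assms(1) real_polynomial_function_iff_sum by blast
  have "\<exists>i\<le>n. a i \<noteq> 0"
  proof (rule ccontr)
    assume "\<not> ?thesis"
    then have "q t0 = 0" by (simp add: q)
    then show False using assms(2) by simp
  qed
  then show ?thesis unfolding q by (subst polyfun_finite_roots) auto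
qed

lemma real_polynomial_function_continuous:
  "real_polynomial_function p \<Longrightarrow> continuous_on A p"
  by (simp add: continuous_on_polymonial_function real_polynomial_function_eq)

text \<open>Tonelli on the homothetic copies of the zero set centred at a point outside of it: each line
  through that point meets the zero set in finitely many points.\<close>
lemma null_sets_zeros_polynomial:
  fixes p :: "'a::euclidean_space \<Rightarrow> real"
  assumes p: "real_polynomial_function p" and x0: "p x0 \<noteq> 0"
  shows "{x. p x = 0} \<in> null_sets lborel"
proof -
  have cont: "continuous_on UNIV p" using p by (rule real_polynomial_function_continuous)
  have [measurable]: "p \<in> borel_measurable borel" using cont by (rule borel_measurable_continuous_onI)
  \<comment> \<open>The point at parameter t on the line from x0 in direction x is tested for being
    a zero. The interval [1, 2] has positive measure, so some t in it is good, and as t is nonzero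
    the homothety by t is invertible.\<close>
  define h :: "real \<Rightarrow> 'a \<Rightarrow> ennreal" where
    "h t x = indicator {1..2} t * indicator {0} (p (x0 + t *\<^sub>R x))" for t x
  have h_meas: "(\<lambda>(t, x). h t x) \<in> borel_measurable (lborel \<Otimes>\<^sub>M lborel)"
    unfolding h_def by measurable
  have line: "(\<integral>\<^sup>+t. h t x \<partial>lborel) = 0" for x
  proof -
    have "real_polynomial_function (p \<circ> (\<lambda>t. x0 + t *\<^sub>R x))"
      using p by (intro real_polynomial_function_compose polynomial_function_add polynomial_function_const
          polynomial_function_bounded_linear bounded_linear_scaleR_left)
    then have "finite {t. p (x0 + t *\<^sub>R x) = 0}"
      using finite_zeros_real_polynomial_function[of "p \<circ> (\<lambda>t. x0 + t *\<^sub>R x)" 0] x0 by simp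
    then have "AE t in lborel. t \<notin> {t. p (x0 + t *\<^sub>R x) = 0}"
      by (intro AE_not_in finite_imp_null_set_lborel)
    then have "AE t in lborel. h t x = 0" by eventually_elim (auto simp: h_def indicator_def)
    then show ?thesis
      by (subst nn_integral_0_iff_AE) (auto simp: h_def)
  qed
  interpret pair_sigma_finite "lborel :: real measure" "lborel :: 'a measure" ..
  have "(\<integral>\<^sup>+t. \<integral>\<^sup>+x. h t x \<partial>lborel \<partial>lborel) = (\<integral>\<^sup>+x. \<integral>\<^sup>+t. h t x \<partial>lborel \<partial>lborel)"
    using lborel_pair.Fubini'[OF h_meas] by simp
  then have "(\<integral>\<^sup>+t. \<integral>\<^sup>+x. h t x \<partial>lborel \<partial>lborel) = 0" by (simp add: line)
  then have AE0: "AE t in lborel. (\<integral>\<^sup>+x. h t x \<partial>lborel) = 0"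
    using lborel.borel_measurable_nn_integral[OF h_meas] by (subst (asm) nn_integral_0_iff_AE) simp_all
  have "\<exists>t\<in>{1..2}. (\<integral>\<^sup>+x. h t x \<partial>lborel) = 0"
  proof (rule ccontr)
    assume "\<not> ?thesis"
    with AE0 have "AE t in lborel. t \<notin> {1..2::real}" by (auto elim: eventually_mono)
    then have "{1..2::real} \<in> null_sets lborel" by (subst (asm) AE_iff_null_sets[symmetric]) auto
    then show False by (auto simp: null_sets_def)
  qed
  then obtain t where t: "t \<in> {1..2}" "(\<integral>\<^sup>+x. h t x \<partial>lborel) = 0" by blast
  have "emeasure lborel {x. p x = 0} =
    emeasure (density (distr lborel borel (\<lambda>x. x0 + t *\<^sub>R x)) (\<lambda>_. \<bar>t\<bar>^DIM('a))) {x. p x = 0}"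
    using t by (subst lborel_affine[of t x0, symmetric]) auto
  also have "\<dots> = (\<integral>\<^sup>+x. ennreal (\<bar>t\<bar>^DIM('a)) * h t x \<partial>lborel)"
    using t(1) by (subst emeasure_density) (auto simp: nn_integral_distr h_def indicator_def intro!: nn_integral_cong)
  also have "\<dots> = ennreal (\<bar>t\<bar>^DIM('a)) * (\<integral>\<^sup>+x. h t x \<partial>lborel)"
    by (rule nn_integral_cmult) (simp add: h_def)
  also have "\<dots> = 0" using t(2) by simp
  finally show ?thesis by (auto simp: null_sets_def)
qed

section \<open>Monomials and degree bounds in several variables\<close>

definition mono_fun :: "('N \<Rightarrow> nat) \<Rightarrow> real^'N \<Rightarrow> real" where
  "mono_fun e x = (\<Prod>i\<in>UNIV. x $ i ^ e i)"

text \<open>The bound is on each exponent separately rather than on the total degree, which makes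
  the number of monomials a plain power of d + 1.\<close>

definition exps :: "nat \<Rightarrow> ('N \<Rightarrow> nat) set" where
  "exps d = {e. \<forall>i. e i \<le> d}"

lemma exps_eq: "exps d = PiE UNIV (\<lambda>_. {..d})"
  by (auto simp: exps_def PiE_def)

lemma finite_exps [simp]: "finite (exps d :: ('N::finite \<Rightarrow> nat) set)"
  unfolding exps_eq by (rule finite_PiE) auto

lemma card_exps: "card (exps d :: ('N::finite \<Rightarrow> nat) set) = (d + 1) ^ CARD('N)"
  unfolding exps_eq by (subst card_PiE) auto

lemma real_polynomial_function_component [intro]: "real_polynomial_function (\<lambda>x::real^'N. x $ i)"
  by (rule real_polynomial_function.intros(1)) (rule bounded_linear_vec_nth)

lemma real_polynomial_function_mono_fun [intro]: "real_polynomial_function (mono_fun e)"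
  unfolding mono_fun_def[abs_def]
  by (intro real_polynomial_function_prod real_polynomial_function_power real_polynomial_function_component) auto

definition has_deg :: "nat \<Rightarrow> (real^'N \<Rightarrow> real) \<Rightarrow> bool" where
  "has_deg d p \<longleftrightarrow> (\<exists>c. \<forall>x. p x = (\<Sum>e\<in>exps d. c e * mono_fun e x))"

lemma has_deg_mono:
  assumes "has_deg d p" "d \<le> d'"
  shows "has_deg d' p"
proof -
  obtain c where c: "\<And>x. p x = (\<Sum>e\<in>exps d. c e * mono_fun e x)"
    using assms(1) by (auto simp: has_deg_def)
  have "exps d \<subseteq> (exps d' :: ('a \<Rightarrow> nat) set)" using assms(2) by (auto simp: exps_def intro: order_trans)
  then have "\<forall>x. p x = (\<Sum>e\<in>exps d'. (if e \<in> exps d then c e else 0) * mono_fun e x)"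
    unfolding c by (intro allI sum.mono_neutral_cong_left) auto
  then show ?thesis unfolding has_deg_def
    by (intro exI[of _ "\<lambda>e. if e \<in> exps d then c e else 0"])
qed

lemma has_deg_const: "has_deg 0 (\<lambda>x. a)"
proof -
  have "exps 0 = {\<lambda>i::'a. 0}" by (auto simp: exps_def)
  then show ?thesis unfolding has_deg_def by (intro exI[of _ "\<lambda>_. a"]) (auto simp: mono_fun_def)
qed

lemma has_deg_add:
  assumes "has_deg d p" "has_deg d q"
  shows "has_deg d (\<lambda>x. p x + q x)"
proof -
  obtain c where c: "\<And>x. p x = (\<Sum>e\<in>exps d. c e * mono_fun e x)"
    using assms(1) by (auto simp: has_deg_def)
  obtain c' where c': "\<And>x. q x = (\<Sum>e\<in>exps d. c' e * mono_fun e x)"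
    using assms(2) by (auto simp: has_deg_def)
  show ?thesis unfolding has_deg_def
    by (intro exI[of _ "\<lambda>e. c e + c' e"]) (auto simp: c c' sum.distrib algebra_simps)
qed

lemma mono_fun_mult: "mono_fun e x * mono_fun e' x = mono_fun (\<lambda>i. e i + e' i) x"
  by (simp add: mono_fun_def prod.distrib power_add)

lemma has_deg_mult:
  fixes p q :: "real^'N \<Rightarrow> real"
  assumes "has_deg d p" "has_deg d' q"
  shows "has_deg (d + d') (\<lambda>x. p x * q x)"
proof -
  obtain c where c: "\<And>x. p x = (\<Sum>e\<in>exps d. c e * mono_fun e x)"
    using assms(1) by (auto simp: has_deg_def)
  obtain c' where c': "\<And>x. q x = (\<Sum>e\<in>exps d'. c' e * mono_fun e x)"
    using assms(2) by (auto simp: has_deg_def)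
  let ?s = "\<lambda>(e, e'). (\<lambda>i. e i + e' i) :: 'N \<Rightarrow> nat"
  let ?S = "(exps d \<times> exps d') :: (('N \<Rightarrow> nat) \<times> ('N \<Rightarrow> nat)) set"
  have "p x * q x = (\<Sum>s\<in>exps (d + d'). (\<Sum>z\<in>{z\<in>?S. ?s z = s}. c (fst z) * c' (snd z)) * mono_fun s x)" for x
  proof -
    have "p x * q x = (\<Sum>z\<in>?S. c (fst z) * c' (snd z) * mono_fun (?s z) x)"
      unfolding c c' sum_product sum.cartesian_product
      by (intro sum.cong) (auto simp: mono_fun_mult[symmetric] algebra_simps)
    also have "\<dots> = (\<Sum>s\<in>exps (d + d'). \<Sum>z\<in>{z\<in>?S. ?s z = s}. c (fst z) * c' (snd z) * mono_fun (?s z) x)"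
      by (intro sum.group[symmetric] finite_cartesian_product finite_exps)
         (auto simp: exps_def intro: add_mono)
    also have "\<dots> = (\<Sum>s\<in>exps (d + d'). (\<Sum>z\<in>{z\<in>?S. ?s z = s}. c (fst z) * c' (snd z)) * mono_fun s x)"
      by (intro sum.cong refl) (auto simp: sum_distrib_right intro!: sum.cong)
    finally show ?thesis .
  qed
  then show ?thesis unfolding has_deg_def
    by (intro exI[of _ "\<lambda>s. \<Sum>z\<in>{z\<in>?S. ?s z = s}. c (fst z) * c' (snd z)"] allI)
qed

lemma has_deg_component: "has_deg 1 (\<lambda>x. x $ i)"
proof -
  let ?e = "\<lambda>j. if j = i then 1 else (0::nat)"
  have e: "?e \<in> exps 1" by (auto simp: exps_def)
  have "mono_fun ?e x = x $ i" for x
    by (simp add: mono_fun_def if_distrib[of "\<lambda>k. _ ^ k"] cong: if_cong)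
  then have "x $ i = (\<Sum>f\<in>exps 1. (if f = ?e then 1 else 0) * mono_fun f x)" for x
    using e by (simp add: if_distrib[of "\<lambda>k. k * _"] sum.delta' cong: if_cong)
  then show ?thesis unfolding has_deg_def
    by (intro exI[of _ "\<lambda>f. if f = ?e then 1 else 0"] allI)
qed

lemma has_deg_sum:
  assumes "finite I" "\<And>i. i \<in> I \<Longrightarrow> has_deg d (p i)"
  shows "has_deg d (\<lambda>x. \<Sum>i\<in>I. p i x)"
  using assms
proof (induction I rule: finite_induct)
  case empty
  then show ?case using has_deg_mono[OF has_deg_const, of d 0] by simp
next
  case (insert i I)
  then show ?case by (auto intro: has_deg_add)
qed

lemma has_deg_power: "has_deg d p \<Longrightarrow> has_deg (k * d) (\<lambda>x. p x ^ k)"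
proof (induction k)
  case 0
  then show ?case using has_deg_const[of 1] by simp
next
  case (Suc k)
  then show ?case using has_deg_mult[of d p "k * d" "\<lambda>x. p x ^ k"] by simp
qed

lemma has_deg_prod:
  assumes "finite I" "\<And>i. i \<in> I \<Longrightarrow> has_deg (d i) (p i)"
  shows "has_deg (\<Sum>i\<in>I. d i) (\<lambda>x. \<Prod>i\<in>I. p i x)"
  using assms
proof (induction I rule: finite_induct)
  case empty
  then show ?case using has_deg_const[of 1] by simp
next
  case (insert i I)
  then show ?case using has_deg_mult[of "d i" "p i"] by simp
qed

lemma real_polynomial_function_has_deg:
  fixes p :: "real^'N \<Rightarrow> real"
  assumes "real_polynomial_function p"
  obtains d where "has_deg d p"
proof -
  have "\<exists>d. has_deg d p"
    using assms
  proof (induction rule: real_polynomial_function.induct)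
    case (linear f)
    have "f = (\<lambda>x. \<Sum>i\<in>UNIV. f (axis i 1) * x $ i)"
    proof
      fix x
      have "f x = f (\<Sum>i\<in>UNIV. x $ i *\<^sub>R axis i 1)" by (metis basis_expansion scalar_mult_eq_scaleR)
      also have "\<dots> = (\<Sum>i\<in>UNIV. f (axis i 1) * x $ i)"
        using linear by (simp add: linear_sum[OF bounded_linear.linear] linear_cmul[OF bounded_linear.linear] mult.commute)
      finally show "f x = (\<Sum>i\<in>UNIV. f (axis i 1) * x $ i)" .
    qed
    moreover have "has_deg 1 (\<lambda>x. \<Sum>i\<in>UNIV. f (axis i 1) * x $ i)"
      using has_deg_mult[OF has_deg_const has_deg_component] by (intro has_deg_sum) auto
    ultimately show ?case by auto
  next
    case (const c)
    then show ?case using has_deg_const by blast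
  next
    case (add f g)
    then obtain d d' where "has_deg d f" "has_deg d' g" by blast
    then have "has_deg (max d d') (\<lambda>x. f x + g x)"
      by (intro has_deg_add) (auto intro: has_deg_mono)
    then show ?case by blast
  next
    case (mult f g)
    then show ?case using has_deg_mult by blast
  qed
  then show ?thesis using that by blast
qed

text \<open>One step of Gaussian elimination per column: a row i0 with nonzero entry in column j
  clears that column in the other rows, and the relation found for the rest is extended by a
  coefficient for i0.\<close>

lemma nontrivial_linear_relation:
  fixes M :: "'i \<Rightarrow> 'j \<Rightarrow> real"
  assumes "finite J" "finite I" "card J < card I"
  obtains c where "\<exists>i\<in>I. c i \<noteq> 0" "\<And>j. j \<in> J \<Longrightarrow> (\<Sum>i\<in>I. c i * M i j) = 0"
proof -
  have "\<exists>c. (\<exists>i\<in>I. c i \<noteq> 0) \<and> (\<forall>j\<in>J. (\<Sum>i\<in>I. c i * M i j) = 0)"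
    using assms
  proof (induction J arbitrary: I M rule: finite_induct)
    case empty
    then obtain i where "i \<in> I" by (metis card_gt_0_iff card.empty ex_in_conv)
    then show ?case by (intro exI[of _ "\<lambda>_. 1"]) auto
  next
    case (insert j J)
    show ?case
    proof (cases "\<forall>i\<in>I. M i j = 0")
      case True
      obtain c where "\<exists>i\<in>I. c i \<noteq> 0" "\<forall>j\<in>J. (\<Sum>i\<in>I. c i * M i j) = 0"
        using insert.IH[of I M] insert.prems insert.hyps by (auto dest: Suc_lessD)
      then show ?thesis using True by (intro exI[of _ c]) auto
    next
      case False
      then obtain i0 where i0: "i0 \<in> I" "M i0 j \<noteq> 0" by blast
      let ?I = "I - {i0}"
      have "card J < card ?I" using insert i0 by simp
      from insert.IH[OF finite_Diff[OF insert.prems(1)] this, of "\<lambda>i k. M i k - M i j / M i0 j * M i0 k"]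
      obtain c where c: "\<exists>i\<in>?I. c i \<noteq> 0"
        "\<And>k. k \<in> J \<Longrightarrow> (\<Sum>i\<in>?I. c i * (M i k - M i j / M i0 j * M i0 k)) = 0"
        by blast
      \<comment> \<open>The coefficient of the pivot row that the equation in column j
        forces.\<close>
      let ?S = "- (\<Sum>i\<in>?I. c i * M i j / M i0 j)"
      let ?c = "c(i0 := ?S)"
      have s: "(\<Sum>i\<in>I. ?c i * M i k) = ?S * M i0 k + (\<Sum>i\<in>?I. c i * M i k)" for k
        using i0 insert.prems by (subst sum.remove[of I i0]) (auto intro!: sum.cong)
      have "(\<Sum>i\<in>I. ?c i * M i k) = 0" if "k \<in> insert j J" for k
      proof (cases "k = j")
        case True
        have "(\<Sum>i\<in>?I. c i * M i j / M i0 j) = (\<Sum>i\<in>?I. c i * M i j) / M i0 j"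
          by (rule sum_divide_distrib[symmetric])
        then show ?thesis using i0 True unfolding s by simp
      next
        case False
        have "(\<Sum>i\<in>?I. c i * (M i k - M i j / M i0 j * M i0 k)) =
          (\<Sum>i\<in>?I. c i * M i k) - (\<Sum>i\<in>?I. c i * M i j / M i0 j) * M i0 k"
          by (simp add: right_diff_distrib sum_subtractf sum_distrib_right mult.assoc)
        then show ?thesis using c(2)[of k] that False unfolding s by simp
      qed
      moreover have "\<exists>i\<in>I. ?c i \<noteq> 0" using c(1) by auto
      ultimately show ?thesis by blast
    qed
  qed
  then show ?thesis using that by blast
qed

text \<open>The products of powers of q and of the components of H outnumber the monomials in which they
  are expressed, as there is one more factor than there are variables.\<close>
lemma algebraic_dependence:
  fixes q :: "real^'N \<Rightarrow> real" and H :: "real^'N \<Rightarrow> real^'N"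
  assumes q: "real_polynomial_function q" and H: "\<And>k. real_polynomial_function (\<lambda>x. H x $ k)"
  obtains m C a e where "a \<le> m" "e \<in> exps m" "C a e \<noteq> 0"
    "\<And>x. (\<Sum>a\<le>m. (\<Sum>e\<in>exps m. C a e * mono_fun e (H x)) * q x ^ a) = 0"
proof -
  let ?n = "CARD('N)"
  obtain d0 where d0: "has_deg d0 q" using real_polynomial_function_has_deg[OF q] .
  have "\<exists>d. has_deg d (\<lambda>x. H x $ k)" for k using real_polynomial_function_has_deg[OF H] by metis
  then obtain dd where dd: "\<And>k. has_deg (dd k) (\<lambda>x. H x $ k)" by metis
  define d where "d = d0 + (\<Sum>k\<in>UNIV. dd k)"
  have dq: "has_deg d q" using d0 by (rule has_deg_mono) (simp add: d_def)
  have dH: "has_deg d (\<lambda>x. H x $ k)" for k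
    using dd by (rule has_deg_mono) (simp add: d_def member_le_sum trans_le_add2)
  \<comment> \<open>With N variables there are (m + 1)^(N + 1) products, each of degree at most D =
    (N + 1) m d in every variable. This m turns the number of monomials, (D + 1)^N, into at most
    (((N + 1) d + 1) m)^N = m * m^N, which is smaller.\<close>
  define m where "m = ((?n + 1) * d + 1) ^ ?n"
  have m1: "1 \<le> m" by (simp add: m_def)
  define D where "D = (?n + 1) * (m * d)"
  let ?I = "{..m} \<times> (exps m :: ('N \<Rightarrow> nat) set)"
  define f where "f z x = q x ^ fst z * mono_fun (snd z) (H x)" for z x
  have "has_deg D (f z)" if "z \<in> ?I" for z
  proof -
    obtain a e where ze: "z = (a, e)" by (cases z)
    then have z: "z = (a, e)" "a \<le> m" "\<And>i. e i \<le> m" using that by (auto simp: exps_def)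
    have 1: "has_deg (m * d) (\<lambda>x. q x ^ a)"
      using has_deg_power[OF dq, of a] by (rule has_deg_mono) (use z in auto)
    have "has_deg (\<Sum>i\<in>UNIV. e i * d) (\<lambda>x. mono_fun e (H x))"
      unfolding mono_fun_def by (intro has_deg_prod has_deg_power dH) auto
    moreover have "(\<Sum>i\<in>UNIV. e i * d) \<le> ?n * (m * d)"
      using sum_bounded_above[of UNIV "\<lambda>i. e i * d" "m * d"] z by simp
    ultimately have "has_deg (?n * (m * d)) (\<lambda>x. mono_fun e (H x))"
      by (rule has_deg_mono)
    from has_deg_mult[OF 1 this] show ?thesis by (simp add: D_def z f_def[abs_def] algebra_simps)
  qed
  then have "\<forall>z\<in>?I. \<exists>c. \<forall>x. f z x = (\<Sum>s\<in>exps D. c s * mono_fun s x)"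
    unfolding has_deg_def by (rule ballI)
  from bchoice[OF this]
  obtain M where M: "\<forall>z\<in>?I. \<forall>x. f z x = (\<Sum>s\<in>exps D. M z s * mono_fun s x)"
    by blast
  have "(D + 1) ^ ?n \<le> (((?n + 1) * d + 1) * m) ^ ?n"
    using m1 by (intro power_mono) (auto simp: D_def algebra_simps)
  also have "\<dots> = m * m ^ ?n" by (simp only: power_mult_distrib m_def)
  also have "\<dots> < (m + 1) * (m + 1) ^ ?n"
    using power_mono[of m "m + 1" ?n] by (intro mult_less_le_imp_less) (use m1 in auto)
  finally have "card (exps D :: ('N \<Rightarrow> nat) set) < card ?I"
    by (simp add: card_exps card_cartesian_product)
  then obtain c where c: "\<exists>i\<in>?I. c i \<noteq> 0" "\<And>s. s \<in> exps D \<Longrightarrow> (\<Sum>z\<in>?I. c z * M z s) = 0"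
    using nontrivial_linear_relation[of "exps D" ?I M] by auto
  obtain a e where ae: "a \<le> m" "e \<in> exps m" "c (a, e) \<noteq> 0" using c(1) by auto
  have "(\<Sum>a\<le>m. (\<Sum>e\<in>exps m. c (a, e) * mono_fun e (H x)) * q x ^ a) = 0" for x
  proof -
    have "(\<Sum>a\<le>m. (\<Sum>e\<in>exps m. c (a, e) * mono_fun e (H x)) * q x ^ a) = (\<Sum>z\<in>?I. c z * f z x)"
      unfolding sum_distrib_right sum.cartesian_product by (intro sum.cong) (auto simp: f_def mult_ac)
    also have "\<dots> = (\<Sum>z\<in>?I. c z * (\<Sum>s\<in>exps D. M z s * mono_fun s x))"
      by (intro sum.cong refl) (metis M)
    also have "\<dots> = (\<Sum>z\<in>?I. \<Sum>s\<in>exps D. c z * M z s * mono_fun s x)"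
      by (simp add: sum_distrib_left mult.assoc)
    also have "\<dots> = (\<Sum>s\<in>exps D. \<Sum>z\<in>?I. c z * M z s * mono_fun s x)"
      by (rule sum.swap)
    also have "\<dots> = 0" using c(2) by (simp add: sum_distrib_right[symmetric])
    finally show ?thesis .
  qed
  with ae show ?thesis using that[of a m e "\<lambda>a e. c (a, e)"] by auto
qed

text \<open>Induction on the variables: with the others held fixed, the sum is a polynomial in the
  variable i, so each of its coefficients vanishes. The exponents in E are functions on all indices;
  the last hypothesis says that they are told apart by their values on S.\<close>

lemma polynomial_coeffs_zero:
  fixes c :: "('N::finite \<Rightarrow> nat) \<Rightarrow> real"
  assumes "finite S" "finite E" "\<And>y::real^'N. (\<Sum>e\<in>E. c e * (\<Prod>i\<in>S. y $ i ^ e i)) = 0"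
    "\<And>e e'. e \<in> E \<Longrightarrow> e' \<in> E \<Longrightarrow> (\<And>i. i \<in> S \<Longrightarrow> e i = e' i) \<Longrightarrow> e = e'"
  shows "\<forall>e\<in>E. c e = 0"
  using assms
proof (induction S arbitrary: E rule: finite_induct)
  case empty
  show ?case
  proof
    fix e assume e: "e \<in> E"
    then have "E = {e}" using empty.prems(3) by auto
    then show "c e = 0" using empty.prems(2)[of 0] by simp
  qed
next
  case (insert i S)
  show ?case
  proof
    fix e0 assume e0: "e0 \<in> E"
    define E' where "E' = {e\<in>E. e i = e0 i}"
    obtain n where n: "\<And>e. e \<in> E \<Longrightarrow> e i \<le> n"
      using insert.prems(1) finite_nat_set_iff_bounded_le[of "(\<lambda>e. e i) ` E"] by auto
    have "(\<Sum>e\<in>E'. c e * (\<Prod>j\<in>S. y $ j ^ e j)) = 0" for y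
    proof -
      define b where "b k = (\<Sum>e\<in>{e\<in>E. e i = k}. c e * (\<Prod>j\<in>S. y $ j ^ e j))" for k
      have "(\<Sum>k\<le>n. b k * t ^ k) = 0" for t
      proof -
        define y' where "y' = (\<chi> j. if j = i then t else y $ j)"
        have "0 = (\<Sum>e\<in>E. c e * (\<Prod>j\<in>insert i S. y' $ j ^ e j))"
          using insert.prems(2) by simp
        also have "\<dots> = (\<Sum>e\<in>E. c e * (\<Prod>j\<in>S. y $ j ^ e j) * t ^ e i)"
        proof (rule sum.cong[OF refl])
          fix e
          have "(\<Prod>j\<in>S. y' $ j ^ e j) = (\<Prod>j\<in>S. y $ j ^ e j)"
            using insert.hyps by (intro prod.cong) (auto simp: y'_def)
          then show "c e * (\<Prod>j\<in>insert i S. y' $ j ^ e j) = c e * (\<Prod>j\<in>S. y $ j ^ e j) * t ^ e i"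
            using insert.hyps by (simp add: y'_def)
        qed
        also have "\<dots> = (\<Sum>k\<le>n. \<Sum>e\<in>{e\<in>E. e i = k}. c e * (\<Prod>j\<in>S. y $ j ^ e j) * t ^ e i)"
          using insert.prems(1) n by (intro sum.group[symmetric]) auto
        also have "\<dots> = (\<Sum>k\<le>n. b k * t ^ k)"
          unfolding b_def by (intro sum.cong refl) (auto simp: sum_distrib_right intro!: sum.cong)
        finally show ?thesis by simp
      qed
      then have "\<forall>k\<le>n. b k = 0" using polyfun_eq_0[of b n] by blast
      then show ?thesis using n[OF e0] by (simp add: b_def E'_def)
    qed
    moreover have "e = e'" if "e \<in> E'" "e' \<in> E'" "\<And>j. j \<in> S \<Longrightarrow> e j = e' j" for e e'
      using that by (intro insert.prems(3)) (auto simp: E'_def)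
    ultimately have "\<forall>e\<in>E'. c e = 0"
      using insert.prems(1) by (intro insert.IH) (auto simp: E'_def)
    then show "c e0 = 0" using e0 by (simp add: E'_def)
  qed
qed

lemma null_sets_zeros_coeffs:
  fixes c :: "('N::finite \<Rightarrow> nat) \<Rightarrow> real"
  assumes "e0 \<in> exps m" "c e0 \<noteq> 0"
  shows "{y. (\<Sum>e\<in>exps m. c e * mono_fun e y) = 0} \<in> null_sets lborel"
proof -
  have "\<exists>y. (\<Sum>e\<in>exps m. c e * mono_fun e y) \<noteq> 0"
    using polynomial_coeffs_zero[of UNIV "exps m" c] assms by (auto simp: mono_fun_def)
  moreover have "real_polynomial_function (\<lambda>y. \<Sum>e\<in>exps m. c e * mono_fun e y)"
    by (intro real_polynomial_function_sum real_polynomial_function.intros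
        real_polynomial_function_mono_fun) auto
  ultimately show ?thesis using null_sets_zeros_polynomial by blast
qed

text \<open>A weak form of Bezout's bound: each coordinate satisfies a polynomial equation over the values
  of H, which bounds the number of generic preimages, and nondegenerate zeros are stable.\<close>
lemma finite_nondegenerate_zeros:
  fixes H :: "real^'N \<Rightarrow> real^'N"
  assumes H: "\<And>k. real_polynomial_function (\<lambda>x. H x $ k)"
  shows "finite {z. H z = 0 \<and> (\<exists>H'. (H has_derivative H') (at z) \<and> inj H')}" (is "finite ?Z")
proof (rule ccontr)
  assume inf: "infinite ?Z"
  define Q where "Q i m C a e \<longleftrightarrow> a \<le> m \<and> e \<in> exps m \<and> C a e \<noteq> (0::real) \<and>
    (\<forall>x. (\<Sum>a\<le>m. (\<Sum>e\<in>exps m. C a e * mono_fun e (H x)) * (x $ i) ^ a) = 0)" for i m C a e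
  have "\<forall>i. \<exists>m C a e. Q i m C a e"
  proof
    fix i
    obtain m C a e where "a \<le> m" "e \<in> exps m" "C a e \<noteq> (0::real)"
      "\<And>x. (\<Sum>a\<le>m. (\<Sum>e\<in>exps m. C a e * mono_fun e (H x)) * (x $ i) ^ a) = 0"
      by (rule algebraic_dependence[OF real_polynomial_function_component[of i] H]) (rule that)
    then have "Q i m C a e" unfolding Q_def by blast
    then show "\<exists>m C a e. Q i m C a e" by blast
  qed
  then obtain m C a e where "\<And>i. Q i (m i) (C i) (a i) (e i)" by metis
  then have rel: "\<And>i. a i \<le> m i" "\<And>i. e i \<in> exps (m i)" "\<And>i. C i (a i) (e i) \<noteq> (0::real)"
    "\<And>i x. (\<Sum>b\<le>m i. (\<Sum>e\<in>exps (m i). C i b e * mono_fun e (H x)) * (x $ i) ^ b) = 0"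
    unfolding Q_def by blast+
  \<comment> \<open>Off B, the equation for \<open>x $ i\<close> over y = H x is nontrivial for
    every i, since its coefficient of index \<open>a i\<close> does not vanish at y.\<close>
  define B where "B = (\<Union>i. {y. (\<Sum>f\<in>exps (m i). C i (a i) f * mono_fun f y) = 0})"
  have "{y. (\<Sum>f\<in>exps (m i). C i (a i) f * mono_fun f y) = 0} \<in> null_sets lborel" for i
    using rel(2,3) by (rule null_sets_zeros_coeffs)
  then have B: "B \<in> null_sets lborel" unfolding B_def
    by (intro null_sets_UN') auto
  define K where "K = (\<Prod>i\<in>UNIV. m i)"
  have pre: "finite {x. H x = y} \<and> card {x. H x = y} \<le> K" if "y \<notin> B" for y
  proof -
    define P where "P i b = (\<Sum>e\<in>exps (m i). C i b e * mono_fun e y)" for i b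
    define T where "T i = {t. (\<Sum>b\<le>m i. P i b * t ^ b) = 0}" for i
    have T: "finite (T i) \<and> card (T i) \<le> m i" for i
      unfolding T_def
      using that rel(1)[of i] polyfun_rootbound[of "m i" "P i"] by (auto simp: B_def P_def)
    have sub: "{x. H x = y} \<subseteq> vec_lambda ` (PiE UNIV T)"
    proof
      fix x assume "x \<in> {x. H x = y}"
      then have "x $ i \<in> T i" for i using rel(4)[of i x] by (auto simp: T_def P_def)
      then have "($) x \<in> PiE UNIV T" by auto
      then show "x \<in> vec_lambda ` (PiE UNIV T)" by (metis image_eqI vec_nth_inverse)
    qed
    have fin: "finite (PiE UNIV T)" using T by (intro finite_PiE) auto
    have "card {x. H x = y} \<le> card (PiE UNIV T)"
      using sub fin by (meson card_image_le card_mono finite_imageI le_trans)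
    also have "\<dots> \<le> K" unfolding K_def
      by (subst card_PiE) (use T in \<open>auto intro: prod_mono\<close>)
    finally show ?thesis using sub fin finite_subset by blast
  qed
  \<comment> \<open>One zero more than a generic fibre can have points.\<close>
  obtain F where F: "F \<subseteq> ?Z" "finite F" "card F = Suc K"
    using infinite_arbitrarily_large[OF inf] by blast
  obtain r where r: "r > 0" "\<And>z w. z \<in> F \<Longrightarrow> w \<in> F \<Longrightarrow> z \<noteq> w \<Longrightarrow> 2 * r \<le> dist z w"
  proof -
    let ?D = "(\<lambda>(z, w). dist z w) ` ((F \<times> F) - Id)"
    have fin: "finite ?D" using F(2) by auto
    have pos: "0 < Min (insert 1 ?D)" using fin by (subst Min_gr_iff) auto
    have le: "Min (insert 1 ?D) \<le> dist z w" if "z \<in> F" "w \<in> F" "z \<noteq> w" for z w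
      using fin that by (intro Min_le) (auto intro!: image_eqI[of _ _ "(z, w)"])
    show ?thesis using that[of "Min (insert 1 ?D) / 2"] pos le by auto
  qed
  have contH: "continuous_on UNIV H"
    using H real_polynomial_function_continuous by (intro continuous_on_vec_lambda[of UNIV "\<lambda>k x. H x $ k", simplified]) auto
  \<comment> \<open>An injective derivative of a map between spaces of equal dimension has a right
    inverse, which makes H open at z.\<close>
  have int: "0 \<in> interior (H ` ball z r)" if z: "z \<in> F" for z
  proof -
    obtain H' where H': "H z = 0" "(H has_derivative H') (at z)" "inj H'"
      using subsetD[OF F(1) z] by auto
    have lin: "linear H'" using H'(2) by (simp add: has_derivative_linear)
    obtain g' where g': "linear g'" "g' \<circ> H' = id" using linear_injective_left_inverse[OF lin H'(3)] by blast
    then have "H' \<circ> g' = id" using lin linear_inverse_left by blast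
    then have "H z \<in> interior (H ` ball z r)"
      using sussmann_open_mapping[OF open_UNIV contH _ H'(2), of g' "ball z r"] g'(1) r(1)
      by (simp add: linear_conv_bounded_linear)
    then show ?thesis using H'(1) by simp
  qed
  define W where "W = (\<Inter>z\<in>F. interior (H ` ball z r))"
  have "open W" unfolding W_def using F(2) by (intro open_INT) auto
  moreover have "0 \<in> W" using int by (auto simp: W_def)
  ultimately have "\<not> negligible W" using open_not_negligible by blast
  moreover have "negligible B" using B by (simp add: negligible_iff_null_sets null_sets_completionI)
  \<comment> \<open>W is a neighbourhood of 0 and B is null, so some generic y has a preimage near
    each of the K + 1 zeros.\<close>
  ultimately obtain y where y: "y \<in> W" "y \<notin> B" using negligible_subset by blast
  have "\<forall>z\<in>F. \<exists>x. x \<in> ball z r \<and> H x = y"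
    using y(1) interior_subset unfolding W_def by blast
  then obtain x where x: "\<And>z. z \<in> F \<Longrightarrow> x z \<in> ball z r \<and> H (x z) = y" by metis
  have "inj_on x F"
  proof (rule inj_onI, rule ccontr)
    fix z w assume zw: "z \<in> F" "w \<in> F" "x z = x w" "z \<noteq> w"
    have "dist z w \<le> dist z (x z) + dist w (x w)" using zw(3) by (metis dist_commute dist_triangle)
    also have "\<dots> < 2 * r" using x[OF zw(1)] x[OF zw(2)] by simp
    finally show False using r(2)[OF zw(1,2,4)] by simp
  qed
  then have "Suc K = card (x ` F)" using F by (simp add: card_image)
  also have "\<dots> \<le> card {x. H x = y}" using pre[OF y(2)] x by (intro card_mono) auto
  also have "\<dots> \<le> K" using pre[OF y(2)] by simp
  finally show False by simp
qed

section \<open>Gaussian matrices\<close>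

lemma Basis_vec_image: "(Basis :: ('a::euclidean_space^'n) set) = (\<lambda>(i, b). axis i b) ` (UNIV \<times> Basis)"
  by (auto simp: Basis_vec_def)

lemma prod_Basis_vec2:
  "(\<Prod>b\<in>(Basis :: ('a::euclidean_space^'n) set). g b) = (\<Prod>i\<in>UNIV. \<Prod>b\<in>Basis. g (axis i b))"
proof -
  have "inj_on (\<lambda>(i, b). axis i b :: 'a^'n) (UNIV \<times> Basis)"
    by (auto simp: inj_on_def axis_eq_axis)
  then show ?thesis
    unfolding Basis_vec_image
    by (subst prod.reindex) (auto simp: prod.cartesian_product case_prod_beta)
qed

lemma vec_lambda_measurable [measurable]:
  "vec_lambda \<in> borel_measurable (PiM UNIV (\<lambda>_::'n::finite. borel :: 'a::euclidean_space measure))"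
  by (subst borel_measurable_euclidean_space) (auto simp: Basis_vec_def inner_axis)

lemma vec_nth_measurable [measurable]: "(\<lambda>x::'a::euclidean_space^'n. x $ i) \<in> borel_measurable borel"
  by (intro borel_measurable_continuous_onI continuous_intros)

text \<open>Entries may lie in any Euclidean space, so this decomposes a vector into coordinates and
  likewise a matrix into rows.\<close>

lemma lborel_vec:
  "(lborel :: ('a::euclidean_space^'n) measure) = distr (PiM UNIV (\<lambda>_. lborel)) borel vec_lambda"
proof (rule lborel_eqI)
  interpret product_sigma_finite "\<lambda>_::'n. lborel :: 'a measure" ..
  fix l u :: "'a^'n"
  assume le: "\<And>b. b \<in> Basis \<Longrightarrow> l \<bullet> b \<le> u \<bullet> b"
  have lu: "l $ i \<bullet> b \<le> u $ i \<bullet> b" if "b \<in> Basis" for i b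
    using le[of "axis i b"] that by (auto simp: inner_axis Basis_vec_def)
  have [measurable]: "vec_lambda \<in> measurable (PiM UNIV (\<lambda>_::'n. lborel :: 'a measure)) borel"
    using vec_lambda_measurable by (simp cong: measurable_cong_sets sets_PiM_cong)
  have "vec_lambda -` box l u \<inter> space (PiM UNIV (\<lambda>_::'n. lborel :: 'a measure)) = PiE UNIV (\<lambda>i. box (l $ i) (u $ i))"
    by (auto simp: box_def Basis_vec_def inner_axis space_PiM)
  then have "emeasure (distr (PiM UNIV (\<lambda>_. lborel)) borel vec_lambda) (box l u) =
    emeasure (PiM UNIV (\<lambda>_::'n. lborel)) (PiE UNIV (\<lambda>i. box (l $ i) (u $ i)))"
    by (subst emeasure_distr) auto
  also have "\<dots> = (\<Prod>i\<in>UNIV. ennreal (\<Prod>b\<in>Basis. (u $ i - l $ i) \<bullet> b))"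
    by (subst emeasure_PiM) (auto simp: emeasure_lborel_box lu)
  also have "\<dots> = ennreal (\<Prod>i\<in>UNIV. \<Prod>b\<in>Basis. (u $ i - l $ i) \<bullet> b)"
    by (subst prod_ennreal) (auto intro!: prod_nonneg simp: lu inner_diff_left)
  also have "(\<Prod>i\<in>UNIV. \<Prod>b\<in>Basis. (u $ i - l $ i) \<bullet> b) = (\<Prod>b\<in>Basis. (u - l) \<bullet> b)"
    by (simp add: prod_Basis_vec2 inner_axis)
  finally show "emeasure (distr (PiM UNIV (\<lambda>_. lborel)) borel vec_lambda) (box l u) =
    ennreal (\<Prod>b\<in>Basis. (u - l) \<bullet> b)" .
qed simp

lemma nn_integral_lborel_vec:
  fixes h :: "'a::euclidean_space^'n \<Rightarrow> ennreal"
  assumes [measurable]: "h \<in> borel_measurable borel"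
  shows "(\<integral>\<^sup>+x. h x \<partial>lborel) = (\<integral>\<^sup>+\<omega>. h (vec_lambda \<omega>) \<partial>PiM UNIV (\<lambda>_. lborel))"
proof -
  have [measurable]: "vec_lambda \<in> measurable (PiM UNIV (\<lambda>_::'n. lborel :: 'a measure)) borel"
    using vec_lambda_measurable by (simp cong: measurable_cong_sets sets_PiM_cong)
  show ?thesis by (subst lborel_vec) (simp add: nn_integral_distr)
qed

lemma nn_integral_lborel_vec_prod:
  fixes f :: "'n::finite \<Rightarrow> 'a::euclidean_space \<Rightarrow> ennreal"
  assumes [measurable]: "\<And>i. f i \<in> borel_measurable borel"
  shows "(\<integral>\<^sup>+(x::'a^'n). (\<Prod>i\<in>UNIV. f i (x $ i)) \<partial>lborel) = (\<Prod>i\<in>UNIV. \<integral>\<^sup>+x. f i x \<partial>lborel)"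
proof -
  interpret product_sigma_finite "\<lambda>_::'n. lborel :: 'a measure" ..
  show ?thesis
    by (subst nn_integral_lborel_vec) (auto simp: product_nn_integral_prod)
qed

text \<open>By \<open>change\<close>, \<open>lborel\<close> is c times its own image under T. On
  product sets one such factor arises per row, and product sets determine the product
  measure.\<close>

lemma nn_integral_lborel_rows:
  fixes T :: "'a::euclidean_space \<Rightarrow> 'a" and h :: "'a^'n \<Rightarrow> ennreal"
  assumes T[measurable]: "T \<in> borel_measurable borel" and h[measurable]: "h \<in> borel_measurable borel"
    and change: "\<And>q :: 'a \<Rightarrow> ennreal. q \<in> borel_measurable borel \<Longrightarrow>
      (\<integral>\<^sup>+x. q x \<partial>lborel) = c * (\<integral>\<^sup>+x. q (T x) \<partial>lborel)"
  shows "(\<integral>\<^sup>+A. h A \<partial>lborel) = c ^ CARD('n) * (\<integral>\<^sup>+A. h (\<chi> i. T (A $ i)) \<partial>lborel)"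
proof -
  interpret product_sigma_finite "\<lambda>_::'n. lborel :: 'a measure" ..
  let ?P = "PiM UNIV (\<lambda>_::'n. lborel :: 'a measure)"
  let ?T = "\<lambda>\<omega>::'n \<Rightarrow> 'a. \<lambda>i. T (\<omega> i)"
  have T'[measurable]: "T \<in> measurable lborel lborel" by simp
  have m[measurable]: "?T \<in> measurable ?P ?P"
    by (rule measurable_PiM_single') (auto simp: space_PiM)
  have vl[measurable]: "vec_lambda \<in> measurable ?P borel"
    using vec_lambda_measurable by (simp cong: measurable_cong_sets sets_PiM_cong)
  have "scale_measure (c ^ CARD('n)) (distr ?P ?P ?T) = ?P"
  proof (rule PiM_eqI)
    fix A :: "'n \<Rightarrow> 'a set" assume A: "\<And>i. i \<in> UNIV \<Longrightarrow> A i \<in> sets lborel"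
    have "?T -` (PiE UNIV A) \<inter> space ?P = PiE UNIV (\<lambda>i. T -` A i)"
      by (auto simp: space_PiM)
    then have "emeasure (scale_measure (c ^ CARD('n)) (distr ?P ?P ?T)) (PiE UNIV A) =
      c ^ CARD('n) * emeasure ?P (PiE UNIV (\<lambda>i. T -` A i))"
      using A by (subst emeasure_scale_measure, subst emeasure_distr) (auto intro!: sets_PiM_I_finite)
    also have "\<dots> = (\<Prod>i\<in>UNIV. c * emeasure lborel (T -` A i))"
      using A measurable_sets[OF T] by (subst emeasure_PiM) (auto simp: prod.distrib)
    also have "\<dots> = (\<Prod>i\<in>UNIV. emeasure lborel (A i))"
    proof (rule prod.cong[OF refl])
      fix i
      have [measurable]: "A i \<in> sets borel" using A by auto
      have "emeasure lborel (A i) = (\<integral>\<^sup>+x. indicator (A i) x \<partial>lborel)" by simp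
      also have "\<dots> = c * (\<integral>\<^sup>+x. indicator (A i) (T x) \<partial>lborel)" by (rule change) simp
      also have "(\<integral>\<^sup>+x. indicator (A i) (T x) \<partial>lborel) = (\<integral>\<^sup>+x. indicator (T -` A i) x \<partial>lborel)"
        by (rule nn_integral_cong) (auto simp: indicator_def)
      also have "\<dots> = emeasure lborel (T -` A i)"
        using measurable_sets[OF T, of "A i"] by (intro nn_integral_indicator) auto
      finally show "c * emeasure lborel (T -` A i) = emeasure lborel (A i)" by simp
    qed
    finally show "emeasure (scale_measure (c ^ CARD('n)) (distr ?P ?P ?T)) (PiE UNIV A) =
      (\<Prod>i\<in>UNIV. emeasure lborel (A i))" .
  qed auto
  then have "(\<integral>\<^sup>+\<omega>. h (vec_lambda \<omega>) \<partial>?P) = (\<integral>\<^sup>+\<omega>. h (vec_lambda \<omega>) \<partial>scale_measure (c ^ CARD('n)) (distr ?P ?P ?T))"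
    by simp
  also have "\<dots> = c ^ CARD('n) * (\<integral>\<^sup>+\<omega>. h (vec_lambda (?T \<omega>)) \<partial>?P)"
    by (simp add: nn_integral_scale_measure nn_integral_distr)
  finally have 1: "(\<integral>\<^sup>+A. h A \<partial>lborel) = c ^ CARD('n) * (\<integral>\<^sup>+\<omega>. h (vec_lambda (?T \<omega>)) \<partial>?P)"
    by (simp add: nn_integral_lborel_vec)
  have [measurable]: "(\<lambda>A::'a^'n. \<chi> i. T (A $ i)) \<in> borel_measurable borel"
    by (subst borel_measurable_euclidean_space) (auto simp: Basis_vec_def inner_axis)
  have "(\<integral>\<^sup>+A. h (\<chi> i. T (A $ i)) \<partial>lborel) = (\<integral>\<^sup>+\<omega>. h (vec_lambda (?T \<omega>)) \<partial>?P)"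
    by (subst nn_integral_lborel_vec) auto
  then show ?thesis using 1 by simp
qed

section \<open>Gaussian densities and the integrals behind the constant in
  \<open>alpha\<close>\<close>

definition gvec :: "real^'N \<Rightarrow> real" where
  "gvec a = (\<Prod>j\<in>UNIV. std_normal_density (a $ j))"

lemma norm_sq_vec: "(norm (a::real^'N))\<^sup>2 = (\<Sum>j\<in>UNIV. (a $ j)\<^sup>2)"
  unfolding power2_norm_eq_inner inner_vec_def by (simp add: power2_eq_square)

lemma gvec_eq: "gvec (a::real^'N) = (1 / sqrt (2 * pi)) ^ CARD('N) * exp (- (norm a)\<^sup>2 / 2)"
proof -
  have "(\<Prod>j\<in>UNIV. exp (- (a $ j)\<^sup>2 / 2)) = exp (\<Sum>j\<in>UNIV. - (a $ j)\<^sup>2 / 2)"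
    by (simp add: exp_sum)
  also have "(\<Sum>j\<in>UNIV. - (a $ j)\<^sup>2 / 2) = - (norm a)\<^sup>2 / 2"
    by (simp add: norm_sq_vec sum_negf sum_divide_distrib)
  finally show ?thesis
    unfolding gvec_def std_normal_density_def by (simp only: prod.distrib prod_constant)
qed

lemma gvec_measurable [measurable]: "gvec \<in> borel_measurable borel"
  unfolding gvec_def[abs_def] by measurable

lemma gvec_nonneg [simp]: "0 \<le> gvec a"
  by (simp add: gvec_def prod_nonneg)

lemma nn_integral_std_normal: "(\<integral>\<^sup>+x. ennreal (std_normal_density x) \<partial>lborel) = 1"
  by (subst nn_integral_eq_integral) auto

lemma nn_integral_gvec: "(\<integral>\<^sup>+a. ennreal (gvec a) \<partial>(lborel :: (real^'N) measure)) = 1"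
proof -
  have "(\<integral>\<^sup>+a. ennreal (gvec a) \<partial>(lborel :: (real^'N) measure)) =
    (\<integral>\<^sup>+(a::real^'N). (\<Prod>j\<in>UNIV. ennreal (std_normal_density (a $ j))) \<partial>lborel)"
    by (simp add: gvec_def prod_ennreal)
  also have "\<dots> = 1"
    by (subst nn_integral_lborel_vec_prod) (auto simp: nn_integral_std_normal)
  finally show ?thesis .
qed

definition gmat :: "real^'N^'n \<Rightarrow> real" where
  "gmat A = (\<Prod>i\<in>UNIV. gvec (A $ i))"

lemma gmat_measurable [measurable]: "gmat \<in> borel_measurable borel"
  unfolding gmat_def[abs_def] by measurable

lemma gmat_nonneg [simp]: "0 \<le> gmat A"
  by (simp add: gmat_def prod_nonneg)

lemma nn_integral_gmat: "(\<integral>\<^sup>+A. ennreal (gmat A) \<partial>(lborel :: (real^'N^'n) measure)) = 1"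
proof -
  have "(\<integral>\<^sup>+A. ennreal (gmat A) \<partial>(lborel :: (real^'N^'n) measure)) =
    (\<integral>\<^sup>+(A::real^'N^'n). (\<Prod>i\<in>UNIV. ennreal (gvec (A $ i))) \<partial>lborel)"
    by (simp add: gmat_def prod_ennreal)
  also have "\<dots> = 1"
    by (subst nn_integral_lborel_vec_prod) (auto simp: nn_integral_gvec)
  finally show ?thesis .
qed

lemma nn_integral_exp_square:
  assumes t: "t > 0"
  shows "(\<integral>\<^sup>+x. ennreal (exp (- t * x\<^sup>2)) \<partial>lborel) = ennreal (sqrt (pi / t))"
proof -
  have "1 = (\<integral>\<^sup>+x. ennreal (std_normal_density x) \<partial>lborel)" by (simp add: nn_integral_std_normal)
  also have "\<dots> = ennreal \<bar>sqrt (2 * t)\<bar> * (\<integral>\<^sup>+x. ennreal (std_normal_density (0 + sqrt (2 * t) * x)) \<partial>lborel)"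
    using t by (intro nn_integral_real_affine) auto
  also have "(\<integral>\<^sup>+x. ennreal (std_normal_density (0 + sqrt (2 * t) * x)) \<partial>lborel) =
    (\<integral>\<^sup>+x. ennreal (1 / sqrt (2 * pi)) * ennreal (exp (- t * x\<^sup>2)) \<partial>lborel)"
    using t by (intro nn_integral_cong) (simp add: std_normal_density_def power_mult_distrib ennreal_mult[symmetric])
  also have "\<dots> = ennreal (1 / sqrt (2 * pi)) * (\<integral>\<^sup>+x. ennreal (exp (- t * x\<^sup>2)) \<partial>lborel)"
    by (rule nn_integral_cmult) simp
  finally have "1 = ennreal (sqrt (2 * t) / sqrt (2 * pi)) * (\<integral>\<^sup>+x. ennreal (exp (- t * x\<^sup>2)) \<partial>lborel)"
    using t by (simp add: mult.assoc[symmetric] ennreal_mult[symmetric])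
  then have "ennreal (sqrt (pi / t)) * 1 =
    (ennreal (sqrt (pi / t)) * ennreal (sqrt (2 * t) / sqrt (2 * pi))) * (\<integral>\<^sup>+x. ennreal (exp (- t * x\<^sup>2)) \<partial>lborel)"
    by (simp only: mult.assoc)
  also have "ennreal (sqrt (pi / t)) * ennreal (sqrt (2 * t) / sqrt (2 * pi)) = 1"
    using t by (simp add: ennreal_mult[symmetric] real_sqrt_divide real_sqrt_mult)
  finally show ?thesis by simp
qed

lemma nn_integral_exp_norm_square:
  assumes t: "t > 0"
  shows "(\<integral>\<^sup>+y. ennreal (exp (- t * (norm y)\<^sup>2)) \<partial>(lborel :: (real^'n) measure)) = ennreal ((pi / t) powr (real CARD('n) / 2))"
proof -
  have "exp (- t * (norm y)\<^sup>2) = (\<Prod>i\<in>UNIV. exp (- t * (y $ i)\<^sup>2))" for y :: "real^'n"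
    by (simp add: norm_sq_vec exp_sum[symmetric] sum_distrib_left sum_negf)
  then have "(\<integral>\<^sup>+y. ennreal (exp (- t * (norm y)\<^sup>2)) \<partial>(lborel :: (real^'n) measure)) =
    (\<integral>\<^sup>+(y::real^'n). (\<Prod>i\<in>UNIV. ennreal (exp (- t * (y $ i)\<^sup>2))) \<partial>lborel)"
    by (simp add: prod_ennreal)
  also have "\<dots> = (\<Prod>i\<in>(UNIV::'n set). ennreal (sqrt (pi / t)))"
    by (subst nn_integral_lborel_vec_prod) (use nn_integral_exp_square[OF t] in auto)
  also have "\<dots> = ennreal (sqrt (pi / t) ^ CARD('n))"
    using t by (simp add: ennreal_power)
  also have "sqrt (pi / t) ^ CARD('n) = (pi / t) powr (real CARD('n) / 2)"
    using t by (simp add: powr_half_sqrt[symmetric] powr_powr powr_realpow[symmetric])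
  finally show ?thesis .
qed

text \<open>Euler's integral rescaled by l. It writes a negative power of l as a mixture of
  exponentials, hence a negative power of 1 + |y|^2 as a mixture of Gaussians.\<close>

lemma Gamma_times_powr:
  fixes s l :: real
  assumes s: "s > 0" and l: "l > 0"
  shows "ennreal (Gamma s * l powr (- s)) =
    (\<integral>\<^sup>+t. ennreal (indicator {0<..} t * (t powr (s - 1) * exp (- t * l))) \<partial>lborel)"
proof -
  have ae0: "AE t in lborel. t \<noteq> (0::real)" by (rule AE_lborel_singleton)
  have "ennreal (Gamma s) = (\<integral>\<^sup>+t. ennreal (indicator {0..} t * t powr (s - 1) / exp t) \<partial>lborel)"
    by (rule Gamma_conv_nn_integral_real[OF s])
  also have "\<dots> = (\<integral>\<^sup>+t. ennreal (indicator {0<..} t * t powr (s - 1) / exp t) \<partial>lborel)"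
    using ae0 by (intro nn_integral_cong_AE) (auto elim!: eventually_mono simp: indicator_def)
  also have "\<dots> = ennreal \<bar>l\<bar> * (\<integral>\<^sup>+t. ennreal (indicator {0<..} (0 + l * t) * (0 + l * t) powr (s - 1) / exp (0 + l * t)) \<partial>lborel)"
    using l by (intro nn_integral_real_affine) auto
  also have "(\<integral>\<^sup>+t. ennreal (indicator {0<..} (0 + l * t) * (0 + l * t) powr (s - 1) / exp (0 + l * t)) \<partial>lborel) =
    (\<integral>\<^sup>+t. ennreal (l powr (s - 1)) * ennreal (indicator {0<..} t * (t powr (s - 1) * exp (- t * l))) \<partial>lborel)"
    using l by (intro nn_integral_cong)
      (auto simp: indicator_def zero_less_mult_iff powr_mult exp_minus ennreal_mult[symmetric] field_simps)
  also have "\<dots> = ennreal (l powr (s - 1)) * (\<integral>\<^sup>+t. ennreal (indicator {0<..} t * (t powr (s - 1) * exp (- t * l))) \<partial>lborel)"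
    by (rule nn_integral_cmult) simp
  finally have *: "ennreal (Gamma s) = ennreal (l powr s) *
      (\<integral>\<^sup>+t. ennreal (indicator {0<..} t * (t powr (s - 1) * exp (- t * l))) \<partial>lborel)"
    using l by (simp add: mult.assoc[symmetric] ennreal_mult[symmetric] powr_diff)
  have "ennreal (Gamma s * l powr (- s)) = ennreal (l powr (- s)) * ennreal (Gamma s)"
    using Gamma_real_pos[OF s] by (simp add: ennreal_mult[symmetric] mult.commute)
  also have "\<dots> = (ennreal (l powr (- s)) * ennreal (l powr s)) *
      (\<integral>\<^sup>+t. ennreal (indicator {0<..} t * (t powr (s - 1) * exp (- t * l))) \<partial>lborel)"
    unfolding * by (simp only: mult.assoc)
  also have "ennreal (l powr (- s)) * ennreal (l powr s) = 1"
    using l by (simp add: ennreal_mult[symmetric] powr_add[symmetric])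
  finally show ?thesis by simp
qed

text \<open>The integrand is, up to normalization, a Gamma integral, and Tonelli reduces to a Gaussian.\<close>
lemma nn_integral_cauchy:
  "(\<integral>\<^sup>+y. ennreal ((1 + (norm y)\<^sup>2) powr (- ((real CARD('n) + 1) / 2))) \<partial>(lborel :: (real^'n) measure)) =
    ennreal (sqrt pi ^ (CARD('n) + 1) / Gamma ((real CARD('n) + 1) / 2))"
proof -
  let ?n = "real CARD('n)"
  define s where "s = (?n + 1) / 2"
  have s: "s > 0" by (simp add: s_def)
  let ?k = "\<lambda>t::real. t powr (s - 1) * exp (- t)"
  have G: "Gamma s > 0" using s by (rule Gamma_real_pos)
  define I where "I = (\<integral>\<^sup>+y. ennreal ((1 + (norm y)\<^sup>2) powr (- s)) \<partial>(lborel :: (real^'n) measure))"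
  have "ennreal (Gamma s) * I =
    (\<integral>\<^sup>+(y::real^'n). ennreal (Gamma s * (1 + (norm y)\<^sup>2) powr (- s)) \<partial>lborel)"
    unfolding I_def using G by (subst nn_integral_cmult[symmetric]) (auto simp: ennreal_mult)
  also have "\<dots> = (\<integral>\<^sup>+(y::real^'n). \<integral>\<^sup>+t. ennreal (indicator {0<..} t * (t powr (s - 1) * exp (- t * (1 + (norm y)\<^sup>2)))) \<partial>lborel \<partial>lborel)"
    using s by (intro nn_integral_cong Gamma_times_powr) (auto intro: add_pos_nonneg)
  also have "\<dots> = (\<integral>\<^sup>+t. \<integral>\<^sup>+(y::real^'n). ennreal (indicator {0<..} t * (t powr (s - 1) * exp (- t * (1 + (norm y)\<^sup>2)))) \<partial>lborel \<partial>lborel)"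
    by (rule lborel_pair.Fubini') measurable
  \<comment> \<open>The inner Gaussian integral contributes (pi / t)^(n/2). As s = (n + 1) / 2, the
    power of t that is left is t^(-1/2), which leads to Gamma (1/2) = sqrt pi.\<close>
  also have "\<dots> = (\<integral>\<^sup>+t. ennreal (pi powr (?n / 2)) * ennreal (indicator {0<..} t * (t powr (1 / 2 - 1) * exp (- t * 1))) \<partial>lborel)"
  proof (rule nn_integral_cong)
    fix t :: real
    show "(\<integral>\<^sup>+(y::real^'n). ennreal (indicator {0<..} t * (t powr (s - 1) * exp (- t * (1 + (norm y)\<^sup>2)))) \<partial>lborel) =
      ennreal (pi powr (?n / 2)) * ennreal (indicator {0<..} t * (t powr (1 / 2 - 1) * exp (- t * 1)))"
    proof (cases "t > 0")
      case True
      have "(\<integral>\<^sup>+(y::real^'n). ennreal (indicator {0<..} t * (t powr (s - 1) * exp (- t * (1 + (norm y)\<^sup>2)))) \<partial>lborel) =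
        (\<integral>\<^sup>+(y::real^'n). ennreal (?k t) * ennreal (exp (- t * (norm y)\<^sup>2)) \<partial>lborel)"
        using True by (intro nn_integral_cong) (simp add: ennreal_mult[symmetric] distrib_left exp_add[symmetric] exp_diff exp_minus field_simps)
      also have "\<dots> = ennreal (?k t) * ennreal ((pi / t) powr (?n / 2))"
        by (subst nn_integral_cmult, simp, subst nn_integral_exp_norm_square[OF True]) (rule refl)
      also have "\<dots> = ennreal (pi powr (?n / 2) * (t powr (1 / 2 - 1) * exp (- t)))"
      proof -
        have "t powr (s - 1) / t powr (?n / 2) = t powr (1 / 2 - 1)"
          using True by (subst powr_diff[symmetric]) (simp add: s_def field_simps)
        then have "?k t * (pi / t) powr (?n / 2) = pi powr (?n / 2) * (t powr (1 / 2 - 1) * exp (- t))"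
          using True by (simp add: powr_divide field_simps)
        then show ?thesis using True by (simp add: ennreal_mult[symmetric])
      qed
      finally show ?thesis using True by (simp add: ennreal_mult[symmetric])
    qed simp
  qed
  also have "\<dots> = ennreal (pi powr (?n / 2)) * ennreal (Gamma (1 / 2) * 1 powr (- (1 / 2)))"
    by (subst nn_integral_cmult, simp, subst Gamma_times_powr) auto
  also have "\<dots> = ennreal (sqrt pi ^ (CARD('n) + 1))"
  proof -
    have "pi powr (?n / 2) * sqrt pi = sqrt pi ^ (CARD('n) + 1)"
      by (simp add: powr_half_sqrt[symmetric] powr_powr powr_realpow[symmetric])
    then show ?thesis by (simp add: ennreal_mult[symmetric] Gamma_one_half_real)
  qed
  finally have *: "ennreal (Gamma s) * I = ennreal (sqrt pi ^ (CARD('n) + 1))" .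
  have "I = (ennreal (1 / Gamma s) * ennreal (Gamma s)) * I"
    using G by (simp add: ennreal_mult[symmetric])
  also have "\<dots> = ennreal (1 / Gamma s) * ennreal (sqrt pi ^ (CARD('n) + 1))"
    by (simp only: mult.assoc *)
  finally show ?thesis using G by (simp add: I_def s_def ennreal_mult[symmetric])
qed

section \<open>Rank-one perturbations of the identity\<close>

lemma inner_matrix_vector: "x \<bullet> (A *v y) = (transpose A *v x) \<bullet> (y :: real^'n)" for A :: "real^'n^'m"
  by (metis dot_lmul_matrix transpose_matrix_vector)

definition outer :: "real^'N \<Rightarrow> real^'N^'N" where
  "outer u = (\<chi> i j. u $ i * u $ j)"

definition shear :: "real \<Rightarrow> real^'N \<Rightarrow> real^'N^'N" where
  "shear c u = mat 1 - c *\<^sub>R outer u"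

lemma shear_mult_vec: "shear c u *v x = x - (c * (u \<bullet> x)) *\<^sub>R u"
proof -
  have "outer u *v x = (u \<bullet> x) *\<^sub>R u"
    by (simp add: vec_eq_iff outer_def matrix_vector_mult_def inner_vec_def sum_distrib_left mult_ac)
  then show ?thesis
    by (simp add: shear_def matrix_vector_mult_diff_rdistrib scaleR_matrix_vector_assoc[symmetric])
qed

lemma transpose_shear [simp]: "transpose (shear c u) = shear c u"
  by (simp add: shear_def transpose_def outer_def vec_eq_iff mat_def mult.commute)

text \<open>After a rotation of u onto a coordinate axis the matrix is diagonal, with a single entry
  that may differ from 1.\<close>

lemma det_shear: "det (shear c u) = 1 - c * (u \<bullet> u)" for u :: "real^'N"
proof -
  fix k :: 'N
  obtain f where f: "orthogonal_transformation f" "f u = axis k (norm u)"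
    by (rule orthogonal_transformation_exists[of u "axis k (norm u)"])
      (simp add: norm_eq_sqrt_inner inner_axis_axis)
  define R where "R = matrix f"
  have lin: "linear f" and orth: "orthogonal_matrix R"
    using f(1) by (auto simp: orthogonal_transformation_matrix R_def)
  have Rv: "R *v x = f x" for x using lin by (simp add: R_def matrix_works)
  have RT: "R ** transpose R = mat 1" using orth by (simp add: orthogonal_matrix_def)
  have "R ** shear c u ** transpose R = shear c (axis k (norm u))"
  proof (subst matrix_eq, rule allI)
    fix x
    have "R *v (transpose R *v x) = x" by (simp add: matrix_vector_mul_assoc RT del: transpose_matrix_vector)
    moreover have "u \<bullet> (transpose R *v x) = axis k (norm u) \<bullet> x"
      by (simp add: inner_matrix_vector Rv f(2) del: transpose_matrix_vector)
    ultimately show "(R ** shear c u ** transpose R) *v x = shear c (axis k (norm u)) *v x"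
      by (simp add: matrix_vector_mul_assoc[symmetric] shear_mult_vec matrix_vector_mult_diff_distrib
          matrix_vector_mult_scaleR Rv[of u] f(2) del: transpose_matrix_vector)
  qed
  then have "det R * det (shear c u) * det (transpose R) = det (shear c (axis k (norm u) :: real^'N))"
    by (metis det_mul)
  moreover have "det R * det (transpose R) = 1"
    using RT by (metis det_I det_mul)
  ultimately have "det (shear c u) = det (shear c (axis k (norm u) :: real^'N))"
    by (metis mult.assoc mult.commute mult_1)
  also have "\<dots> = (\<Prod>i\<in>UNIV. shear c (axis k (norm u) :: real^'N) $ i $ i)"
    by (rule det_diagonal) (auto simp: shear_def outer_def mat_def axis_def)
  also have "\<dots> = (\<Prod>i\<in>UNIV. if i = k then 1 - c * (u \<bullet> u) else 1)"
    by (rule prod.cong) (auto simp: shear_def outer_def mat_def axis_def power2_norm_eq_inner[symmetric] power2_eq_square)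
  also have "\<dots> = 1 - c * (u \<bullet> u)" by simp
  finally show "det (shear c u) = 1 - c * (u \<bullet> u)" .
qed

text \<open>The determinant of the inverse square root of 1 + x x^T, and the factor by which that
  matrix scales x.\<close>

definition shrink :: "real^'N \<Rightarrow> real" where
  "shrink x = 1 / sqrt (1 + (norm x)\<^sup>2)"

text \<open>Chosen such that the shear by x is the inverse square root of 1 + x x^T; the value for x = 0
  does not matter.\<close>
definition shear_coeff :: "real^'N \<Rightarrow> real" where
  "shear_coeff x = (1 - shrink x) / (norm x)\<^sup>2"

lemma shrink_pos: "0 < shrink x"
  by (simp add: shrink_def add_pos_nonneg)

lemma shrink_sq: "(shrink x)\<^sup>2 * (1 + (norm x)\<^sup>2) = 1"
proof -
  have "1 + (norm x)\<^sup>2 > 0" by (simp add: add_pos_nonneg)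
  then show ?thesis by (simp add: shrink_def power_divide)
qed

lemma shear_coeff_eq: "1 - shear_coeff x * (x \<bullet> x) = shrink x"
  by (cases "x = 0") (auto simp: shear_coeff_def power2_norm_eq_inner shrink_def)

text \<open>S is symmetric and its square is the inverse of 1 + x x^T, which is 1 - x x^T / (1 +
  |x|^2); moreover x is an eigenvector of S with eigenvalue \<open>shrink x\<close>.\<close>

lemma shear_form:
  fixes x a b :: "real^'N"
  defines "S \<equiv> shear (shear_coeff x) x"
  shows "(S *v a) \<bullet> (S *v b) = a \<bullet> b - (a \<bullet> x) * (b \<bullet> x) / (1 + (norm x)\<^sup>2)"
    and "(S *v a) \<bullet> x = shrink x * (a \<bullet> x)"
proof -
  let ?c = "shear_coeff x" and ?r = "x \<bullet> x"
  have r: "(norm x)\<^sup>2 = ?r" by (simp add: power2_norm_eq_inner)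
  have e: "1 - ?c * ?r = shrink x" by (rule shear_coeff_eq)
  show "(S *v a) \<bullet> x = shrink x * (a \<bullet> x)"
    unfolding e[symmetric] by (simp add: S_def shear_mult_vec inner_diff_left inner_commute algebra_simps)
  have sq: "(1 - ?c * ?r)\<^sup>2 * (1 + ?r) = 1" using shrink_sq[of x] e r by simp
  have pos: "1 + ?r > 0" by (simp add: add_pos_nonneg)
  have "(S *v a) \<bullet> (S *v b) = a \<bullet> b - (2 * ?c - ?c\<^sup>2 * ?r) * ((a \<bullet> x) * (b \<bullet> x))"
    by (simp add: S_def shear_mult_vec inner_diff_left inner_diff_right inner_commute power2_eq_square algebra_simps)
  also have "(2 * ?c - ?c\<^sup>2 * ?r) * ((a \<bullet> x) * (b \<bullet> x)) = (a \<bullet> x) * (b \<bullet> x) / (1 + ?r)"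
  proof (cases "x = 0")
    case False
    then have r0: "?r \<noteq> 0" by simp
    have "?r * (2 * ?c - ?c\<^sup>2 * ?r) = 1 - (1 - ?c * ?r)\<^sup>2" by (simp add: power2_eq_square algebra_simps)
    also have "(1 - ?c * ?r)\<^sup>2 = 1 / (1 + ?r)" using sq pos by (simp add: field_simps)
    also have "1 - 1 / (1 + ?r) = ?r / (1 + ?r)" using pos by (simp add: field_simps)
    finally have "?r * (2 * ?c - ?c\<^sup>2 * ?r) = ?r * (1 / (1 + ?r))" by simp
    then have "2 * ?c - ?c\<^sup>2 * ?r = 1 / (1 + ?r)" using r0 by (rule mult_left_cancel[THEN iffD1, rotated])
    then show ?thesis by simp
  qed simp
  finally show "(S *v a) \<bullet> (S *v b) = a \<bullet> b - (a \<bullet> x) * (b \<bullet> x) / (1 + (norm x)\<^sup>2)"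
    by (simp add: r)
qed

text \<open>The two exponents add up to the quadratic form |a|^2 + <a, x>^2, which S pulls back to
  |a|^2. The normalizing constant of the second density survives.\<close>

lemma gvec_shear:
  fixes x a :: "real^'N"
  defines "S \<equiv> shear (shear_coeff x) x"
  shows "gvec (S *v a) * std_normal_density ((S *v a) \<bullet> x) = gvec a / sqrt (2 * pi)"
proof -
  have pos: "1 + (norm x)\<^sup>2 > 0" by (simp add: add_pos_nonneg)
  have s: "(shrink x)\<^sup>2 = 1 / (1 + (norm x)\<^sup>2)" using shrink_sq[of x] pos by (simp add: field_simps)
  have "(norm (S *v a))\<^sup>2 + ((S *v a) \<bullet> x)\<^sup>2 = (norm a)\<^sup>2"
    using shear_form(1)[of x a a] shear_form(2)[of x a] by (simp add: S_def power2_norm_eq_inner[symmetric] power_mult_distrib s power2_eq_square[of "a \<bullet> x"])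
  then have "- (norm (S *v a))\<^sup>2 / 2 + - ((S *v a) \<bullet> x)\<^sup>2 / 2 = - (norm a)\<^sup>2 / 2" by simp
  then have "exp (- (norm (S *v a))\<^sup>2 / 2) * exp (- ((S *v a) \<bullet> x)\<^sup>2 / 2) = exp (- (norm a)\<^sup>2 / 2)"
    by (simp only: exp_add[symmetric])
  then show ?thesis by (simp add: gvec_eq std_normal_density_def mult_ac)
qed

section \<open>Gaussian means of absolute determinants\<close>

lemma det_mult_measurable [measurable (raw)]:
  fixes f :: "'x \<Rightarrow> real^'N^'n" and g :: "'x \<Rightarrow> real^'n^'N"
  assumes [measurable]: "f \<in> borel_measurable M" "g \<in> borel_measurable M"
  shows "(\<lambda>x. det (f x ** g x)) \<in> borel_measurable M"
  unfolding det_def matrix_matrix_mult_def by simp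

lemma matrix_vector_measurable [measurable (raw)]:
  fixes f :: "'x \<Rightarrow> real^'N^'n" and g :: "'x \<Rightarrow> real^'N"
  assumes [measurable]: "f \<in> borel_measurable M" "g \<in> borel_measurable M"
  shows "(\<lambda>x. f x *v g x) \<in> borel_measurable M"
  by (subst borel_measurable_euclidean_space)
     (auto simp: Basis_vec_def inner_axis matrix_vector_mult_def)

text \<open>Here x and B stand for a point of M and the Jacobian of a parametrization there; leaving
  them independent separates the Gaussian computation from the geometry.\<close>

definition gauss_det :: "real^'N \<Rightarrow> real^'n^'N \<Rightarrow> ennreal" where
  "gauss_det x B = (\<integral>\<^sup>+(A::real^'N^'n). ennreal (gmat A * gvec (A *v x) * \<bar>det (A ** B)\<bar>) \<partial>lborel)"

definition gauss_det0 :: "real^'n^'N \<Rightarrow> ennreal" where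
  "gauss_det0 B = (\<integral>\<^sup>+(A::real^'N^'n). ennreal (gmat A * \<bar>det (A ** B)\<bar>) \<partial>lborel)"

lemma gauss_det_mult: "gauss_det x (Q ** C) = ennreal \<bar>det C\<bar> * gauss_det x Q"
proof -
  have "gauss_det x (Q ** C) =
    (\<integral>\<^sup>+A. ennreal \<bar>det C\<bar> * ennreal (gmat A * gvec (A *v x) * \<bar>det (A ** Q)\<bar>) \<partial>lborel)"
    unfolding gauss_det_def
    by (intro nn_integral_cong) (simp add: matrix_mul_assoc det_mul abs_mult ennreal_mult[symmetric] mult_ac)
  also have "\<dots> = ennreal \<bar>det C\<bar> * gauss_det x Q"
    unfolding gauss_det_def by (rule nn_integral_cmult) measurable
  finally show ?thesis .
qed

lemma gauss_det0_mult: "gauss_det0 (Q ** C) = ennreal \<bar>det C\<bar> * gauss_det0 Q"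
proof -
  have "gauss_det0 (Q ** C) =
    (\<integral>\<^sup>+A. ennreal \<bar>det C\<bar> * ennreal (gmat A * \<bar>det (A ** Q)\<bar>) \<partial>lborel)"
    unfolding gauss_det0_def
    by (intro nn_integral_cong) (simp add: matrix_mul_assoc det_mul abs_mult ennreal_mult[symmetric] mult_ac)
  also have "\<dots> = ennreal \<bar>det C\<bar> * gauss_det0 Q"
    unfolding gauss_det0_def by (rule nn_integral_cmult) measurable
  finally show ?thesis .
qed

text \<open>The rows of A are independent, and the shear transforms the density of a row a times the
  Gaussian density of its inner product with x back to a multiple of the standard density.\<close>
lemma gauss_det_shear:
  fixes x :: "real^'N" and B :: "real^'n^'N"
  shows "gauss_det x B = ennreal ((shrink x / sqrt (2 * pi)) ^ CARD('n)) * gauss_det0 (shear (shear_coeff x) x ** B)"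
proof -
  define S where "S = shear (shear_coeff x) x"
  have detS: "det S = shrink x" by (simp add: S_def det_shear shear_coeff_eq)
  have [measurable]: "(\<lambda>a. S *v a) \<in> borel_measurable borel" by simp
  \<comment> \<open>Symmetry of S turns its action on the rows into a multiplication from the
    right.\<close>
  have rows: "(\<chi> i. S *v (A $ i)) = A ** S" for A :: "real^'N^'n"
  proof -
    have "S $ j $ k = S $ k $ j" for j k
      using transpose_shear[of "shear_coeff x" x] unfolding S_def[symmetric] by (metis transpose_def vec_lambda_beta)
    then show ?thesis
      by (simp add: vec_eq_iff matrix_matrix_mult_def matrix_vector_mult_def mult.commute)
  qed
  have dens: "gmat (A ** S) * gvec ((A ** S) *v x) = (1 / sqrt (2 * pi)) ^ CARD('n) * gmat A" for A :: "real^'N^'n"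
  proof -
    have "(A ** S) $ i = S *v (A $ i)" for i unfolding rows[symmetric] by simp
    then have "gmat (A ** S) * gvec ((A ** S) *v x) =
      (\<Prod>i\<in>UNIV. gvec (S *v (A $ i)) * std_normal_density ((S *v (A $ i)) \<bullet> x))"
      by (simp add: gmat_def gvec_def[of "_ *v _"] matrix_vector_mul_component prod.distrib)
    also have "\<dots> = (\<Prod>i\<in>UNIV. gvec (A $ i) / sqrt (2 * pi))"
      unfolding S_def by (simp only: gvec_shear)
    also have "\<dots> = (1 / sqrt (2 * pi)) ^ CARD('n) * gmat A"
      by (simp add: gmat_def prod_dividef power_divide)
    finally show ?thesis .
  qed
  have "gauss_det x B = (ennreal (shrink x)) ^ CARD('n) *
    (\<integral>\<^sup>+(A::real^'N^'n). ennreal (gmat (\<chi> i. S *v (A $ i)) * gvec ((\<chi> i. S *v (A $ i)) *v x) * \<bar>det ((\<chi> i. S *v (A $ i)) ** B)\<bar>) \<partial>lborel)"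
    unfolding gauss_det_def
  proof (rule nn_integral_lborel_rows)
    fix q :: "real^'N \<Rightarrow> ennreal" assume "q \<in> borel_measurable borel"
    then show "(\<integral>\<^sup>+a. q a \<partial>lborel) = ennreal (shrink x) * (\<integral>\<^sup>+a. q (S *v a) \<partial>lborel)"
      using nn_integral_linear_change[of S q] shrink_pos[of x] by (simp add: detS)
  qed measurable
  also have "\<dots> = (ennreal (shrink x)) ^ CARD('n) *
    (\<integral>\<^sup>+(A::real^'N^'n). ennreal ((1 / sqrt (2 * pi)) ^ CARD('n)) * ennreal (gmat A * \<bar>det (A ** (S ** B))\<bar>) \<partial>lborel)"
    unfolding rows dens by (simp add: ennreal_mult[symmetric] matrix_mul_assoc mult.assoc)
  also have "\<dots> = (ennreal (shrink x)) ^ CARD('n) * (ennreal ((1 / sqrt (2 * pi)) ^ CARD('n)) * gauss_det0 (S ** B))"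
    unfolding gauss_det0_def by (subst nn_integral_cmult) auto
  also have "\<dots> = ennreal ((shrink x / sqrt (2 * pi)) ^ CARD('n)) * gauss_det0 (S ** B)"
    using shrink_pos[of x]
    by (simp add: mult.assoc[symmetric] ennreal_power ennreal_mult[symmetric] power_divide)
  finally show ?thesis by (simp add: S_def)
qed

lemma real_polynomial_function_det:
  fixes f :: "'a::real_normed_vector \<Rightarrow> real^'n^'n"
  assumes "\<And>i j. real_polynomial_function (\<lambda>x. f x $ i $ j)"
  shows "real_polynomial_function (\<lambda>x. det (f x))"
  unfolding det_def
  by (intro real_polynomial_function_sum real_polynomial_function.intros real_polynomial_function_prod assms) auto

text \<open>The determinant is a polynomial in the entries of A, so a single witness
  \<open>A0\<close> suffices.\<close>

lemma AE_det_mult_nonzero: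
  fixes Q :: "real^'n^'N"
  assumes "det (A0 ** Q) \<noteq> 0"
  shows "AE A in (lborel :: (real^'N^'n) measure). det (A ** Q) \<noteq> 0"
proof -
  have "real_polynomial_function (\<lambda>A::real^'N^'n. (A ** Q) $ i $ j)" for i j
    unfolding matrix_matrix_mult_def vec_lambda_beta
    by (intro real_polynomial_function_sum real_polynomial_function.intros
        bounded_linear_compose[OF bounded_linear_vec_nth bounded_linear_vec_nth]) auto
  then have "real_polynomial_function (\<lambda>A::real^'N^'n. det (A ** Q))"
    by (rule real_polynomial_function_det)
  from null_sets_zeros_polynomial[OF this assms] show ?thesis
    by (rule AE_I') auto
qed

text \<open>The mean of |det G| for an n by n matrix G of independent standard Gaussians, 2^(n/2)
  Gamma ((n+1)/2) / sqrt pi, written such that the power of sqrt (2 pi) cancels against the one in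
  \<open>gauss_det_shear\<close>.\<close>

definition abs_det_mean :: "nat \<Rightarrow> real" where
  "abs_det_mean n = sqrt (2 * pi) ^ n * (Gamma ((real n + 1) / 2) / sqrt pi ^ (n + 1))"

lemma abs_det_mean_pos: "0 < abs_det_mean n"
  by (simp add: abs_det_mean_def Gamma_real_pos)

lemma shrink_power: "shrink x ^ (n + 1) = (1 + (norm x)\<^sup>2) powr (- ((real n + 1) / 2))"
proof -
  have p: "1 + (norm x)\<^sup>2 > 0" by (simp add: add_pos_nonneg)
  have "shrink x = (1 + (norm x)\<^sup>2) powr (- (1 / 2))"
    unfolding shrink_def powr_minus powr_half_sqrt[OF less_imp_le[OF p]] by (rule inverse_eq_divide[symmetric])
  then have "shrink x ^ (n + 1) = ((1 + (norm x)\<^sup>2) powr (- (1 / 2))) powr real (n + 1)"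
    using p shrink_pos[of x] by (simp only: powr_realpow)
  also have "\<dots> = (1 + (norm x)\<^sup>2) powr (- ((real n + 1) / 2))"
    unfolding powr_powr by (rule arg_cong) simp
  finally show ?thesis .
qed

text \<open>Instead of multiplying the means of chi distributions, use that the linear space spanned by Q
  meets the affine space of a generic pair (A, b) in exactly one point.\<close>
lemma gauss_det0_orthonormal:
  fixes Q :: "real^'n^'N"
  assumes Q: "transpose Q ** Q = mat 1"
  shows "gauss_det0 Q = ennreal (abs_det_mean CARD('n))"
proof -
  let ?n = "CARD('n)"
  have innerQ: "(Q *v y) \<bullet> (Q *v z) = y \<bullet> z" for y z
    by (subst inner_matrix_vector) (simp add: matrix_vector_mul_assoc Q)
  have normQ: "norm (Q *v y) = norm y" for y by (simp add: norm_eq_sqrt_inner innerQ)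
  have shrinkQ: "shrink (Q *v y) = shrink y" for y by (simp add: shrink_def normQ)
  have coeffQ: "shear_coeff (Q *v y) = shear_coeff y" for y by (simp add: shear_coeff_def normQ shrinkQ)
  \<comment> \<open>The shear by \<open>Q *v y\<close> acts on the span of Q like the shear by y in
    the coordinates of Q. One more determinant \<open>shrink y\<close> arises, which completes the
    exponent to n + 1.\<close>
  have F: "gauss_det (Q *v y) Q =
    ennreal ((1 / sqrt (2 * pi)) ^ ?n) * ennreal ((1 + (norm y)\<^sup>2) powr (- ((real ?n + 1) / 2))) * gauss_det0 Q" for y
  proof -
    have "shear (shear_coeff y) (Q *v y) ** Q = Q ** shear (shear_coeff y) y"
      by (simp add: matrix_eq matrix_vector_mul_assoc[symmetric] shear_mult_vec innerQ
          matrix_vector_mult_diff_distrib matrix_vector_mult_scaleR)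
    then have "gauss_det (Q *v y) Q =
      ennreal ((shrink y / sqrt (2 * pi)) ^ ?n) * (ennreal \<bar>det (shear (shear_coeff y) y)\<bar> * gauss_det0 Q)"
      by (simp add: gauss_det_shear shrinkQ coeffQ gauss_det0_mult)
    also have "det (shear (shear_coeff y) y) = shrink y" by (simp add: det_shear shear_coeff_eq)
    also have "ennreal ((shrink y / sqrt (2 * pi)) ^ ?n) * (ennreal \<bar>shrink y\<bar> * gauss_det0 Q) =
      ennreal ((1 / sqrt (2 * pi)) ^ ?n * shrink y ^ (?n + 1)) * gauss_det0 Q"
      using shrink_pos[of y]
      by (simp add: mult.assoc[symmetric] ennreal_mult[symmetric] power_divide mult_ac)
    also have "ennreal ((1 / sqrt (2 * pi)) ^ ?n * shrink y ^ (?n + 1)) =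
      ennreal ((1 / sqrt (2 * pi)) ^ ?n) * ennreal ((1 + (norm y)\<^sup>2) powr (- ((real ?n + 1) / 2)))"
      unfolding shrink_power by (intro ennreal_mult) auto
    finally show ?thesis .
  qed
  have "1 = (\<integral>\<^sup>+A. ennreal (gmat A) \<partial>(lborel :: (real^'N^'n) measure))"
    by (simp add: nn_integral_gmat)
  \<comment> \<open>For generic A the map from y to A Q y is a linear bijection, under which the
    density of b integrates to 1.\<close>
  also have "\<dots> = (\<integral>\<^sup>+(A::real^'N^'n). \<integral>\<^sup>+y. ennreal (gmat A * gvec (A *v (Q *v y)) * \<bar>det (A ** Q)\<bar>) \<partial>lborel \<partial>lborel)"
  proof (rule nn_integral_cong_AE)
    have "det (transpose Q ** Q) \<noteq> 0" by (simp add: Q)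
    then have "AE A in (lborel :: (real^'N^'n) measure). det (A ** Q) \<noteq> 0"
      by (rule AE_det_mult_nonzero)
    then show "AE A in (lborel :: (real^'N^'n) measure). ennreal (gmat A) =
      (\<integral>\<^sup>+y. ennreal (gmat A * gvec (A *v (Q *v y)) * \<bar>det (A ** Q)\<bar>) \<partial>lborel)"
    proof eventually_elim
      case (elim A)
      have "1 = ennreal \<bar>det (A ** Q)\<bar> * (\<integral>\<^sup>+y. ennreal (gvec ((A ** Q) *v y)) \<partial>lborel)"
        using nn_integral_linear_change[OF elim, of "\<lambda>b. ennreal (gvec b)"] by (simp add: nn_integral_gvec)
      then have "ennreal (gmat A) * 1 =
        ennreal (gmat A) * (ennreal \<bar>det (A ** Q)\<bar> * (\<integral>\<^sup>+y. ennreal (gvec ((A ** Q) *v y)) \<partial>lborel))"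
        by (rule arg_cong)
      also have "\<dots> = (\<integral>\<^sup>+y. ennreal (gmat A) * (ennreal \<bar>det (A ** Q)\<bar> * ennreal (gvec ((A ** Q) *v y))) \<partial>lborel)"
        by (simp add: nn_integral_cmult)
      also have "\<dots> = (\<integral>\<^sup>+y. ennreal (gmat A * gvec (A *v (Q *v y)) * \<bar>det (A ** Q)\<bar>) \<partial>lborel)"
        by (intro nn_integral_cong) (simp add: ennreal_mult[symmetric] matrix_vector_mul_assoc mult_ac)
      finally show ?case by simp
    qed
  qed
  also have "\<dots> = (\<integral>\<^sup>+y. gauss_det (Q *v y) Q \<partial>lborel)"
    unfolding gauss_det_def by (rule lborel_pair.Fubini') measurable
  also have "\<dots> = (\<integral>\<^sup>+(y::real^'n). (ennreal ((1 / sqrt (2 * pi)) ^ ?n) * gauss_det0 Q) * ennreal ((1 + (norm y)\<^sup>2) powr (- ((real ?n + 1) / 2))) \<partial>lborel)"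
    by (simp only: F mult_ac)
  also have "\<dots> = (ennreal ((1 / sqrt (2 * pi)) ^ ?n) * gauss_det0 Q) * ennreal (sqrt pi ^ (?n + 1) / Gamma ((real ?n + 1) / 2))"
    by (subst nn_integral_cmult, simp, subst nn_integral_cauchy) (rule refl)
  finally have "1 = ennreal ((1 / sqrt (2 * pi)) ^ ?n) * gauss_det0 Q * ennreal (sqrt pi ^ (?n + 1) / Gamma ((real ?n + 1) / 2))" .
  moreover have "ennreal ((1 / sqrt (2 * pi)) ^ ?n * (sqrt pi ^ (?n + 1) / Gamma ((real ?n + 1) / 2))) =
    ennreal ((1 / sqrt (2 * pi)) ^ ?n) * ennreal (sqrt pi ^ (?n + 1) / Gamma ((real ?n + 1) / 2))"
    using Gamma_real_pos[of "(real ?n + 1) / 2"] by (intro ennreal_mult) auto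
  ultimately have one: "ennreal ((1 / sqrt (2 * pi)) ^ ?n * (sqrt pi ^ (?n + 1) / Gamma ((real ?n + 1) / 2))) * gauss_det0 Q = 1"
    by (metis mult.assoc mult.commute)
  have G: "Gamma ((real ?n + 1) / 2) > 0" by (rule Gamma_real_pos) simp
  \<comment> \<open>The reciprocal of the claimed value; multiplying by it replaces a division in
    \<open>ennreal\<close>.\<close>
  define X where "X = (1 / sqrt (2 * pi)) ^ ?n * (sqrt pi ^ (?n + 1) / Gamma ((real ?n + 1) / 2))"
  have X: "X * abs_det_mean ?n = 1" "0 \<le> X"
    using less_imp_neq[OF G] G less_imp_le[OF G] unfolding X_def abs_det_mean_def
    by (auto simp: power_divide simp del: Gamma_real_pos)
  have "ennreal (abs_det_mean ?n) * (ennreal X * gauss_det0 Q) = ennreal (X * abs_det_mean ?n) * gauss_det0 Q"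
    using X(2) abs_det_mean_pos[of ?n]
    by (subst mult.assoc[symmetric], subst ennreal_mult[symmetric]) (auto simp: mult.commute)
  then show ?thesis using one unfolding X_def[symmetric] by (simp add: X)
qed

lemma subspace_orthonormal_columns:
  fixes W :: "(real^'N) set"
  assumes subW: "subspace W" and dimW: "dim W = CARD('n)"
  obtains Q :: "real^'n^'N" where "transpose Q ** Q = mat 1" "range ((*v) Q) = W"
proof -
  obtain b where b: "b \<subseteq> W" "pairwise orthogonal b" "\<And>x. x \<in> b \<Longrightarrow> norm x = 1" "independent b" "card b = dim W"
    using orthonormal_basis_subspace[OF subW] by metis
  have "finite b" using b(4) by (rule independent_imp_finite)
  then obtain f :: "'n \<Rightarrow> real^'N" where f: "bij_betw f UNIV b"
    using finite_same_card_bij[of "UNIV :: 'n set" b] b(5) dimW by auto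
  define Q :: "real^'n^'N" where "Q = (\<chi> i j. f j $ i)"
  have ff: "f i \<bullet> f j = (if i = j then 1 else 0)" for i j
  proof (cases "i = j")
    case True
    have "f i \<in> b" using f by (auto simp: bij_betw_def)
    then show ?thesis using b(3)[of "f i"] True by (simp add: norm_eq_1)
  next
    case False
    then have "f i \<noteq> f j" "f i \<in> b" "f j \<in> b" using f by (auto simp: bij_betw_def inj_on_def)
    then show ?thesis using b(2) False by (auto simp: pairwise_def orthogonal_def)
  qed
  have QQ: "transpose Q ** Q = mat 1"
    using ff by (simp add: vec_eq_iff matrix_matrix_mult_def transpose_def Q_def mat_def inner_vec_def)
  have injQ: "inj ((*v) Q)"
    using QQ by (metis matrix_left_invertible_injective)
  have Qy: "Q *v y = (\<Sum>j\<in>UNIV. y $ j *\<^sub>R f j)" for y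
    by (simp add: vec_eq_iff matrix_vector_mult_def Q_def mult.commute)
  have "range ((*v) Q) \<subseteq> W"
  proof safe
    fix y
    have "f j \<in> W" for j using f b(1) by (auto simp: bij_betw_def)
    then show "Q *v y \<in> W" unfolding Qy by (intro subspace_sum subspace_scale subW)
  qed
  moreover have "dim (range ((*v) Q)) = CARD('n)"
    using injQ full_rank_injective[of Q] rank_dim_range[of Q] by simp
  ultimately have rng: "range ((*v) Q) = W"
    using subspace_dim_equal[of "range ((*v) Q)" W] subW dimW by (simp add: linear_subspace_image)
  show ?thesis by (rule that[OF QQ rng])
qed

text \<open>With orthonormal columns Q spanning the range of B, the matrix Q Q^T fixes that range,
  so C can be taken as \<open>transpose Q ** B\<close>.\<close>

lemma orthonormal_columns:
  fixes B :: "real^'n^'N"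
  assumes B: "inj ((*v) B)"
  obtains Q :: "real^'n^'N" and C :: "real^'n^'n"
  where "transpose Q ** Q = mat 1" "B = Q ** C" "range ((*v) Q) = range ((*v) B)"
proof -
  have "dim (range ((*v) B)) = CARD('n)" using B full_rank_injective[of B] rank_dim_range[of B] by simp
  then obtain Q :: "real^'n^'N" where QQ: "transpose Q ** Q = mat 1" and rng: "range ((*v) Q) = range ((*v) B)"
    using subspace_orthonormal_columns[of "range ((*v) B)"] by (auto simp: linear_subspace_image)
  have "B = Q ** (transpose Q ** B)"
  proof (subst matrix_eq, rule allI)
    fix z
    have "B *v z \<in> range ((*v) Q)" using rng by auto
    then obtain y where y: "B *v z = Q *v y" by auto
    have "Q ** (transpose Q ** B) *v z = Q *v ((transpose Q ** Q) *v y)"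
      by (simp only: matrix_vector_mul_assoc[symmetric] y)
    then show "B *v z = Q ** (transpose Q ** B) *v z" by (simp add: QQ y)
  qed
  then show ?thesis by (rule that[OF QQ _ rng])
qed

text \<open>The sheared frame \<open>?S ** Q\<close> is no longer orthonormal. It is factored as Q'
  C, and the square of det C is its Gram determinant; the Gram matrix is again a rank-one
  perturbation of the identity.\<close>

lemma gauss_det_orthonormal:
  fixes Q :: "real^'n^'N" and x :: "real^'N"
  assumes Q: "transpose Q ** Q = mat 1"
  shows "gauss_det x Q = ennreal (sqrt (1 + x \<bullet> (x - Q *v (transpose Q *v x))) /
     (1 + (norm x)\<^sup>2) powr ((real CARD('n) + 1) / 2) *
     (Gamma ((real CARD('n) + 1) / 2) / sqrt pi ^ (CARD('n) + 1)))"
proof -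
  let ?n = "CARD('n)" and ?S = "shear (shear_coeff x) x" and ?w = "transpose Q *v x" and ?r = "(norm x)\<^sup>2"
  have r: "1 + ?r > 0" by (simp add: add_pos_nonneg)
  have gram: "transpose (?S ** Q) ** (?S ** Q) = shear (1 / (1 + ?r)) ?w"
  proof -
    have "v \<bullet> ((transpose (?S ** Q) ** (?S ** Q)) *v u) = v \<bullet> (shear (1 / (1 + ?r)) ?w *v u)" for u v
    proof -
      have "v \<bullet> ((transpose (?S ** Q) ** (?S ** Q)) *v u) = v \<bullet> (transpose (?S ** Q) *v ((?S ** Q) *v u))"
        by (simp only: matrix_vector_mul_assoc)
      also have "\<dots> = ((?S ** Q) *v v) \<bullet> ((?S ** Q) *v u)"
        by (simp only: inner_matrix_vector transpose_transpose)
      also have "\<dots> = (?S *v (Q *v v)) \<bullet> (?S *v (Q *v u))"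
        by (simp only: matrix_vector_mul_assoc)
      also have "\<dots> = (Q *v v) \<bullet> (Q *v u) - ((Q *v v) \<bullet> x) * ((Q *v u) \<bullet> x) / (1 + ?r)"
        by (rule shear_form(1))
      also have "(Q *v v) \<bullet> (Q *v u) = v \<bullet> u"
        by (subst inner_matrix_vector) (simp add: matrix_vector_mul_assoc Q)
      also have "(Q *v v) \<bullet> x = ?w \<bullet> v" by (metis inner_commute inner_matrix_vector)
      also have "(Q *v u) \<bullet> x = ?w \<bullet> u" by (metis inner_commute inner_matrix_vector)
      finally show ?thesis
        by (simp add: shear_mult_vec inner_diff_right inner_commute)
    qed
    then show ?thesis by (subst matrix_eq) (metis vector_eq_ldot)
  qed
  have w: "x \<bullet> (Q *v ?w) = ?w \<bullet> ?w" by (rule inner_matrix_vector)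
  \<comment> \<open>Bessel's inequality, which keeps the argument of the square root
    nonnegative.\<close>
  have wr: "?w \<bullet> ?w \<le> ?r"
  proof -
    have "?w \<bullet> ?w = (Q *v ?w) \<bullet> (Q *v ?w)"
      by (subst inner_matrix_vector) (simp add: matrix_vector_mul_assoc Q)
    moreover have "0 \<le> (x - Q *v ?w) \<bullet> (x - Q *v ?w)" by simp
    ultimately show ?thesis using w by (simp add: inner_diff_left inner_diff_right inner_commute power2_norm_eq_inner)
  qed
  have "det ?S \<noteq> 0" using shrink_pos[of x] by (simp add: det_shear shear_coeff_eq)
  then have "inj ((*v) ?S)" by (simp add: invertible_det_nz[symmetric] invertible_eq_bij bij_def)
  moreover have "inj ((*v) Q)" using Q by (metis matrix_left_invertible_injective)
  ultimately have "inj ((*v) (?S ** Q))"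
    by (simp add: inj_def matrix_vector_mul_assoc[symmetric])
  then obtain Q' :: "real^'n^'N" and C :: "real^'n^'n" where Q': "transpose Q' ** Q' = mat 1" "?S ** Q = Q' ** C"
    by (rule orthonormal_columns)
  have "transpose (?S ** Q) ** (?S ** Q) = transpose C ** (transpose Q' ** Q') ** C"
    unfolding Q'(2) by (simp add: matrix_transpose_mul matrix_mul_assoc)
  then have "(det C)\<^sup>2 = det (shear (1 / (1 + ?r)) ?w)"
    by (simp add: Q'(1) gram det_mul power2_eq_square)
  then have detC: "\<bar>det C\<bar> = sqrt (1 + x \<bullet> (x - Q *v ?w)) * shrink x"
  proof -
    assume "(det C)\<^sup>2 = det (shear (1 / (1 + ?r)) ?w)"
    also have "\<dots> = (1 + ?r - ?w \<bullet> ?w) / (1 + ?r)" using r by (simp add: det_shear field_simps)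
    also have "1 + ?r - ?w \<bullet> ?w = 1 + x \<bullet> (x - Q *v ?w)"
      by (simp add: inner_diff_right w power2_norm_eq_inner del: transpose_matrix_vector)
    finally have "sqrt ((det C)\<^sup>2) = sqrt (1 + x \<bullet> (x - Q *v ?w)) / sqrt (1 + ?r)"
      by (simp add: real_sqrt_divide)
    then show ?thesis by (simp add: shrink_def)
  qed
  have nn: "0 \<le> 1 + x \<bullet> (x - Q *v ?w)"
    using wr by (simp add: inner_diff_right w power2_norm_eq_inner del: transpose_matrix_vector)
  have "gauss_det x Q = ennreal ((shrink x / sqrt (2 * pi)) ^ ?n) * gauss_det0 (Q' ** C)"
    by (simp add: gauss_det_shear Q'(2))
  also have "\<dots> = ennreal ((shrink x / sqrt (2 * pi)) ^ ?n * (\<bar>det C\<bar> * abs_det_mean ?n))"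
    using shrink_pos[of x] abs_det_mean_pos[of ?n]
    by (simp add: gauss_det0_mult gauss_det0_orthonormal[OF Q'(1)] ennreal_mult)
  also have "(shrink x / sqrt (2 * pi)) ^ ?n * (\<bar>det C\<bar> * abs_det_mean ?n) =
    sqrt (1 + x \<bullet> (x - Q *v ?w)) * shrink x ^ (?n + 1) * (Gamma ((real ?n + 1) / 2) / sqrt pi ^ (?n + 1))"
    by (simp add: detC abs_det_mean_def power_divide)
  also have "shrink x ^ (?n + 1) = 1 / (1 + ?r) powr ((real ?n + 1) / 2)"
    unfolding shrink_power powr_minus by (rule inverse_eq_divide)
  finally show ?thesis by (simp only: times_divide_eq_right mult_1_right)
qed

section \<open>Tangent spaces and parametrizations of algebraic manifolds\<close>

definition grad :: "('a::real_inner \<Rightarrow> real) \<Rightarrow> 'a \<Rightarrow> 'a" where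
  "grad p x = (SOME D. (p has_derivative (\<lambda>h. h \<bullet> D)) (at x))"

text \<open>Polynomial components of the gradients make the Jacobian determinants of charts
  polynomial, so that the basis theorem applies to them.\<close>

lemma polynomial_gradient:
  fixes p :: "real^'N \<Rightarrow> real"
  assumes "real_polynomial_function p"
  shows "\<exists>g. (\<forall>x. (p has_derivative (\<lambda>h. h \<bullet> g x)) (at x)) \<and> (\<forall>k. real_polynomial_function (\<lambda>x. g x $ k))"
  using assms
proof (induction rule: real_polynomial_function.induct)
  case (linear f)
  have "f h = h \<bullet> (\<chi> i. f (axis i 1))" for h
  proof -
    have "f h = f (\<Sum>i\<in>UNIV. h $ i *\<^sub>R axis i 1)" by (metis basis_expansion scalar_mult_eq_scaleR)
    also have "\<dots> = (\<Sum>i\<in>UNIV. h $ i * f (axis i 1))"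
      using linear by (simp add: linear_sum[OF bounded_linear.linear] linear_cmul[OF bounded_linear.linear])
    finally show ?thesis by (simp add: inner_vec_def)
  qed
  then have "f = (\<lambda>h. h \<bullet> (\<chi> i. f (axis i 1)))" by blast
  then have "(f has_derivative (\<lambda>h. h \<bullet> (\<chi> i. f (axis i 1)))) (at x)" for x
    using bounded_linear_imp_has_derivative[OF linear, of "at x"] by simp
  moreover have "real_polynomial_function (\<lambda>x::real^'N. (\<chi> i. f (axis i 1)) $ k)" for k
    by (rule real_polynomial_function.intros)
  ultimately show ?case by (intro exI[of _ "\<lambda>_. \<chi> i. f (axis i 1)"] conjI allI)
next
  case (const c)
  show ?case by (intro exI[of _ "\<lambda>_. 0"]) (auto intro: real_polynomial_function.intros)
next
  case (add f g)
  obtain f' where f': "\<forall>x. (f has_derivative (\<lambda>h. h \<bullet> f' x)) (at x)" "\<forall>k. real_polynomial_function (\<lambda>x. f' x $ k)"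
    using add by blast
  obtain g' where g': "\<forall>x. (g has_derivative (\<lambda>h. h \<bullet> g' x)) (at x)" "\<forall>k. real_polynomial_function (\<lambda>x. g' x $ k)"
    using add by blast
  have "((\<lambda>x. f x + g x) has_derivative (\<lambda>h. h \<bullet> (f' x + g' x))) (at x)" for x
    unfolding inner_add_right using f'(1) g'(1) by (intro has_derivative_add) auto
  then show ?case using f'(2) g'(2)
    by (intro exI[of _ "\<lambda>x. f' x + g' x"]) (auto intro: real_polynomial_function.intros)
next
  case (mult f g)
  obtain f' where f': "\<forall>x. (f has_derivative (\<lambda>h. h \<bullet> f' x)) (at x)" "\<forall>k. real_polynomial_function (\<lambda>x. f' x $ k)"
    using mult by blast
  obtain g' where g': "\<forall>x. (g has_derivative (\<lambda>h. h \<bullet> g' x)) (at x)" "\<forall>k. real_polynomial_function (\<lambda>x. g' x $ k)"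
    using mult by blast
  have "((\<lambda>x. f x * g x) has_derivative (\<lambda>h. h \<bullet> (f x *\<^sub>R g' x + g x *\<^sub>R f' x))) (at x)" for x
    using has_derivative_mult[OF f'(1)[rule_format, of x] g'(1)[rule_format, of x]]
    by (simp add: inner_add_right mult.commute)
  moreover have "real_polynomial_function (\<lambda>x. (f x *\<^sub>R g' x + g x *\<^sub>R f' x) $ k)" for k
    using mult.hyps f'(2) g'(2) by (auto intro!: real_polynomial_function.intros(3,4))
  ultimately show ?case by (intro exI[of _ "\<lambda>x. f x *\<^sub>R g' x + g x *\<^sub>R f' x"] conjI allI)
qed

lemma inner_derivative_unique:
  assumes "(p has_derivative (\<lambda>h. h \<bullet> D)) (at x)" "(p has_derivative (\<lambda>h. h \<bullet> D')) (at x)"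
  shows "D = D'"
proof -
  have "(\<lambda>h. h \<bullet> D) = (\<lambda>h. h \<bullet> D')" using assms by (rule has_derivative_unique)
  then show ?thesis by (metis vector_eq_ldot)
qed

lemma grad_polynomial:
  fixes p :: "real^'N \<Rightarrow> real"
  assumes "real_polynomial_function p"
  shows "(p has_derivative (\<lambda>h. h \<bullet> grad p x)) (at x)" "real_polynomial_function (\<lambda>x. grad p x $ k)"
proof -
  obtain g where g: "\<And>x. (p has_derivative (\<lambda>h. h \<bullet> g x)) (at x)" "\<And>k. real_polynomial_function (\<lambda>x. g x $ k)"
    using polynomial_gradient[OF assms] by blast
  have d: "(p has_derivative (\<lambda>h. h \<bullet> grad p x)) (at x)" for x
    unfolding grad_def by (rule someI) (rule g(1))
  then have "grad p = g" using inner_derivative_unique[OF _ g(1)] by blast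
  then show "(p has_derivative (\<lambda>h. h \<bullet> grad p x)) (at x)" "real_polynomial_function (\<lambda>x. grad p x $ k)"
    using d g(2) by auto
qed

lemma GDERIV_grad:
  fixes p :: "real^'N \<Rightarrow> real"
  assumes "real_polynomial_function p"
  shows "GDERIV p x :> D \<longleftrightarrow> D = grad p x"
  using grad_polynomial(1)[OF assms, of x] inner_derivative_unique unfolding gderiv_def by blast

lemma GDERIV_set:
  fixes P :: "(real^'N \<Rightarrow> real) set"
  assumes "\<forall>p\<in>P. real_polynomial_function p"
  shows "{D. \<exists>p\<in>P. GDERIV p x :> D} = (\<lambda>p. grad p x) ` P"
  using assms by (auto simp: GDERIV_grad)

text \<open>The columns of Q are an orthonormal basis of the common kernel of the gradients, the
  expected tangent space at x. Independence is stated for the family indexed by P and not for the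
  set of gradients, so equal gradients of different polynomials are excluded.\<close>

definition chart_data :: "(real^'N) set \<Rightarrow> real^'N \<Rightarrow> (real^'N \<Rightarrow> real) set \<Rightarrow> real^'n^'N \<Rightarrow> bool" where
  "chart_data V x P Q \<longleftrightarrow> finite P \<and> card P + CARD('n) = CARD('N) \<and>
     (\<forall>p\<in>P. real_polynomial_function p \<and> (\<forall>y\<in>V. p y = 0)) \<and>
     transpose Q ** Q = mat 1 \<and> range ((*v) Q) = {v. \<forall>p\<in>P. v \<bullet> grad p x = 0} \<and>
     (\<forall>c. (\<Sum>p\<in>P. c p *\<^sub>R grad p x) = 0 \<longrightarrow> (\<forall>p\<in>P. c p = 0))"

lemma dim_common_kernel:
  fixes G :: "'a::euclidean_space set"
  shows "dim {v. \<forall>g\<in>G. v \<bullet> g = 0} + dim G = DIM('a)"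
proof -
  have "(\<forall>g\<in>G. v \<bullet> g = 0) \<longleftrightarrow> (\<forall>x\<in>span G. orthogonal x v)" for v
  proof
    assume v: "\<forall>g\<in>G. v \<bullet> g = 0"
    show "\<forall>x\<in>span G. orthogonal x v"
    proof
      fix x assume "x \<in> span G"
      then have "orthogonal v x"
        by (rule orthogonal_to_span) (use v in \<open>simp add: orthogonal_def\<close>)
      then show "orthogonal x v" by (simp add: orthogonal_commute)
    qed
  next
    assume "\<forall>x\<in>span G. orthogonal x v"
    then show "\<forall>g\<in>G. v \<bullet> g = 0" by (simp add: orthogonal_def inner_commute span_base)
  qed
  then have "{v. \<forall>g\<in>G. v \<bullet> g = 0} = {y \<in> UNIV. \<forall>x \<in> span G. orthogonal x y}" by simp
  then show ?thesis
    using dim_subspace_orthogonal_to_vectors[of "span G" UNIV] by simp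
qed

lemma subspace_common_kernel: "subspace {v. \<forall>g\<in>G. v \<bullet> g = (0::real)}"
  by (auto simp: subspace_def inner_add_left)

lemma nonsingular_point_chart:
  fixes V :: "(real^'N) set"
  assumes "x \<in> nonsingular_points CARD('n::finite) V"
  obtains P and Q :: "real^'n^'N" and U where "chart_data V x P Q" "open U" "x \<in> U" "V \<inter> U = {y\<in>U. \<forall>p\<in>P. p y = 0}"
proof -
  from assms obtain P U where PU: "finite P" "card P + CARD('n) = CARD('N)"
    "\<forall>p\<in>P. real_polynomial_function p \<and> (\<forall>y\<in>V. p y = 0)"
    "dim {D. \<exists>p\<in>P. GDERIV p x :> D} = card P" "open U" "x \<in> U" "V \<inter> U = {y\<in>U. \<forall>p\<in>P. p y = 0}"
    unfolding nonsingular_points_def by blast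
  let ?G = "(\<lambda>p. grad p x) ` P"
  have dimG: "dim ?G = card P" using PU(3,4) by (simp add: GDERIV_set)
  have finG: "finite ?G" using PU(1) by simp
  \<comment> \<open>The dimension is at most the number of distinct gradients, so its equality with
    \<open>card P\<close> forces the gradients to be distinct.\<close>
  have cardG: "card ?G = card P"
    using dim_le_card'[OF finG] card_image_le[OF PU(1), of "\<lambda>p. grad p x"] dimG by linarith
  then have injG: "inj_on (\<lambda>p. grad p x) P" using PU(1) by (simp add: eq_card_imp_inj_on)
  have indG: "independent ?G"
    by (rule card_eq_dim[THEN iffD2, OF order_refl]) (simp_all only: cardG dimG finG span_superset)
  let ?K = "{v. \<forall>p\<in>P. v \<bullet> grad p x = 0}"
  have K: "?K = {v. \<forall>g\<in>?G. v \<bullet> g = 0}" by auto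
  have "subspace ?K" unfolding K by (rule subspace_common_kernel)
  moreover have "dim ?K = CARD('n)"
    unfolding K using dim_common_kernel[of ?G] dimG PU(2) by simp
  ultimately obtain Q :: "real^'n^'N" where Q: "transpose Q ** Q = mat 1" "range ((*v) Q) = ?K"
    by (rule subspace_orthonormal_columns)
  have "\<forall>p\<in>P. c p = 0" if c: "(\<Sum>p\<in>P. c p *\<^sub>R grad p x) = 0" for c
  proof
    fix p assume p: "p \<in> P"
    define q where "q = inv_into P (\<lambda>p. grad p x)"
    have q: "q (grad p x) = p" if "p \<in> P" for p
      using inv_into_f_f[OF injG that] by (simp add: q_def)
    have "(\<Sum>g\<in>?G. c (q g) *\<^sub>R g) = (\<Sum>p\<in>P. c p *\<^sub>R grad p x)"
      by (subst sum.reindex[OF injG]) (auto simp: q intro!: sum.cong)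
    then have "(\<Sum>g\<in>?G. c (q g) *\<^sub>R g) = 0" using c by simp
    then have "c (q (grad p x)) = 0"
      using independentD[OF indG finG order_refl, of "\<lambda>g. c (q g)"] p by blast
    moreover note q[OF p]
    ultimately show "c p = 0" by simp
  qed
  then have "chart_data V x P Q" unfolding chart_data_def using PU(1-3) Q by blast
  then show ?thesis using PU(5-7) by (rule that)
qed

text \<open>The projection of \<open>y - x\<close> onto the range of Q, plus the values of the
  equations spread along the gradients at x. The two parts lie in complementary subspaces, so both
  can be recovered from the sum.\<close>

definition chart_map :: "(real^'N \<Rightarrow> real) set \<Rightarrow> real^'n^'N \<Rightarrow> real^'N \<Rightarrow> real^'N \<Rightarrow> real^'N" where
  "chart_map P Q x y = Q *v (transpose Q *v (y - x)) + (\<Sum>p\<in>P. p y *\<^sub>R grad p x)"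

definition chart_deriv :: "(real^'N \<Rightarrow> real) set \<Rightarrow> real^'n^'N \<Rightarrow> real^'N \<Rightarrow> real^'N \<Rightarrow> real^'N \<Rightarrow> real^'N" where
  "chart_deriv P Q x y v = Q *v (transpose Q *v v) + (\<Sum>p\<in>P. (v \<bullet> grad p y) *\<^sub>R grad p x)"

lemma bounded_linear_matrix_vector [simp]: "bounded_linear ((*v) (A :: real^'n^'m))"
  using matrix_vector_mul_linear linear_conv_bounded_linear by blast

lemma orthonormal_cancel:
  fixes Q :: "real^'n^'N"
  shows "transpose Q ** Q = mat 1 \<Longrightarrow> transpose Q *v (Q *v z) = z"
  by (metis matrix_vector_mul_assoc matrix_vector_mul_lid)

lemma chart_map_has_derivative:
  assumes "chart_data V x P Q"
  shows "(chart_map P Q x has_derivative chart_deriv P Q x y) (at y)"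
proof -
  have p: "real_polynomial_function p" if "p \<in> P" for p using assms that by (auto simp: chart_data_def)
  have "((\<lambda>y. Q *v (transpose Q *v (y - x))) has_derivative (\<lambda>v. Q *v (transpose Q *v v))) (at y)"
    by (intro bounded_linear.has_derivative[OF bounded_linear_matrix_vector] derivative_eq_intros | simp del: transpose_matrix_vector)+
  moreover have "((\<lambda>y. \<Sum>p\<in>P. p y *\<^sub>R grad p x) has_derivative (\<lambda>v. \<Sum>p\<in>P. (v \<bullet> grad p y) *\<^sub>R grad p x)) (at y)"
    using grad_polynomial(1)[OF p] by (intro has_derivative_sum has_derivative_scaleR_left) auto
  ultimately show ?thesis
    unfolding chart_map_def[abs_def] chart_deriv_def[abs_def] by (rule has_derivative_add)
qed

lemma linear_chart_deriv: "linear (chart_deriv P Q x y)"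
  unfolding chart_deriv_def[abs_def]
  by (rule linearI)
     (auto simp: matrix_vector_right_distrib matrix_vector_mult_scaleR inner_add_left scaleR_add_left sum.distrib
        scaleR_sum_right scaleR_add_right simp del: transpose_matrix_vector)

text \<open>The range of Q is orthogonal to all gradients at x. Hence the two parts vanish
  separately, the first by orthonormality and the second by independence.\<close>

lemma chart_data_split:
  fixes Q :: "real^'n^'N"
  assumes cd: "chart_data V x P Q" and 0: "Q *v u + (\<Sum>p\<in>P. c p *\<^sub>R grad p x) = 0"
  shows "u = 0 \<and> (\<forall>p\<in>P. c p = 0)"
proof -
  have orth: "(Q *v w) \<bullet> grad p x = 0" if "p \<in> P" for w p
    using cd that by (auto simp: chart_data_def)
  have "0 = (Q *v u) \<bullet> (Q *v u + (\<Sum>p\<in>P. c p *\<^sub>R grad p x))" using 0 by simp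
  also have "\<dots> = (Q *v u) \<bullet> (Q *v u)"
    by (simp add: inner_add_right inner_sum_right orth)
  also have "\<dots> = u \<bullet> u"
    using cd by (subst inner_matrix_vector) (simp add: matrix_vector_mul_assoc chart_data_def del: transpose_matrix_vector)
  finally have u: "u = 0" by simp
  then have "(\<Sum>p\<in>P. c p *\<^sub>R grad p x) = 0" using 0 by simp
  then show ?thesis using u cd by (auto simp: chart_data_def)
qed

lemma chart_deriv_eq_0:
  fixes Q :: "real^'n^'N"
  assumes cd: "chart_data V x P Q"
  shows "chart_deriv P Q x y v = 0 \<longleftrightarrow> transpose Q *v v = 0 \<and> (\<forall>p\<in>P. v \<bullet> grad p y = 0)"
proof
  assume "chart_deriv P Q x y v = 0"
  then show "transpose Q *v v = 0 \<and> (\<forall>p\<in>P. v \<bullet> grad p y = 0)"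
    unfolding chart_deriv_def by (rule chart_data_split[OF cd])
next
  assume "transpose Q *v v = 0 \<and> (\<forall>p\<in>P. v \<bullet> grad p y = 0)"
  then show "chart_deriv P Q x y v = 0" unfolding chart_deriv_def by (simp del: transpose_matrix_vector)
qed

lemma inj_chart_deriv_base:
  assumes cd: "chart_data V x P Q"
  shows "inj (chart_deriv P Q x x)"
proof (subst linear_injective_0[OF linear_chart_deriv], intro allI impI)
  fix v assume "chart_deriv P Q x x v = 0"
  then have v: "transpose Q *v v = 0" "\<forall>p\<in>P. v \<bullet> grad p x = 0"
    using chart_deriv_eq_0[OF cd] by auto
  then have "v \<in> range ((*v) Q)" using cd by (auto simp: chart_data_def)
  then obtain w where w: "v = Q *v w" by auto
  have "w = transpose Q *v v" using cd w
    by (simp add: matrix_vector_mul_assoc chart_data_def del: transpose_matrix_vector)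
  then show "v = 0" using v w by simp
qed

text \<open>On the common kernel at y the chart derivative reduces to its part with
  \<open>transpose Q\<close>, so its injectivity embeds the kernel into n-dimensional space.\<close>

lemma dim_chart_kernel_le:
  fixes Q :: "real^'n^'N"
  assumes cd: "chart_data V x P Q" and inj: "inj (chart_deriv P Q x y)"
  shows "dim {v. \<forall>p\<in>P. v \<bullet> grad p y = 0} \<le> CARD('n)"
proof -
  let ?K = "{v. \<forall>p\<in>P. v \<bullet> grad p y = 0}"
  have subK: "subspace ?K" using subspace_common_kernel[of "(\<lambda>p. grad p y) ` P"] by simp
  have "inj_on ((*v) (transpose Q)) ?K"
  proof (rule inj_onI)
    fix v w assume "v \<in> ?K" "w \<in> ?K" "transpose Q *v v = transpose Q *v w"
    then have "chart_deriv P Q x y (v - w) = 0"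
      by (simp add: chart_deriv_eq_0[OF cd] matrix_vector_mult_diff_distrib inner_diff_left del: transpose_matrix_vector)
    then show "v = w" using inj linear_injective_0[OF linear_chart_deriv] by (metis eq_iff_diff_eq_0)
  qed
  then have "dim ?K = dim ((*v) (transpose Q) ` ?K)"
    using subK by (intro dim_image_eq[symmetric] matrix_vector_mul_linear) (simp add: span_eq_iff[THEN iffD2])
  also have "\<dots> \<le> CARD('n)" using dim_subset_UNIV[of "(*v) (transpose Q) ` ?K"] by simp
  finally show ?thesis .
qed

text \<open>Equality by dimension. It identifies the tangent space at points y other than the centre
  x of the chart.\<close>

lemma chart_kernel:
  fixes Q :: "real^'n^'N"
  assumes cd: "chart_data V x P Q" and inj: "inj (chart_deriv P Q x y)"
    and S: "subspace S" "S \<subseteq> {v. \<forall>p\<in>P. v \<bullet> grad p y = 0}" "dim S = CARD('n)"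
  shows "S = {v. \<forall>p\<in>P. v \<bullet> grad p y = 0}"
  using S dim_chart_kernel_le[OF cd inj] subspace_common_kernel[of "(\<lambda>p. grad p y) ` P"]
  by (intro subspace_dim_equal) auto

text \<open>By rank-nullity the gradients stay independent wherever the chart derivative is
  injective; so points of V near x are nonsingular as well.\<close>

lemma dim_chart_gradients:
  fixes Q :: "real^'n^'N"
  assumes cd: "chart_data V x P Q" and inj: "inj (chart_deriv P Q x y)"
  shows "dim ((\<lambda>p. grad p y) ` P) = card P"
proof -
  let ?K = "{v. \<forall>p\<in>P. v \<bullet> grad p y = 0}" and ?G = "(\<lambda>p. grad p y) ` P"
  have "?K = {v. \<forall>g\<in>?G. v \<bullet> g = 0}" by auto
  then have "card P \<le> dim ?G"
    using dim_common_kernel[of ?G] dim_chart_kernel_le[OF cd inj] cd by (simp add: chart_data_def)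
  moreover have "finite P" using cd by (simp add: chart_data_def)
  then have "dim ?G \<le> card P"
    using dim_le_card'[of ?G] card_image_le[of P "\<lambda>p. grad p y"] by simp
  ultimately show ?thesis by simp
qed

text \<open>A polynomial vanishing on V is constant along every curve in M, and the chain rule
  applies.\<close>

lemma tangent_space_subset:
  fixes M :: "(real^'N) set"
  assumes M: "M \<subseteq> V" and p: "real_polynomial_function p" "\<forall>y\<in>V. p y = 0" and v: "v \<in> tangent_space M x"
  shows "v \<bullet> grad p x = 0"
proof -
  obtain \<gamma> e where g: "0 < e" "\<forall>t\<in>{-e<..<e}. \<gamma> t \<in> M" "\<gamma> 0 = x" "(\<gamma> has_vector_derivative v) (at (0::real))"
    using v by (auto simp: tangent_space_def)
  have "((p \<circ> \<gamma>) has_derivative ((\<lambda>h. h \<bullet> grad p x) \<circ> (\<lambda>t. t *\<^sub>R v))) (at 0)"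
    using g(3,4) grad_polynomial(1)[OF p(1), of x]
    by (intro diff_chain_at) (auto simp: has_vector_derivative_def)
  moreover have "((p \<circ> \<gamma>) has_derivative (\<lambda>t. 0)) (at 0)"
  proof (rule has_derivative_transform_within_open[OF has_derivative_const])
    show "open {-e<..<e}" "(0::real) \<in> {-e<..<e}" using g(1) by auto
    show "0 = (p \<circ> \<gamma>) t" if "t \<in> {-e<..<e}" for t
    proof -
      have "\<gamma> t \<in> V" using that g(2) M by blast
      then show ?thesis using p(2) by simp
    qed
  qed
  ultimately have "(\<lambda>h. h \<bullet> grad p x) \<circ> (\<lambda>t. t *\<^sub>R v) = (\<lambda>t. 0)" by (rule has_derivative_unique)
  from fun_cong[OF this, of 1] show ?thesis by simp
qed

section \<open>Tangent spaces and the Gaussian weight in a parametrization\<close>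

lemma local_parametrization_has_derivative:
  assumes "local_parametrization M U \<psi>" "u \<in> U"
  shows "(\<psi> has_derivative ((*v) (jacobian \<psi> (at u)))) (at u)"
  using assms unfolding local_parametrization_def by (simp add: jacobian_works)

lemma local_parametrization_in: "local_parametrization M U \<psi> \<Longrightarrow> u \<in> U \<Longrightarrow> \<psi> u \<in> M"
  unfolding local_parametrization_def by (metis imageI openin_subset subsetD topspace_euclidean_subtopology)

lemma range_jacobian_subset_tangent:
  fixes \<psi> :: "real^'n \<Rightarrow> real^'N"
  assumes lp: "local_parametrization M U \<psi>" and u: "u \<in> U"
  shows "range ((*v) (jacobian \<psi> (at u))) \<subseteq> tangent_space M (\<psi> u)"
proof safe
  fix w :: "real^'n"
  have "open U" using lp by (simp add: local_parametrization_def)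
  then obtain r where r: "r > 0" "ball u r \<subseteq> U" using u openE by blast
  \<comment> \<open>The summand 1 covers w = 0; for |t| < e the point
    \<open>u + t *\<^sub>R w\<close> stays in the ball of radius r.\<close>
  define e where "e = r / (norm w + 1)"
  have e: "e > 0" using r by (simp add: e_def add_nonneg_pos)
  have inU: "u + t *\<^sub>R w \<in> U" if "t \<in> {-e<..<e}" for t
  proof -
    have "norm (t *\<^sub>R w) \<le> \<bar>t\<bar> * (norm w + 1)" by (simp add: mult_left_mono)
    also have "\<dots> < e * (norm w + 1)" using that by (intro mult_strict_right_mono) (auto simp: add_nonneg_pos)
    also have "\<dots> = r" using add_nonneg_pos[of "norm w" 1] by (simp add: e_def)
    finally show ?thesis using r(2) by (auto simp: dist_norm)
  qed
  define \<gamma> where "\<gamma> t = \<psi> (u + t *\<^sub>R w)" for t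
  have der: "(\<gamma> has_derivative (\<lambda>s. jacobian \<psi> (at (u + t *\<^sub>R w)) *v (s *\<^sub>R w))) (at t)" if "t \<in> {-e<..<e}" for t
  proof -
    have "((\<lambda>t. u + t *\<^sub>R w) has_derivative (\<lambda>s. s *\<^sub>R w)) (at t)" by (auto intro!: derivative_eq_intros)
    from diff_chain_at[OF this local_parametrization_has_derivative[OF lp inU[OF that]]]
    show ?thesis by (simp add: \<gamma>_def[abs_def] o_def)
  qed
  have "\<gamma> differentiable_on {-e<..<e}"
    unfolding differentiable_on_def using der by (meson differentiable_at_withinI differentiable_def)
  moreover have "(\<gamma> has_vector_derivative (jacobian \<psi> (at u) *v w)) (at 0)"
    using der[of 0] e by (simp add: has_vector_derivative_def matrix_vector_mult_scaleR)
  moreover have "\<forall>t\<in>{-e<..<e}. \<gamma> t \<in> M" using inU local_parametrization_in[OF lp] by (auto simp: \<gamma>_def)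
  ultimately show "jacobian \<psi> (at u) *v w \<in> tangent_space M (\<psi> u)"
    unfolding tangent_space_def using e by (auto simp: \<gamma>_def intro!: exI[of _ \<gamma>] exI[of _ e])
qed

lemma algebraic_manifoldE:
  assumes "algebraic_manifold n M"
  obtains V W where "algebraic_variety V" "open W" "M = nonsingular_points n V \<inter> W" "M \<subseteq> V"
  using assms unfolding algebraic_manifold_def openin_open nonsingular_points_def by blast

text \<open>The set of velocities is squeezed between the range of the Jacobian and the kernel of
  the gradients, both of dimension n. In particular it is a subspace, which its definition by curves
  does not show.\<close>

lemma tangent_space_parametrization:
  fixes \<psi> :: "real^'n \<Rightarrow> real^'N"
  assumes am: "algebraic_manifold CARD('n) M" and lp: "local_parametrization M U \<psi>" and u: "u \<in> U"
  shows "tangent_space M (\<psi> u) = range ((*v) (jacobian \<psi> (at u)))"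
proof -
  obtain V W where V: "M = nonsingular_points CARD('n) V \<inter> W" "M \<subseteq> V"
    using am by (rule algebraic_manifoldE)
  let ?y = "\<psi> u" and ?J = "jacobian \<psi> (at u)"
  have "?y \<in> nonsingular_points CARD('n) V" using V(1) local_parametrization_in[OF lp u] by auto
  then obtain P and Q :: "real^'n^'N" where cd: "chart_data V ?y P Q"
    by (rule nonsingular_point_chart)
  let ?K = "{v. \<forall>p\<in>P. v \<bullet> grad p ?y = 0}"
  have TK: "tangent_space M ?y \<subseteq> ?K"
    using tangent_space_subset[OF V(2)] cd by (auto simp: chart_data_def)
  have JT: "range ((*v) ?J) \<subseteq> tangent_space M ?y" by (rule range_jacobian_subset_tangent[OF lp u])
  have "inj ((*v) ?J)" using lp u by (auto simp: local_parametrization_def)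
  then have "dim (range ((*v) ?J)) = CARD('n)" using full_rank_injective[of ?J] rank_dim_range[of ?J] by simp
  then have "range ((*v) ?J) = ?K"
    using TK JT by (intro chart_kernel[OF cd inj_chart_deriv_base[OF cd]]) (auto simp: linear_subspace_image)
  then show ?thesis using TK JT by blast
qed

text \<open>Q Q^T z is the tangential part of z. The definite description asks for uniqueness too:
  the difference of two candidates is normal and orthogonal to all normal vectors, hence to
  itself.\<close>

lemma orthogonal_projection_normal:
  fixes Q :: "real^'n^'N"
  assumes Q: "transpose Q ** Q = mat 1" and T: "tangent_space M x = range ((*v) Q)"
  shows "orthogonal_projection (normal_space M x) z = z - Q *v (transpose Q *v z)"
proof -
  let ?y = "z - Q *v (transpose Q *v z)"
  have N: "w \<in> normal_space M x \<longleftrightarrow> (\<forall>v. (Q *v v) \<bullet> w = 0)" for w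
    unfolding normal_space_def T orthogonal_comp_def orthogonal_def by (auto simp: inner_commute)
  have yN: "?y \<in> normal_space M x"
    unfolding N
  proof
    fix v
    have "(Q *v v) \<bullet> (Q *v (transpose Q *v z)) = (transpose Q *v (Q *v v)) \<bullet> (transpose Q *v z)"
      by (rule inner_matrix_vector)
    also have "transpose Q *v (Q *v v) = v" by (simp add: matrix_vector_mul_assoc Q del: transpose_matrix_vector)
    also have "v \<bullet> (transpose Q *v z) = (Q *v v) \<bullet> z" by (subst inner_matrix_vector) simp
    finally show "(Q *v v) \<bullet> ?y = 0" by (simp add: inner_diff_right del: transpose_matrix_vector)
  qed
  show ?thesis unfolding orthogonal_projection_def
  proof (rule the_equality)
    show "?y \<in> normal_space M x \<and> (\<forall>w\<in>normal_space M x. orthogonal (z - ?y) w)"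
      using yN N by (auto simp: orthogonal_def simp del: transpose_matrix_vector)
  next
    fix y assume y: "y \<in> normal_space M x \<and> (\<forall>w\<in>normal_space M x. orthogonal (z - y) w)"
    have d: "?y - y \<in> normal_space M x" using y yN by (auto simp: N inner_diff_right simp del: transpose_matrix_vector)
    have "(z - y) \<bullet> (?y - y) = 0" using y d by (auto simp: orthogonal_def)
    moreover have "(z - ?y) \<bullet> (?y - y) = 0" using d N by (auto simp del: transpose_matrix_vector)
    ultimately have "(?y - y) \<bullet> (?y - y) = 0" by (simp add: inner_diff_left inner_diff_right del: transpose_matrix_vector)
    then show "y = ?y" by simp
  qed
qed

text \<open>In a factorization J = Q C with orthonormal Q, the factor |det C| is the Riemannian
  density, as the metric tensor is C^T C, and Q yields \<open>alpha\<close>.\<close>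

lemma gauss_det_parametrization:
  fixes \<psi> :: "real^'n \<Rightarrow> real^'N"
  assumes am: "algebraic_manifold CARD('n) M" and lp: "local_parametrization M U \<psi>" and u: "u \<in> U"
  shows "gauss_det (\<psi> u) (jacobian \<psi> (at u)) =
      ennreal (alpha CARD('n) M (\<psi> u)) * ennreal (sqrt (det (metric_tensor \<psi> u)))"
    and "0 < alpha CARD('n) M (\<psi> u)"
    and "0 < det (metric_tensor \<psi> u)"
proof -
  let ?J = "jacobian \<psi> (at u)" and ?x = "\<psi> u"
  have "inj ((*v) ?J)" using lp u by (auto simp: local_parametrization_def)
  then obtain Q :: "real^'n^'N" and C :: "real^'n^'n" where Q: "transpose Q ** Q = mat 1" "?J = Q ** C" "range ((*v) Q) = range ((*v) ?J)"
    by (rule orthonormal_columns)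
  have T: "tangent_space M ?x = range ((*v) Q)"
    using tangent_space_parametrization[OF am lp u] Q(3) by simp
  have proj: "orthogonal_projection (normal_space M ?x) ?x = ?x - Q *v (transpose Q *v ?x)"
    by (rule orthogonal_projection_normal[OF Q(1) T])
  have "metric_tensor \<psi> u = transpose C ** (transpose Q ** Q) ** C"
    unfolding metric_tensor_def Q(2) by (simp add: matrix_transpose_mul matrix_mul_assoc)
  then have det: "det (metric_tensor \<psi> u) = (det C)\<^sup>2"
    by (simp add: Q(1) det_mul power2_eq_square)
  have "det C \<noteq> 0"
  proof -
    have "inj ((*v) C)"
    proof (rule injI)
      fix v w assume "C *v v = C *v w"
      then have "?J *v v = ?J *v w" unfolding Q(2) by (simp add: matrix_vector_mul_assoc[symmetric])
      then show "v = w" using \<open>inj ((*v) ?J)\<close> by (simp add: inj_eq)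
    qed
    then show ?thesis by (metis det_eq_0_rank full_rank_injective less_irrefl)
  qed
  then show "0 < det (metric_tensor \<psi> u)" by (simp add: det)
  have nn: "0 \<le> ?x \<bullet> (?x - Q *v (transpose Q *v ?x))"
  proof -
    let ?w = "transpose Q *v ?x"
    have 1: "?x \<bullet> (Q *v ?w) = ?w \<bullet> ?w" by (rule inner_matrix_vector)
    have 2: "(Q *v ?w) \<bullet> (Q *v ?w) = ?w \<bullet> ?w"
      by (subst inner_matrix_vector) (simp only: orthonormal_cancel[OF Q(1)])
    have "0 \<le> (?x - Q *v ?w) \<bullet> (?x - Q *v ?w)" by simp
    also have "\<dots> = ?x \<bullet> (?x - Q *v ?w)"
      using 1 2 by (simp add: inner_diff_left inner_diff_right inner_commute del: transpose_matrix_vector)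
    finally show ?thesis .
  qed
  have r: "1 + (norm ?x)\<^sup>2 > 0" by (simp add: add_pos_nonneg)
  have G: "Gamma ((real CARD('n) + 1) / 2) > 0" by (rule Gamma_real_pos) simp
  show pos: "0 < alpha CARD('n) M ?x"
    unfolding alpha_def proj using nn r G
    by (intro mult_pos_pos divide_pos_pos) (auto simp del: transpose_matrix_vector Gamma_real_pos)
  have "gauss_det ?x ?J = ennreal \<bar>det C\<bar> * ennreal (alpha CARD('n) M ?x)"
    unfolding Q(2) gauss_det_mult gauss_det_orthonormal[OF Q(1)] alpha_def proj ..
  also have "\<bar>det C\<bar> = sqrt (det (metric_tensor \<psi> u))" by (simp add: det)
  finally show "gauss_det ?x ?J = ennreal (alpha CARD('n) M ?x) * ennreal (sqrt (det (metric_tensor \<psi> u)))"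
    by (simp add: mult.commute)
qed

text \<open>Cramer's rule as a formula, from which continuity in the coefficients can be read
  off.\<close>

definition solve_linear :: "real^'N^'N \<Rightarrow> real^'N \<Rightarrow> real^'N" where
  "solve_linear A b = (\<chi> k. det (\<chi> i j. if j = k then b $ i else A $ i $ j) / det A)"

lemma solve_linear: "det A \<noteq> 0 \<Longrightarrow> A *v x = b \<Longrightarrow> x = solve_linear A b"
  unfolding solve_linear_def using cramer by blast

lemma continuous_on_det:
  fixes f :: "'a::topological_space \<Rightarrow> real^'n^'n"
  assumes "\<And>i j. continuous_on S (\<lambda>x. f x $ i $ j)"
  shows "continuous_on S (\<lambda>x. det (f x))"
  unfolding det_def by (intro continuous_intros assms)

lemma continuous_on_solve_linear:
  fixes A :: "'a::topological_space \<Rightarrow> real^'N^'N"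
  assumes A: "\<And>i j. continuous_on S (\<lambda>x. A x $ i $ j)" and det: "\<And>x. x \<in> S \<Longrightarrow> det (A x) \<noteq> 0"
  shows "continuous_on S (\<lambda>x. solve_linear (A x) b)"
  unfolding solve_linear_def
proof (intro continuous_on_vec_lambda continuous_on_divide continuous_on_det A)
  fix k i j
  show "continuous_on S (\<lambda>x. (\<chi> i j. if j = k then b $ i else A x $ i $ j) $ i $ j)"
    using A[of i j] by (cases "j = k") auto
qed (use det in auto)

lemma continuous_on_chart_deriv:
  assumes "chart_data V x P Q"
  shows "continuous_on S (\<lambda>y. chart_deriv P Q x y v)"
proof -
  have "continuous_on S (\<lambda>y. grad p y)" if "p \<in> P" for p
    using grad_polynomial(2)[of p] assms that
    by (intro continuous_on_vec_lambda[of S "\<lambda>k y. grad p y $ k", simplified] real_polynomial_function_continuous)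
       (auto simp: chart_data_def)
  then show ?thesis unfolding chart_deriv_def by (intro continuous_intros) auto
qed

text \<open>The chart map at x straightens M: it maps the part of M near x into the tangent space.\<close>
lemma exists_local_parametrization:
  fixes M :: "(real^'N) set"
  assumes am: "algebraic_manifold CARD('n::finite) M" and x: "x \<in> M"
  obtains U and \<psi> :: "real^'n \<Rightarrow> real^'N" where "local_parametrization M U \<psi>" "x \<in> \<psi> ` U"
proof -
  obtain V W where V: "open W" "M = nonsingular_points CARD('n) V \<inter> W" "M \<subseteq> V"
    using am by (rule algebraic_manifoldE)
  have "x \<in> nonsingular_points CARD('n) V" using x V(2) by auto
  then obtain P and Q :: "real^'n^'N" and U0 where cd: "chart_data V x P Q" and U0: "open U0" "x \<in> U0"
    "V \<inter> U0 = {y\<in>U0. \<forall>p\<in>P. p y = 0}"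
    by (rule nonsingular_point_chart)
  have QQ: "transpose Q ** Q = mat 1" and poly: "\<And>p. p \<in> P \<Longrightarrow> real_polynomial_function p"
    and vanish: "\<And>p y. p \<in> P \<Longrightarrow> y \<in> V \<Longrightarrow> p y = 0" and fin: "finite P"
    and cardP: "card P + CARD('n) = CARD('N)"
    using cd by (auto simp: chart_data_def)
  note cancel = orthonormal_cancel[OF QQ]
  define G where "G = chart_map P Q x"
  define D where "D y = chart_deriv P Q x y" for y
  have linD: "linear (D y)" for y unfolding D_def by (rule linear_chart_deriv)
  have Dblin: "blinfun_apply (Blinfun (D y)) = D y" for y
    using linD by (simp add: bounded_linear_Blinfun_apply linear_conv_bounded_linear)
  have derG: "(G has_derivative D y) (at y)" for y
    unfolding G_def D_def by (rule chart_map_has_derivative[OF cd])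
  have injD: "inj (D x)" unfolding D_def by (rule inj_chart_deriv_base[OF cd])
  have contD: "continuous_on S (\<lambda>y. D y v)" for S v
    unfolding D_def by (rule continuous_on_chart_deriv[OF cd])
  obtain h where h: "linear h" "h \<circ> D x = id" using linear_injective_left_inverse[OF linD injD] by blast
  have contB: "continuous_on UNIV (\<lambda>y. Blinfun (D y))"
    by (rule continuous_on_blinfun_componentwise) (simp add: Dblin contD)
  have inv: "Blinfun h o\<^sub>L Blinfun (D x) = id_blinfun"
    using h by (intro blinfun_eqI)
      (simp add: Dblin bounded_linear_Blinfun_apply linear_conv_bounded_linear[symmetric] fun_eq_iff)
  obtain U' V' g g' where IF: "open U'" "x \<in> U'" "open V'" "G x \<in> V'" "homeomorphism U' V' G g"
    "\<And>y. y \<in> V' \<Longrightarrow> (g has_derivative (g' y)) (at y)"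
    "\<And>y. y \<in> V' \<Longrightarrow> g' y = Hilbert_Choice.inv (blinfun_apply (Blinfun (D (g y))))"
    "\<And>y. y \<in> V' \<Longrightarrow> bij (blinfun_apply (Blinfun (D (g y))))"
  proof (rule inverse_function_theorem[of UNIV G "\<lambda>y. Blinfun (D y)" x "Blinfun h"])
    show "(G has_derivative blinfun_apply (Blinfun (D y))) (at y)" for y unfolding Dblin by (rule derG)
  qed (use contB inv in auto)
  define W0 where "W0 = U' \<inter> U0 \<inter> W"
  have W0: "open W0" "x \<in> W0" using IF(1,2) U0 V x by (auto simp: W0_def)
  have gG: "g (G y) = y" if "y \<in> U'" for y using IF(5) that by (auto simp: homeomorphism_def)
  have Gg: "G (g z) = z" if "z \<in> V'" for z using IF(5) that by (auto simp: homeomorphism_def)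
  have gU: "g z \<in> U'" if "z \<in> V'" for z using IF(5) that by (auto simp: homeomorphism_def)
  have GV: "G y \<in> V'" if "y \<in> U'" for y using IF(5) that by (auto simp: homeomorphism_def)
  have contg: "continuous_on V' g" using IF(5) by (auto simp: homeomorphism_def)
  define \<Omega> where "\<Omega> = (*v) Q -` (V' \<inter> g -` W0)"
  have "open (V' \<inter> g -` W0)" using contg IF(3) W0(1) by (simp add: continuous_on_open_vimage Int_commute)
  then have \<Omega>: "open \<Omega>" unfolding \<Omega>_def
    by (intro open_vimage linear_continuous_on bounded_linear_matrix_vector)
  define \<psi> where "\<psi> u = g (Q *v u)" for u
  have inV': "Q *v u \<in> V'" if "u \<in> \<Omega>" for u using that by (simp add: \<Omega>_def)
  have \<psi>W: "\<psi> u \<in> W0" if "u \<in> \<Omega>" for u using that by (simp add: \<Omega>_def \<psi>_def)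
  have G\<psi>: "G (\<psi> u) = Q *v u" if "u \<in> \<Omega>" for u using Gg[OF inV'[OF that]] by (simp add: \<psi>_def)
  \<comment> \<open>Comparing the complementary parts of \<open>G (\<psi> u) = Q *v u\<close>: the
    tangent coordinates return u, and all equations hold.\<close>
  have split: "transpose Q *v (\<psi> u - x) = u \<and> (\<forall>p\<in>P. p (\<psi> u) = 0)" if "u \<in> \<Omega>" for u
  proof -
    have "Q *v (transpose Q *v (\<psi> u - x) - u) + (\<Sum>p\<in>P. p (\<psi> u) *\<^sub>R grad p x) = 0"
      using G\<psi>[OF that(1)] unfolding G_def chart_map_def
      by (simp add: matrix_vector_mult_diff_distrib algebra_simps del: transpose_matrix_vector)
    from chart_data_split[OF cd this] show ?thesis by (simp del: transpose_matrix_vector)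
  qed
  have injDy: "inj (D y)" if "y \<in> U'" for y
    using IF(8)[OF GV[OF that]] gG[OF that] by (simp add: Dblin bij_is_inj)
  have img: "\<psi> ` \<Omega> = V \<inter> W0"
  proof safe
    fix u assume u: "u \<in> \<Omega>"
    show "\<psi> u \<in> W0" by (rule \<psi>W[OF u])
    then have "\<psi> u \<in> U0" by (simp add: W0_def)
    then show "\<psi> u \<in> V" using U0(3) split[OF u] by blast
  next
    fix y assume y: "y \<in> V" "y \<in> W0"
    define u where "u = transpose Q *v (y - x)"
    have "(\<Sum>p\<in>P. p y *\<^sub>R grad p x) = 0" using vanish y(1) by (intro sum.neutral) auto
    then have Gy: "G y = Q *v u" unfolding G_def chart_map_def u_def by simp
    have yU: "y \<in> U'" using y(2) by (simp add: W0_def)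
    have "u \<in> \<Omega>" unfolding \<Omega>_def using Gy GV[OF yU] gG[OF yU] y(2) by simp
    moreover have "\<psi> u = y" unfolding \<psi>_def Gy[symmetric] by (rule gG[OF yU])
    ultimately show "y \<in> \<psi> ` \<Omega>" by blast
  qed
  \<comment> \<open>The polynomials chosen at x also witness nonsingularity at nearby points of V,
    because the chart derivative stays injective there.\<close>
  have VM: "V \<inter> W0 = M \<inter> W0"
  proof -
    have "y \<in> nonsingular_points CARD('n) V" if y: "y \<in> V" "y \<in> W0" for y
    proof -
      have "inj (chart_deriv P Q x y)" using injDy[of y] y(2) by (simp add: W0_def D_def)
      from dim_chart_gradients[OF cd this]
      have "dim {D. \<exists>p\<in>P. GDERIV p y :> D} = card P" using poly by (simp add: GDERIV_set)
      moreover have "y \<in> U0" using y by (simp add: W0_def)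
      ultimately show ?thesis
        unfolding nonsingular_points_def using y(1) fin cardP poly vanish U0 by blast
    qed
    then show ?thesis using V(2,3) by (auto simp: W0_def)
  qed
  have derpsi: "(\<psi> has_derivative (\<lambda>v. g' (Q *v u) (Q *v v))) (at u)" if "u \<in> \<Omega>" for u
    using diff_chain_at[OF bounded_linear_imp_has_derivative[OF bounded_linear_matrix_vector] IF(6)[OF inV'[OF that]]]
    by (simp add: \<psi>_def[abs_def] o_def)
  have jac: "jacobian \<psi> (at u) = matrix (\<lambda>v. g' (Q *v u) (Q *v v))" if "u \<in> \<Omega>" for u
    unfolding jacobian_def using frechet_derivative_at[OF derpsi[OF that]] by simp
  have linJ: "jacobian \<psi> (at u) *v v = g' (Q *v u) (Q *v v)" if "u \<in> \<Omega>" for u v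
    unfolding jac[OF that] using derpsi[OF that] by (simp add: matrix_works has_derivative_linear)
  have DJ: "D (\<psi> u) (jacobian \<psi> (at u) *v v) = Q *v v" if "u \<in> \<Omega>" for u v
  proof -
    have "bij (D (\<psi> u))" "g' (Q *v u) = Hilbert_Choice.inv (D (\<psi> u))"
      using IF(7,8)[OF inV'[OF that]] by (simp_all add: Dblin \<psi>_def)
    then show ?thesis by (simp add: linJ[OF that] bij_is_surj surj_f_inv_f)
  qed
  have "local_parametrization M \<Omega> \<psi>"
    unfolding local_parametrization_def
  proof (intro conjI ballI)
    show "open \<Omega>" by (rule \<Omega>)
    show "openin (top_of_set M) (\<psi> ` \<Omega>)"
      unfolding img VM using W0(1) by (simp add: openin_open_Int)
    have cont\<psi>: "continuous_on \<Omega> \<psi>"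
      using derpsi by (meson continuous_on_eq_continuous_at has_derivative_continuous \<Omega>)
    show "\<exists>\<phi>. homeomorphism \<Omega> (\<psi> ` \<Omega>) \<psi> \<phi>"
    proof (intro exI homeomorphismI)
      show "continuous_on (\<psi> ` \<Omega>) (\<lambda>y. transpose Q *v (y - x))"
        by (intro bounded_linear.continuous_on[OF bounded_linear_matrix_vector] continuous_intros)
    qed (use cont\<psi> split in \<open>auto simp del: transpose_matrix_vector\<close>)
    show "\<psi> differentiable at u" if "u \<in> \<Omega>" for u using derpsi[OF that] differentiable_def by blast
    show "inj ((*v) (jacobian \<psi> (at u)))" if "u \<in> \<Omega>" for u
    proof (rule injI)
      fix v w assume "jacobian \<psi> (at u) *v v = jacobian \<psi> (at u) *v w"
      then have "Q *v v = Q *v w" using DJ[OF that] by metis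
      then show "v = w" using cancel by metis
    qed
    \<comment> \<open>The columns of the Jacobian solve linear systems whose matrix, the chart
      derivative at \<open>\<psi> u\<close>, depends continuously on u.\<close>
    have "continuous_on \<Omega> (\<lambda>u. jacobian \<psi> (at u) $ i $ j)" for i j
    proof -
      define A where "A u = matrix (D (\<psi> u))" for u
      have Av: "A u *v v = D (\<psi> u) v" for u v unfolding A_def using linD by (simp add: matrix_works)
      have detA: "det (A u) \<noteq> 0" if "u \<in> \<Omega>" for u
      proof -
        have "\<psi> u \<in> U'" using \<psi>W[OF that] by (simp add: W0_def)
        then have "inj ((*v) (A u))" using injDy by (simp add: Av inj_def)
        then show ?thesis by (metis det_eq_0_rank full_rank_injective less_irrefl)
      qed
      have "continuous_on \<Omega> (\<lambda>u. A u $ k $ l)" for k l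
      proof -
        have "continuous_on \<Omega> (\<lambda>u. D (\<psi> u) (axis l 1))"
          by (rule continuous_on_compose2[OF contD[of UNIV] cont\<psi>]) auto
        then show ?thesis unfolding A_def matrix_def by (simp add: continuous_on_component)
      qed
      from continuous_on_solve_linear[OF this detA]
      have c: "continuous_on \<Omega> (\<lambda>u. solve_linear (A u) (Q *v axis j 1))" .
      have e: "jacobian \<psi> (at u) *v axis j 1 = solve_linear (A u) (Q *v axis j 1)" if "u \<in> \<Omega>" for u
        by (rule solve_linear[OF detA[OF that]]) (simp add: Av DJ[OF that])
      then have "jacobian \<psi> (at u) $ i $ j = solve_linear (A u) (Q *v axis j 1) $ i" if "u \<in> \<Omega>" for u
        unfolding e[OF that, symmetric] by (simp add: matrix_vector_mult_basis column_def)
      then show ?thesis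
        using continuous_on_component[OF c, of i] by (simp cong: continuous_on_cong)
    qed
    then show "continuous_on \<Omega> (\<lambda>u. jacobian \<psi> (at u))"
      by (intro continuous_on_vec_lambda[of _ "\<lambda>i u. jacobian \<psi> (at u) $ i", simplified]
          continuous_on_vec_lambda[of _ "\<lambda>j u. jacobian \<psi> (at u) $ _ $ j", simplified])
  qed
  moreover have "x \<in> \<psi> ` \<Omega>" unfolding img using x V(3) W0(2) by auto
  ultimately show ?thesis by (rule that)
qed

text \<open>By the basis theorem finitely many systems of local equations suffice for all of M, and each of
  them together with the linear equations has finitely many nondegenerate solutions.\<close>
lemma finite_transversal_intersection:
  fixes M :: "(real^'N) set" and A :: "real^'N^'n"
  assumes am: "algebraic_manifold CARD('n) M"
    and trans: "\<And>x v. x \<in> M \<Longrightarrow> A *v x = b \<Longrightarrow> v \<in> tangent_space M x \<Longrightarrow> A *v v = 0 \<Longrightarrow> v = 0"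
  shows "finite (M \<inter> linear_section A b)"
proof -
  obtain V W where V: "open W" "M = nonsingular_points CARD('n) V \<inter> W" "M \<subseteq> V"
    using am by (rule algebraic_manifoldE)
  have "\<exists>P. \<exists>Q :: real^'n^'N. chart_data V x P Q" if "x \<in> M" for x
  proof -
    have "x \<in> nonsingular_points CARD('n) V" using V(2) that by auto
    then show ?thesis by (rule nonsingular_point_chart) blast
  qed
  then obtain P and Q :: "real^'N \<Rightarrow> real^'n^'N" where cd: "\<And>x. x \<in> M \<Longrightarrow> chart_data V x (P x) (Q x)"
    by metis
  \<comment> \<open>The Jacobian determinant at y of the chart map centred at x. Where it is
    nonzero, the gradients of \<open>P x\<close> cut out the tangent space at points y of M.\<close>
  define h where "h x y = det (matrix (chart_deriv (P x) (Q x) x y))" for x y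
  have h_iff: "h x y \<noteq> 0 \<longleftrightarrow> inj (chart_deriv (P x) (Q x) x y)" for x y
  proof -
    have "(*v) (matrix (chart_deriv (P x) (Q x) x y)) = chart_deriv (P x) (Q x) x y"
      using linear_chart_deriv[of "P x" "Q x" x y] by (auto simp: matrix_works)
    then show ?thesis unfolding h_def
      by (metis det_eq_0_rank full_rank_injective less_rank_noninjective)
  qed
  have poly_p: "real_polynomial_function p" if "x \<in> M" "p \<in> P x" for x p
    using cd[OF that(1)] that(2) by (auto simp: chart_data_def)
  have poly_h: "real_polynomial_function (h x)" if "x \<in> M" for x
    unfolding h_def[abs_def]
  proof (rule real_polynomial_function_det)
    fix i j :: 'N
    have "(axis j 1 \<bullet> grad p y) = grad p y $ j" for p y
      by (subst inner_commute) (simp add: inner_axis)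
    then have "matrix (chart_deriv (P x) (Q x) x y) $ i $ j =
      (Q x *v (transpose (Q x) *v axis j 1)) $ i + (\<Sum>p\<in>P x. grad p y $ j * grad p x $ i)" for y
      by (simp add: matrix_def chart_deriv_def sum_component del: transpose_matrix_vector)
    moreover have "real_polynomial_function (\<lambda>y. (Q x *v (transpose (Q x) *v axis j 1)) $ i + (\<Sum>p\<in>P x. grad p y $ j * grad p x $ i))"
      using cd[OF that] grad_polynomial(2)[OF poly_p[OF that]]
      by (intro real_polynomial_function.intros(2-4) real_polynomial_function_sum) (auto simp: chart_data_def)
    ultimately show "real_polynomial_function (\<lambda>y. matrix (chart_deriv (P x) (Q x) x y) $ i $ j)" by simp
  qed
  have "\<exists>F\<subseteq>h ` M. finite F \<and> (\<forall>f\<in>h ` M. \<forall>y. f y \<noteq> 0 \<longrightarrow> (\<exists>f\<in>F. f y \<noteq> 0))"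
    using poly_h by (intro finite_subfamily_same_zeros) auto
  then obtain F0 where F0: "F0 \<subseteq> h ` M" "finite F0" "\<forall>f\<in>h ` M. \<forall>y. f y \<noteq> 0 \<longrightarrow> (\<exists>f\<in>F0. f y \<noteq> 0)"
    by blast
  obtain F where "F \<subseteq> M" "finite F" "F0 = h ` F" using finite_subset_image[OF F0(2,1)] by blast
  with F0(3) have F: "F \<subseteq> M" "finite F" "\<And>x y. x \<in> M \<Longrightarrow> h x y \<noteq> 0 \<Longrightarrow> \<exists>z\<in>F. h z y \<noteq> 0"
    by auto
  \<comment> \<open>The determinant of the chart centred at y is nonzero at y, so one of the
    finitely many chosen determinants is nonzero there too.\<close>
  have cover: "M \<inter> linear_section A b \<subseteq> (\<Union>x\<in>F. {y \<in> M. A *v y = b \<and> h x y \<noteq> 0})"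
  proof
    fix y assume y: "y \<in> M \<inter> linear_section A b"
    have "h y y \<noteq> 0" using y unfolding h_iff by (intro inj_chart_deriv_base[OF cd]) auto
    then obtain x where "x \<in> F" "h x y \<noteq> 0" using F(3)[of y y] y by auto
    then show "y \<in> (\<Union>x\<in>F. {y \<in> M. A *v y = b \<and> h x y \<noteq> 0})" using y by (auto simp: linear_section_def)
  qed
  have "finite {y \<in> M. A *v y = b \<and> h x y \<noteq> 0}" if "x \<in> F" for x
  proof -
    have xM: "x \<in> M" using that F(1) by auto
    note cdx = cd[OF xM]
    \<comment> \<open>The linear equations take the place of the tangent coordinates, which yields a
      square polynomial system. By transversality its derivative is injective at the points in
      question.\<close>
    define H where "H y = Q x *v (A *v y - b) + (\<Sum>p\<in>P x. p y *\<^sub>R grad p x)" for y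
    have "real_polynomial_function (\<lambda>y. H y $ k)" for k
    proof -
      have "real_polynomial_function (\<lambda>y. (Q x *v (A *v y)) $ k + (- (Q x *v b) $ k) + (\<Sum>p\<in>P x. p y * grad p x $ k))"
        using cdx poly_p[OF xM]
        by (intro real_polynomial_function.intros(2-4) real_polynomial_function_sum)
           (auto simp: chart_data_def intro!: real_polynomial_function.intros(1)
             bounded_linear_compose[OF bounded_linear_vec_nth] bounded_linear_compose[OF bounded_linear_matrix_vector] bounded_linear_matrix_vector)
      then show ?thesis by (simp add: H_def sum_component matrix_vector_mult_diff_distrib)
    qed
    then have "finite {z. H z = 0 \<and> (\<exists>H'. (H has_derivative H') (at z) \<and> inj H')}"
      by (rule finite_nondegenerate_zeros)
    moreover have "{y \<in> M. A *v y = b \<and> h x y \<noteq> 0} \<subseteq> {z. H z = 0 \<and> (\<exists>H'. (H has_derivative H') (at z) \<and> inj H')}"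
    proof safe
      fix y assume y: "y \<in> M" "b = A *v y" "h x y \<noteq> 0"
      have "p y = 0" if "p \<in> P x" for p using cdx that y(1) V(3) by (auto simp: chart_data_def)
      then have "(\<Sum>p\<in>P x. p y *\<^sub>R grad p x) = 0" by (intro sum.neutral) auto
      then show "H y = 0" by (simp add: H_def y(2))
      define H' where "H' v = Q x *v (A *v v) + (\<Sum>p\<in>P x. (v \<bullet> grad p y) *\<^sub>R grad p x)" for v
      have "((\<lambda>y. Q x *v (A *v y - b)) has_derivative (\<lambda>v. Q x *v (A *v v))) (at y)"
        by (intro bounded_linear.has_derivative[OF bounded_linear_matrix_vector] has_derivative_diff[where g' = "\<lambda>_. 0", simplified]
            bounded_linear_imp_has_derivative bounded_linear_matrix_vector has_derivative_const)
      moreover have "((\<lambda>y. \<Sum>p\<in>P x. p y *\<^sub>R grad p x) has_derivative (\<lambda>v. \<Sum>p\<in>P x. (v \<bullet> grad p y) *\<^sub>R grad p x)) (at y)"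
        using grad_polynomial(1)[OF poly_p[OF xM]] by (intro has_derivative_sum has_derivative_scaleR_left) auto
      ultimately have der: "(H has_derivative H') (at y)"
        unfolding H_def[abs_def] H'_def[abs_def] by (rule has_derivative_add)
      obtain U and \<psi> :: "real^'n \<Rightarrow> real^'N" and u where lp: "local_parametrization M U \<psi>" "u \<in> U" "y = \<psi> u"
        using exists_local_parametrization[OF am y(1)] by blast
      let ?J = "jacobian \<psi> (at u)"
      have T: "tangent_space M y = range ((*v) ?J)"
        using tangent_space_parametrization[OF am lp(1,2)] lp(3) by simp
      have "inj ((*v) ?J)" using lp by (auto simp: local_parametrization_def)
      then have "dim (tangent_space M y) = CARD('n)"
        unfolding T using full_rank_injective[of ?J] rank_dim_range[of ?J] by simp
      moreover have "tangent_space M y \<subseteq> {v. \<forall>p\<in>P x. v \<bullet> grad p y = 0}"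
        using tangent_space_subset[OF V(3)] cdx by (auto simp: chart_data_def)
      moreover have "subspace (tangent_space M y)" unfolding T by (simp add: linear_subspace_image)
      ultimately have K: "tangent_space M y = {v. \<forall>p\<in>P x. v \<bullet> grad p y = 0}"
        using y(3) unfolding h_iff by (intro chart_kernel[OF cdx])
      have linH': "linear H'" using der by (rule has_derivative_linear)
      have "inj H'"
      proof (subst linear_injective_0[OF linH'], intro allI impI)
        fix v assume "H' v = 0"
        then have v: "A *v v = 0 \<and> (\<forall>p\<in>P x. v \<bullet> grad p y = 0)"
          unfolding H'_def by (rule chart_data_split[OF cdx])
        then show "v = 0" using trans[OF y(1), of v] y(2) K by blast
      qed
      with der show "\<exists>H'. (H has_derivative H') (at y) \<and> inj H'" by blast
    qed
    ultimately show ?thesis by (rule finite_subset[rotated])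
  qed
  then have "finite (\<Union>x\<in>F. {y \<in> M. A *v y = b \<and> h x y \<noteq> 0})" using F(2) by blast
  then show ?thesis using cover by (rule finite_subset[rotated])
qed

section \<open>The area formula for random linear sections\<close>

text \<open>Completeness of Lebesgue measure absorbs the exceptional set. Sums over sections are
  compared with Borel functions only almost everywhere and become measurable in this way.\<close>

lemma measurable_lebesgue_AE_eq:
  fixes f g :: "'a::euclidean_space \<Rightarrow> 'b::topological_space"
  assumes g: "g \<in> borel_measurable lborel" and ae: "AE x in lborel. f x = g x"
  shows "f \<in> borel_measurable lebesgue"
proof (rule measurableI)
  fix B :: "'b set" assume B: "B \<in> sets borel"
  obtain N where N: "N \<in> null_sets lborel" "{x. f x \<noteq> g x} \<subseteq> N"
    using ae by (auto simp: eventually_ae_filter)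
  have "f -` B = (g -` B - N) \<union> (f -` B \<inter> N)" using N(2) by auto
  moreover have "g -` B - N \<in> sets lborel"
    using measurable_sets[OF g B] N(1) by (intro sets.Diff) auto
  moreover have "f -` B \<inter> N \<subseteq> N" by auto
  ultimately have "f -` B \<in> sets lebesgue" using N(1) by (intro sets_completionI)
  then show "f -` B \<inter> space lebesgue \<in> sets lebesgue" by simp
qed simp

lemma borel_measurable_fst [measurable]:
  "fst \<in> borel_measurable (borel :: ('a::topological_space \<times> 'b::topological_space) measure)"
  by (rule borel_measurable_continuous_onI) (rule continuous_on_fst[OF continuous_on_id])

lemma borel_measurable_snd [measurable]:
  "snd \<in> borel_measurable (borel :: ('a::topological_space \<times> 'b::topological_space) measure)"
  by (rule borel_measurable_continuous_onI) (rule continuous_on_snd[OF continuous_on_id])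

lemma bounded_bilinear_matrix_vector: "bounded_bilinear (\<lambda>(A::real^'N^'n) x. A *v x)"
proof (rule bilinear_conv_bounded_bilinear[THEN iffD1])
  show "bilinear (\<lambda>(A::real^'N^'n) x. A *v x)"
    unfolding bilinear_def
    by (auto intro!: linearI simp: matrix_vector_right_distrib matrix_vector_mult_scaleR
        matrix_vector_mult_add_rdistrib scaleR_matrix_vector_assoc)
qed

lemma continuous_on_matrix_vector [continuous_intros]:
  fixes f :: "'a::topological_space \<Rightarrow> real^'N^'n"
  shows "continuous_on S f \<Longrightarrow> continuous_on S g \<Longrightarrow> continuous_on S (\<lambda>x. f x *v g x)"
  by (rule bounded_bilinear.continuous_on[OF bounded_bilinear_matrix_vector])

lemma continuous_on_det_mult:
  fixes f :: "'a::topological_space \<Rightarrow> real^'N^'n" and g :: "'a \<Rightarrow> real^'n^'N"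
  assumes "continuous_on S f" "continuous_on S g"
  shows "continuous_on S (\<lambda>x. det (f x ** g x))"
  unfolding matrix_matrix_mult_def
  by (intro continuous_on_det) (auto intro!: continuous_intros assms)

text \<open>The open set is a countable union of boxes. A continuous image of such a set is a
  countable union of compact sets, hence Borel.\<close>

lemma fsigma_closed_Int_open:
  fixes C W :: "'a::euclidean_space set"
  assumes "closed C" "open W"
  shows "\<exists>F :: nat \<Rightarrow> 'a set. (\<forall>n. compact (F n)) \<and> C \<inter> W = (\<Union>n. F n)"
proof -
  obtain \<D> where \<D>: "countable \<D>" "\<And>X. X \<in> \<D> \<Longrightarrow> \<exists>a b. X = cbox a b" "\<Union>\<D> = W"
    by (rule open_countable_Union_open_cbox[OF assms(2)]) (rule that)
  define D where "D = from_nat_into (insert {} \<D>)"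
  have "range D = insert {} \<D>" unfolding D_def using \<D>(1) by (intro range_from_nat_into) auto
  then have "D n \<in> insert {} \<D>" "(\<Union>n. D n) = W" for n
    using \<D>(3) by (auto simp del: range_from_nat_into)
  then have D: "compact (D n)" "(\<Union>n. D n) = W" for n
    using \<D>(2) by (metis compact_cbox compact_empty insert_iff)+
  show ?thesis
    by (rule exI[of _ "\<lambda>n. C \<inter> D n"]) (use D assms(1) in \<open>auto intro: closed_Int_compact\<close>)
qed

section \<open>The averaged area formula on one parametrized piece\<close>

locale parametrized =
  fixes M :: "(real^'N) set" and U :: "(real^'n) set" and \<psi> :: "real^'n \<Rightarrow> real^'N"
  assumes am: "algebraic_manifold CARD('n) M" and lp: "local_parametrization M U \<psi>"
begin

abbreviation "J u \<equiv> jacobian \<psi> (at u)"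

text \<open>Keeping A as a component turns the family of maps from u to A psi(u) into one map
  between spaces of equal dimension, whose local inverses are continuous jointly in A and b.\<close>

definition \<Theta> :: "(real^'N^'n) \<times> (real^'n) \<Rightarrow> (real^'N^'n) \<times> (real^'n)" where
  "\<Theta> z = (fst z, fst z *v \<psi> (snd z))"

definition regular :: "((real^'N^'n) \<times> (real^'n)) set" where
  "regular = {z. snd z \<in> U \<and> det (fst z ** J (snd z)) \<noteq> 0}"

lemma open_U: "open U"
  using lp by (simp add: local_parametrization_def)

lemma cont_J: "continuous_on U (\<lambda>u. J u)"
  using lp by (simp add: local_parametrization_def)

lemma der_psi: "u \<in> U \<Longrightarrow> (\<psi> has_derivative ((*v) (J u))) (at u)"
  by (rule local_parametrization_has_derivative[OF lp])

lemma cont_psi: "continuous_on U \<psi>"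
  using der_psi by (meson continuous_on_eq_continuous_at has_derivative_continuous open_U)

lemma open_UNIV_U: "open ((UNIV :: (real^'N^'n) set) \<times> U)"
  by (intro open_Times open_U open_UNIV)

lemma cont_det: "continuous_on ((UNIV :: (real^'N^'n) set) \<times> U) (\<lambda>z. det (fst z ** J (snd z)))"
  by (intro continuous_on_det_mult continuous_intros continuous_on_compose2[OF cont_J]) auto

lemma cont_Theta: "continuous_on ((UNIV :: (real^'N^'n) set) \<times> U) \<Theta>"
  unfolding \<Theta>_def
  by (intro continuous_intros continuous_on_compose2[OF cont_psi]) auto

lemma open_regular: "open regular"
proof -
  have "regular = (UNIV \<times> U) \<inter> (\<lambda>z. det (fst z ** J (snd z))) -` (- {0})"
    by (auto simp: regular_def)
  moreover have "open ((UNIV \<times> U) \<inter> (\<lambda>z. det (fst z ** J (snd z))) -` (- {0}))"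
    by (rule continuous_open_preimage[OF cont_det open_UNIV_U]) (simp add: open_Compl)
  ultimately show ?thesis by simp
qed

text \<open>The derivative is block triangular, with the identity on A and
  \<open>fst z ** J (snd z)\<close> on u as diagonal blocks, so it is invertible on the regular
  set.\<close>

lemma Theta_local_homeomorphism:
  assumes z: "z \<in> regular"
  obtains W G where "open W" "z \<in> W" "W \<subseteq> regular" "open (\<Theta> ` W)" "continuous_on (\<Theta> ` W) G" "\<And>w. w \<in> W \<Longrightarrow> G (\<Theta> w) = w"
proof -
  define \<Theta>' where "\<Theta>' w h = (fst h, fst w *v (J (snd w) *v snd h) + fst h *v \<psi> (snd w))"
    for w h :: "(real^'N^'n) \<times> (real^'n)"
  have der: "(\<Theta> has_derivative \<Theta>' w) (at w)" if "w \<in> regular" for w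
  proof -
    have "snd w \<in> U" using that by (simp add: regular_def)
    then have "((\<lambda>z. \<psi> (snd z)) has_derivative (\<lambda>h. J (snd w) *v snd h)) (at w)"
      using diff_chain_at[OF bounded_linear_imp_has_derivative[OF bounded_linear_snd] der_psi] by (simp add: o_def)
    then have "((\<lambda>z. fst z *v \<psi> (snd z)) has_derivative (\<lambda>h. fst w *v (J (snd w) *v snd h) + fst h *v \<psi> (snd w))) (at w)"
      by (intro bounded_bilinear.FDERIV[OF bounded_bilinear_matrix_vector]) (auto intro: derivative_intros)
    then show ?thesis unfolding \<Theta>_def[abs_def] \<Theta>'_def[abs_def]
      by (intro has_derivative_Pair) (auto intro: derivative_intros)
  qed
  have lin: "bounded_linear (\<Theta>' w)" if "w \<in> regular" for w using der[OF that] by (rule has_derivative_bounded_linear)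
  have app: "blinfun_apply (Blinfun (\<Theta>' w)) = \<Theta>' w" if "w \<in> regular" for w
    using lin[OF that] by (rule bounded_linear_Blinfun_apply)
  have cont: "continuous_on regular (\<lambda>w. Blinfun (\<Theta>' w))"
  proof (rule continuous_on_blinfun_componentwise)
    fix i
    have "continuous_on regular (\<lambda>w. \<Theta>' w i)"
      unfolding \<Theta>'_def
      by (intro continuous_intros continuous_on_compose2[OF cont_psi] continuous_on_compose2[OF cont_J])
         (auto simp: regular_def)
    then show "continuous_on regular (\<lambda>w. blinfun_apply (Blinfun (\<Theta>' w)) i)"
      by (rule continuous_on_eq) (simp add: app)
  qed
  have linz: "linear (\<Theta>' z)" using lin[OF z] by (rule bounded_linear.linear)
  have "inj (\<Theta>' z)"
  proof (subst linear_injective_0[OF linz], intro allI impI)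
    fix h assume "\<Theta>' z h = 0"
    then have h: "fst h = 0" "fst z *v (J (snd z) *v snd h) = 0"
      by (auto simp: \<Theta>'_def zero_prod_def)
    have "det (fst z ** J (snd z)) \<noteq> 0" using z by (simp add: regular_def)
    then have "inj ((*v) (fst z ** J (snd z)))" by (simp add: invertible_det_nz[symmetric] invertible_eq_bij bij_def)
    moreover have "(fst z ** J (snd z)) *v snd h = (fst z ** J (snd z)) *v 0"
      using h(2) by (simp add: matrix_vector_mul_assoc)
    ultimately have "snd h = 0" by (rule injD)
    then show "h = 0" using h(1) by (simp add: prod_eq_iff)
  qed
  then obtain k where k: "linear k" "k \<circ> \<Theta>' z = id" using linear_injective_left_inverse[OF linz] by blast
  have "k (\<Theta>' z h) = h" for h using fun_cong[OF k(2), of h] by simp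
  then have inv: "Blinfun k o\<^sub>L Blinfun (\<Theta>' z) = id_blinfun"
    using k(1) by (intro blinfun_eqI)
      (simp add: app[OF z] bounded_linear_Blinfun_apply linear_conv_bounded_linear[symmetric])
  obtain U' V' G G' where IF: "open U'" "U' \<subseteq> regular" "z \<in> U'" "open V'" "homeomorphism U' V' \<Theta> G"
  proof (rule inverse_function_theorem[of regular \<Theta> "\<lambda>w. Blinfun (\<Theta>' w)" z "Blinfun k"])
    show "(\<Theta> has_derivative blinfun_apply (Blinfun (\<Theta>' w))) (at w)" if "w \<in> regular" for w
      unfolding app[OF that] by (rule der[OF that])
  qed (use cont inv open_regular z in auto)
  then have "\<Theta> ` U' = V'" "continuous_on V' G" "\<And>w. w \<in> U' \<Longrightarrow> G (\<Theta> w) = w"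
    by (auto simp: homeomorphism_def)
  with IF show ?thesis by (intro that[of U' G]) auto
qed

text \<open>\<open>\<psi>\<close> and its Jacobian are continuous on U only; the extensions by 0 are
  Borel on the whole space.\<close>

definition \<psi>\<^sub>0 :: "real^'n \<Rightarrow> real^'N" where "\<psi>\<^sub>0 u = (if u \<in> U then \<psi> u else 0)"
definition J\<^sub>0 :: "real^'n \<Rightarrow> real^'n^'N" where "J\<^sub>0 u = (if u \<in> U then J u else 0)"

lemma U_borel [measurable]: "U \<in> sets borel"
  using open_U by simp

lemma psi0_measurable [measurable]: "\<psi>\<^sub>0 \<in> borel_measurable borel"
  unfolding \<psi>\<^sub>0_def[abs_def] by (intro borel_measurable_continuous_on_if cont_psi) auto

lemma J0_measurable [measurable]: "J\<^sub>0 \<in> borel_measurable borel"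
  unfolding J\<^sub>0_def[abs_def] by (intro borel_measurable_continuous_on_if cont_J) auto

definition fiber :: "(real^'N^'n) \<times> (real^'n) \<Rightarrow> (real^'n) set" where
  "fiber z = {u\<in>U. fst z *v \<psi> u = snd z}"

definition critical :: "((real^'N^'n) \<times> (real^'n)) set" where
  "critical = \<Theta> ` {z. snd z \<in> U \<and> det (fst z ** J (snd z)) = 0}"

lemma critical_iff: "z \<in> critical \<longleftrightarrow> (\<exists>u\<in>fiber z. det (fst z ** J u) = 0)"
  by (cases z) (auto simp: critical_def fiber_def \<Theta>_def image_iff)

text \<open>For fixed A the slice consists of the critical values of u to A psi(u) and is null by
  Sard's theorem; Tonelli integrates over A. The set is Borel, as the singular pairs form a closed
  subset of an open set, whose continuous image is a countable union of compact sets.\<close>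

lemma critical_null: "critical \<in> null_sets lborel"
proof -
  let ?K = "{z. snd z \<in> U \<and> det (fst z ** J (snd z)) = 0}"
  have "closedin (top_of_set (UNIV \<times> U)) (UNIV \<times> U \<inter> (\<lambda>z. det (fst z ** J (snd z))) -` {0})"
    by (rule continuous_closedin_preimage[OF cont_det]) simp
  moreover have "UNIV \<times> U \<inter> (\<lambda>z. det (fst z ** J (snd z))) -` {0} = ?K" by auto
  ultimately have "closedin (top_of_set (UNIV \<times> U)) ?K" by simp
  then obtain C where C: "closed C" "?K = UNIV \<times> U \<inter> C"
    by (auto simp: closedin_closed)
  from fsigma_closed_Int_open[OF C(1) open_UNIV_U]
  obtain F :: "nat \<Rightarrow> _" where F': "(\<forall>n. compact (F n)) \<and> C \<inter> (UNIV \<times> U) = (\<Union>n. F n)" ..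
  then have F: "\<And>n. compact (F n)" "C \<inter> (UNIV \<times> U) = (\<Union>n. F n)" by simp_all
  have FU: "F n \<subseteq> UNIV \<times> U" for n using F(2) by auto
  have "critical = (\<Union>n. \<Theta> ` F n)" unfolding critical_def C(2) using F(2) by (auto simp: Int_commute)
  moreover have "compact (\<Theta> ` F n)" for n
    using F(1) FU cont_Theta by (intro compact_continuous_image) (auto intro: continuous_on_subset)
  then have "(\<Union>n. \<Theta> ` F n) \<in> sets borel" by (intro sets.countable_nat_UN image_subsetI borel_compact) assumption
  ultimately have meas: "critical \<in> sets borel" by simp
  have fib: "emeasure lborel (Pair A -` critical) = 0" for A
  proof -
    have "Pair A -` critical = (\<lambda>u. A *v \<psi> u) ` {u\<in>U. det (A ** J u) = 0}"
      by (auto simp: critical_iff fiber_def)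
    moreover have "negligible ((\<lambda>u. A *v \<psi> u) ` {u\<in>U. det (A ** J u) = 0})"
    proof (rule Sard_equidim)
      fix u assume u: "u \<in> {u\<in>U. det (A ** J u) = 0}"
      have "((\<lambda>u. A *v \<psi> u) has_derivative (\<lambda>h. A *v (J u *v h))) (at u)"
        using u by (intro bounded_linear.has_derivative[OF bounded_linear_matrix_vector] der_psi) auto
      then have "((\<lambda>u. A *v \<psi> u) has_derivative ((*v) (A ** J u))) (at u)"
        by (simp add: matrix_vector_mul_assoc)
      then show "((\<lambda>u. A *v \<psi> u) has_derivative ((*v) (A ** J u))) (at u within {u\<in>U. det (A ** J u) = 0})"
        by (rule has_derivative_at_withinI)
      show "det (matrix ((*v) (A ** J u))) = 0" using u by simp
    qed
    moreover have "Pair A -` critical \<in> sets borel"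
      using measurable_sets[OF _ meas, of "Pair A" borel] by simp
    ultimately show ?thesis
      by (simp add: negligible_iff_null_sets null_sets_completion_iff null_sets_def)
  qed
  have "emeasure (lborel \<Otimes>\<^sub>M lborel) critical = (\<integral>\<^sup>+A. emeasure lborel (Pair A -` critical) \<partial>lborel)"
    by (rule lborel.emeasure_pair_measure_alt) (simp only: lborel_prod sets_lborel meas)
  then show ?thesis using meas by (simp add: lborel_prod fib null_sets_def)
qed

lemma regular_cover:
  obtains W G :: "nat \<Rightarrow> _" where "\<And>k. open (W k)" "\<And>k. open (\<Theta> ` W k)" "(\<Union>k. W k) = regular"
    "\<And>k. continuous_on (\<Theta> ` W k) (G k)" "\<And>k w. w \<in> W k \<Longrightarrow> G k (\<Theta> w) = w"
proof -
  define \<F> where "\<F> = {W. open W \<and> W \<subseteq> regular \<and> open (\<Theta> ` W) \<and>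
    (\<exists>G. continuous_on (\<Theta> ` W) G \<and> (\<forall>w\<in>W. G (\<Theta> w) = w))}"
  have U\<F>: "\<Union>\<F> = regular"
  proof
    show "\<Union>\<F> \<subseteq> regular" by (auto simp: \<F>_def)
    show "regular \<subseteq> \<Union>\<F>"
    proof
      fix z assume "z \<in> regular"
      then obtain W G where "open W" "z \<in> W" "W \<subseteq> regular" "open (\<Theta> ` W)" "continuous_on (\<Theta> ` W) G"
        "\<And>w. w \<in> W \<Longrightarrow> G (\<Theta> w) = w"
        by (rule Theta_local_homeomorphism) (rule that)
      then have "W \<in> \<F>" "z \<in> W" unfolding \<F>_def by blast+
      then show "z \<in> \<Union>\<F>" by blast
    qed
  qed
  have "open S" if "S \<in> \<F>" for S using that by (simp add: \<F>_def)
  then obtain \<F>' where \<F>': "\<F>' \<subseteq> \<F>" "countable \<F>'" "\<Union>\<F>' = \<Union>\<F>"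
    by (rule Lindelof)
  \<comment> \<open>Inserting the empty set makes the family nonempty, so that it can be enumerated
    by all natural numbers.\<close>
  define W where "W = from_nat_into (insert {} \<F>')"
  have r: "range W = insert {} \<F>'" unfolding W_def using \<F>'(2) by (intro range_from_nat_into) auto
  have "{} \<in> \<F>" by (simp add: \<F>_def)
  then have "insert {} \<F>' \<subseteq> \<F>" using \<F>'(1) by simp
  then have W: "W k \<in> \<F>" for k unfolding r[symmetric] using rangeI by (rule subsetD)
  have "\<forall>k. \<exists>G. continuous_on (\<Theta> ` W k) G \<and> (\<forall>w\<in>W k. G (\<Theta> w) = w)"
    using W by (simp add: \<F>_def)
  then obtain G where G: "\<And>k. continuous_on (\<Theta> ` W k) (G k) \<and> (\<forall>w\<in>W k. G k (\<Theta> w) = w)" by metis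
  have "(\<Union>k. W k) = regular" using r \<F>'(3) U\<F> by auto
  then show ?thesis using W G by (intro that[of W G]) (auto simp: \<F>_def)
qed

text \<open>As an integral over counting measure it is countably additive in h and gives infinite
  fibres their true value.\<close>

definition fiber_sum :: "(real^'n \<Rightarrow> ennreal) \<Rightarrow> (real^'N^'n) \<times> (real^'n) \<Rightarrow> ennreal" where
  "fiber_sum h z = (\<integral>\<^sup>+u. h u * indicator (fiber z) u \<partial>count_space UNIV)"

text \<open>The regular set is cut into countably many Borel pieces on which \<open>\<Theta>\<close>
  is injective with a Borel inverse. On each piece the sum over the fibre has at most one term,
  which is a Borel function of (A, b), and the change of variables applies for each A.\<close>

lemma fiber_sum_area:
  assumes h[measurable]: "h \<in> borel_measurable borel"
  shows "\<exists>g\<in>borel_measurable borel. (AE z in lborel. fiber_sum h z = g z) \<and>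
    (\<integral>\<^sup>+z. g z * ennreal (gmat (fst z) * gvec (snd z)) \<partial>lborel) =
    (\<integral>\<^sup>+u. h u * indicator U u * gauss_det (\<psi>\<^sub>0 u) (J\<^sub>0 u) \<partial>lborel)"
proof -
  obtain W G where WG: "\<And>k::nat. open (W k)" "\<And>k. open (\<Theta> ` W k)" "(\<Union>k. W k) = regular"
    "\<And>k. continuous_on (\<Theta> ` W k) (G k)" "\<And>k w. w \<in> W k \<Longrightarrow> G k (\<Theta> w) = w"
    by (rule regular_cover) (rule that)
  define D where "D = disjointed W"
  have D: "disjoint_family D" "(\<Union>k. D k) = regular" "\<And>k. D k \<subseteq> W k"
    unfolding D_def WG(3)[symmetric] by (auto intro: disjoint_family_disjointed UN_disjointed_eq simp: UN_disjointed_eq dest: disjointed_subset[THEN subsetD])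
  have Dm[measurable]: "D k \<in> sets borel" for k
    using WG(1) unfolding D_def disjointed_def by (intro sets.Diff sets.finite_UN) auto
  define G0 where "G0 k z = (if z \<in> \<Theta> ` W k then G k z else 0)" for k z
  have G0[measurable]: "G0 k \<in> borel_measurable borel" for k
    unfolding G0_def using WG(2,4) by (intro borel_measurable_continuous_on_if) auto
  have G0_Theta: "G0 k (\<Theta> w) = w" if "w \<in> D k" for k w
  proof -
    have "w \<in> W k" using that D(3) by blast
    then show ?thesis by (simp add: G0_def WG(5))
  qed
  define T where "T k = \<Theta> ` D k" for k
  \<comment> \<open>The image is Borel, being a preimage under the local inverse within an open
    set.\<close>
  have T_eq: "T k = \<Theta> ` W k \<inter> G0 k -` D k" for k
    unfolding T_def using D(3)[of k] WG(5)[of _ k] by (auto simp: G0_def image_iff) (metis subsetD)+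
  have Tm[measurable]: "T k \<in> sets borel" for k
    unfolding T_eq using measurable_sets[OF G0 Dm, of k] WG(2)[of k] by auto
  define hk where "hk k z = h (snd (G0 k z)) * indicator (T k) z" for k z
  have snd_m[measurable]: "(\<lambda>z. snd (G0 k z)) \<in> borel_measurable borel" for k
    by measurable
  have hk[measurable]: "hk k \<in> borel_measurable borel" for k
    unfolding hk_def by measurable
  define g where "g z = (\<Sum>k. hk k z)" for z
  have g[measurable]: "g \<in> borel_measurable borel" unfolding g_def by measurable
  have fib: "fiber_sum h z = g z" if z: "z \<notin> critical" for z
  proof -
    define S where "S k = {u. (fst z, u) \<in> D k \<and> u \<in> fiber z}" for k
    have dS: "disjoint_family S"
      using D(1) unfolding disjoint_family_on_def S_def by blast
    have "fiber z = (\<Union>k. S k)"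
    proof -
      have "(fst z, u) \<in> regular" if "u \<in> fiber z" for u
        using z that by (auto simp: critical_iff regular_def fiber_def)
      then show ?thesis using D(2) by (auto simp: S_def)
    qed
    then have "indicator (fiber z) u = (\<Sum>k. indicator (S k) u :: ennreal)" for u
      using suminf_indicator[OF dS] by metis
    then have "fiber_sum h z = (\<integral>\<^sup>+u. (\<Sum>k. h u * indicator (S k) u) \<partial>count_space UNIV)"
      unfolding fiber_sum_def by simp
    also have "\<dots> = (\<Sum>k. \<integral>\<^sup>+u. h u * indicator (S k) u \<partial>count_space UNIV)"
      by (rule nn_integral_suminf) simp
    also have "\<dots> = g z"
      unfolding g_def
    proof (rule suminf_cong)
      fix k
      show "(\<integral>\<^sup>+u. h u * indicator (S k) u \<partial>count_space UNIV) = hk k z"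
      proof (cases "z \<in> T k")
        case True
        then obtain w where w: "w \<in> D k" "z = \<Theta> w" by (auto simp: T_def)
        have "snd w \<in> U" using w(1) D(2) by (auto simp: regular_def)
        have "S k = {snd w}"
        proof safe
          fix u assume "u \<in> S k"
          then have "(fst z, u) \<in> D k" "\<Theta> (fst z, u) = z"
            by (auto simp: S_def fiber_def \<Theta>_def prod_eq_iff)
          then have "(fst z, u) = w" using G0_Theta[of "(fst z, u)" k] G0_Theta[OF w(1)] w(2) by simp
          then show "u = snd w" by auto
        next
          show "snd w \<in> S k" using w \<open>snd w \<in> U\<close> by (auto simp: S_def fiber_def \<Theta>_def)
        qed
        then show ?thesis using True w G0_Theta[OF w(1)]
          by (simp add: hk_def nn_integral_indicator_singleton)
      next
        case False
        have "S k = {}"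
        proof safe
          fix u assume "u \<in> S k"
          then have "(fst z, u) \<in> D k" "\<Theta> (fst z, u) = z"
            by (auto simp: S_def fiber_def \<Theta>_def prod_eq_iff)
          then have "z \<in> T k" unfolding T_def by force
          then show "u \<in> {}" using False by simp
        qed
        then show ?thesis using False by (simp add: hk_def)
      qed
    qed
    finally show ?thesis .
  qed
  have AE: "AE z in lborel. fiber_sum h z = g z"
    using AE_not_in[OF critical_null] by eventually_elim (rule fib)
  define F where "F A u = gvec (A *v \<psi>\<^sub>0 u) * \<bar>det (A ** J\<^sub>0 u)\<bar>" for A :: "real^'N^'n" and u
  have Fm: "(\<lambda>(A, u). F A u) \<in> borel_measurable (borel \<Otimes>\<^sub>M borel)"
    unfolding F_def by measurable
  have Fm1[measurable]: "F A \<in> borel_measurable borel" for A unfolding F_def[abs_def] by measurable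
  have slice[measurable]: "Pair A -` D k \<in> sets borel" for A k
    using measurable_sets[OF _ Dm, of "Pair A" borel] by simp
  have sliceT[measurable]: "Pair A -` T k \<in> sets borel" for A k
    using measurable_sets[OF _ Tm, of "Pair A" borel] by simp
  have hkA[measurable]: "(\<lambda>b. hk k (A, b)) \<in> borel_measurable borel" for A k
    by (rule measurable_compose[OF _ hk]) simp
  have G0A[measurable]: "(\<lambda>b. snd (G0 k (A, b))) \<in> borel_measurable borel" for A k
    by (rule measurable_compose[OF _ snd_m]) simp
  \<comment> \<open>For fixed A, the change of variables from b to u on the slice of one
    piece.\<close>
  have one: "(\<integral>\<^sup>+b. ennreal (gvec b) * hk k (A, b) \<partial>lborel) =
    (\<integral>\<^sup>+u. h u * ennreal (F A u) * indicator (D k) (A, u) \<partial>lborel)" for A k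
  proof -
    let ?S = "Pair A -` D k"
    have "D k \<subseteq> regular" using D(2) by blast
    then have SU: "?S \<subseteq> U" by (auto simp: regular_def)
    have img: "(\<lambda>u. A *v \<psi> u) ` ?S = Pair A -` T k"
    proof (intro equalityI image_subsetI subsetI)
      fix u assume "u \<in> ?S"
      then have "\<Theta> (A, u) \<in> T k" unfolding T_def by auto
      then show "A *v \<psi> u \<in> Pair A -` T k" by (simp add: \<Theta>_def)
    next
      fix b assume "b \<in> Pair A -` T k"
      then obtain w where "w \<in> D k" "(A, b) = \<Theta> w" unfolding T_def by auto
      then show "b \<in> (\<lambda>u. A *v \<psi> u) ` ?S"
        by (intro image_eqI[of _ _ "snd w"]) (auto simp: \<Theta>_def)
    qed
    have der: "((\<lambda>u. A *v \<psi> u) has_derivative ((*v) (A ** J u))) (at u within ?S)" if "u \<in> ?S" for u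
    proof (rule has_derivative_at_withinI)
      have "((\<lambda>u. A *v \<psi> u) has_derivative (\<lambda>h. A *v (J u *v h))) (at u)"
        using that SU by (intro bounded_linear.has_derivative[OF bounded_linear_matrix_vector] der_psi) auto
      then show "((\<lambda>u. A *v \<psi> u) has_derivative ((*v) (A ** J u))) (at u)"
        by (simp add: matrix_vector_mul_assoc)
    qed
    have inv: "G0 k (A, A *v \<psi> u) = (A, u)" if "u \<in> ?S" for u
      using G0_Theta[of "(A, u)" k] that by (simp add: \<Theta>_def)
    have inj: "inj_on (\<lambda>u. A *v \<psi> u) ?S"
      by (rule inj_on_inverseI[of _ "\<lambda>b. snd (G0 k (A, b))"]) (simp add: inv)
    have dm: "(\<lambda>u. \<bar>det (matrix ((*v) (A ** J u)))\<bar> * indicator ?S u) \<in> borel_measurable borel"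
    proof -
      have e: "(\<lambda>u. \<bar>det (matrix ((*v) (A ** J u)))\<bar> * indicator ?S u) =
        (\<lambda>u. \<bar>det (A ** J\<^sub>0 u)\<bar> * indicator ?S u)"
        using SU by (auto simp: J\<^sub>0_def indicator_def fun_eq_iff)
      show ?thesis unfolding e by measurable
    qed
    have "(\<integral>\<^sup>+b. ennreal (gvec b) * hk k (A, b) \<partial>lborel) =
      (\<integral>\<^sup>+b. (ennreal (gvec b) * h (snd (G0 k (A, b)))) * indicator ((\<lambda>u. A *v \<psi> u) ` ?S) b \<partial>lborel)"
      unfolding img by (intro nn_integral_cong) (auto simp: hk_def indicator_def)
    also have "\<dots> = (\<integral>\<^sup>+u. (ennreal (gvec (A *v \<psi> u)) * h (snd (G0 k (A, A *v \<psi> u)))) *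
      (ennreal \<bar>det (matrix ((*v) (A ** J u)))\<bar> * indicator ?S u) \<partial>lborel)"
      by (rule nn_integral_injective_image[OF _ _ der inj dm]) (simp_all add: img)
    also have "\<dots> = (\<integral>\<^sup>+u. h u * ennreal (F A u) * indicator (D k) (A, u) \<partial>lborel)"
    proof (rule nn_integral_cong)
      fix u
      show "(ennreal (gvec (A *v \<psi> u)) * h (snd (G0 k (A, A *v \<psi> u)))) *
        (ennreal \<bar>det (matrix ((*v) (A ** J u)))\<bar> * indicator ?S u) = h u * ennreal (F A u) * indicator (D k) (A, u)"
      proof (cases "u \<in> ?S")
        case True
        then show ?thesis using SU inv[OF True]
          by (auto simp: F_def \<psi>\<^sub>0_def J\<^sub>0_def ennreal_mult mult_ac)
      qed auto
    qed
    finally show ?thesis .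
  qed
  \<comment> \<open>Singular parameters do not contribute to the integral over u, as the determinant
    in F vanishes there.\<close>
  have reg: "ennreal (F A u) * indicator regular (A, u) = ennreal (F A u) * indicator U u" for A u
    by (auto simp: indicator_def regular_def F_def J\<^sub>0_def)
  have sumD: "(\<Sum>k. indicator (D k) w :: ennreal) = indicator regular w" for w
    using suminf_indicator[OF D(1)] D(2) by simp
  have "(\<integral>\<^sup>+z. g z * ennreal (gmat (fst z) * gvec (snd z)) \<partial>lborel) =
    (\<integral>\<^sup>+A. \<integral>\<^sup>+b. g (A, b) * ennreal (gmat A * gvec b) \<partial>lborel \<partial>lborel)"
    unfolding lborel_prod[symmetric]
    by (subst lborel.nn_integral_fst[symmetric]) (simp_all add: lborel_prod borel_prod)
  also have "\<dots> = (\<integral>\<^sup>+A. \<integral>\<^sup>+u. h u * indicator U u * ennreal (gmat A * F A u) \<partial>lborel \<partial>lborel)"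
  proof (rule nn_integral_cong)
    fix A :: "real^'N^'n"
    have "(\<integral>\<^sup>+b. g (A, b) * ennreal (gmat A * gvec b) \<partial>lborel) =
      (\<integral>\<^sup>+b. (\<Sum>k. ennreal (gmat A) * (ennreal (gvec b) * hk k (A, b))) \<partial>lborel)"
      by (intro nn_integral_cong) (simp add: g_def ennreal_mult mult_ac)
    also have "\<dots> = (\<Sum>k. \<integral>\<^sup>+b. ennreal (gmat A) * (ennreal (gvec b) * hk k (A, b)) \<partial>lborel)"
      by (rule nn_integral_suminf) measurable
    also have "\<dots> = (\<Sum>k. ennreal (gmat A) * (\<integral>\<^sup>+u. h u * ennreal (F A u) * indicator (D k) (A, u) \<partial>lborel))"
      by (simp add: nn_integral_cmult one)
    also have "\<dots> = (\<Sum>k. \<integral>\<^sup>+u. ennreal (gmat A) * (h u * ennreal (F A u) * indicator (Pair A -` D k) u) \<partial>lborel)"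
      by (subst nn_integral_cmult[symmetric]) (simp_all add: indicator_def)
    also have "\<dots> = (\<integral>\<^sup>+u. (\<Sum>k. ennreal (gmat A) * (h u * ennreal (F A u) * indicator (Pair A -` D k) u)) \<partial>lborel)"
      by (rule nn_integral_suminf[symmetric]) measurable
    also have "\<dots> = (\<integral>\<^sup>+u. h u * indicator U u * ennreal (gmat A * F A u) \<partial>lborel)"
    proof (rule nn_integral_cong)
      fix u
      have "(\<Sum>k. ennreal (gmat A) * (h u * ennreal (F A u) * indicator (Pair A -` D k) u)) =
        ennreal (gmat A) * (h u * (ennreal (F A u) * (\<Sum>k. indicator (D k) (A, u))))"
        by (simp add: indicator_def mult.assoc)
      also have "\<dots> = ennreal (gmat A) * (h u * (ennreal (F A u) * indicator U u))"
        unfolding sumD reg ..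
      also have "\<dots> = h u * indicator U u * ennreal (gmat A * F A u)"
        by (simp add: ennreal_mult F_def mult_ac)
      finally show "(\<Sum>k. ennreal (gmat A) * (h u * ennreal (F A u) * indicator (Pair A -` D k) u)) =
        h u * indicator U u * ennreal (gmat A * F A u)" .
    qed
    finally show "(\<integral>\<^sup>+b. g (A, b) * ennreal (gmat A * gvec b) \<partial>lborel) =
      (\<integral>\<^sup>+u. h u * indicator U u * ennreal (gmat A * F A u) \<partial>lborel)" .
  qed
  also have "\<dots> = (\<integral>\<^sup>+u. \<integral>\<^sup>+A. h u * indicator U u * ennreal (gmat A * F A u) \<partial>lborel \<partial>lborel)"
    using Fm by (intro lborel_pair.Fubini'[symmetric]) (simp add: case_prod_beta)
  also have "\<dots> = (\<integral>\<^sup>+u. h u * indicator U u * gauss_det (\<psi>\<^sub>0 u) (J\<^sub>0 u) \<partial>lborel)"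
    unfolding gauss_det_def F_def
    by (intro nn_integral_cong) (simp add: nn_integral_cmult mult.assoc)
  finally show ?thesis using g AE by blast
qed

lemma gauss_det_measurable [measurable]: "(\<lambda>u. gauss_det (\<psi>\<^sub>0 u) (J\<^sub>0 u)) \<in> borel_measurable borel"
  unfolding gauss_det_def by measurable

text \<open>A Borel stand-in for the reciprocal of \<open>alpha\<close> along the parametrization.
  \<open>alpha\<close> refers to tangent spaces, so its measurability is not visible; as
  \<open>gauss_det\<close> is \<open>alpha\<close> times the Riemannian density, this quotient
  recovers the reciprocal on U.\<close>

definition \<alpha>inv :: "real^'n \<Rightarrow> ennreal" where
  "\<alpha>inv u = ennreal (sqrt (det (transpose (J\<^sub>0 u) ** J\<^sub>0 u)) / enn2real (gauss_det (\<psi>\<^sub>0 u) (J\<^sub>0 u)))"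

lemma ainv_measurable [measurable]: "\<alpha>inv \<in> borel_measurable borel"
proof -
  have [measurable]: "(\<lambda>u. transpose (J\<^sub>0 u)) \<in> borel_measurable borel"
    unfolding transpose_def
    by (subst borel_measurable_euclidean_space) (auto simp: Basis_vec_def inner_axis)
  show ?thesis unfolding \<alpha>inv_def[abs_def] by measurable
qed

lemma ainv_eq:
  assumes u: "u \<in> U"
  shows "\<alpha>inv u = ennreal (1 / alpha CARD('n) M (\<psi> u))"
    and "\<alpha>inv u * gauss_det (\<psi>\<^sub>0 u) (J\<^sub>0 u) = ennreal (sqrt (det (metric_tensor \<psi> u)))"
proof -
  let ?a = "alpha CARD('n) M (\<psi> u)" and ?d = "det (metric_tensor \<psi> u)"
  note F = gauss_det_parametrization[OF am lp u]
  have g: "gauss_det (\<psi>\<^sub>0 u) (J\<^sub>0 u) = ennreal (?a * sqrt ?d)"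
    using F u by (simp add: \<psi>\<^sub>0_def J\<^sub>0_def ennreal_mult)
  have d: "det (transpose (J\<^sub>0 u) ** J\<^sub>0 u) = ?d" using u by (simp add: J\<^sub>0_def metric_tensor_def)
  show e: "\<alpha>inv u = ennreal (1 / ?a)"
    unfolding \<alpha>inv_def g d using F(2,3) by (simp add: enn2real_ennreal)
  show "\<alpha>inv u * gauss_det (\<psi>\<^sub>0 u) (J\<^sub>0 u) = ennreal (sqrt ?d)"
    unfolding e g using F(2,3) by (simp add: ennreal_mult[symmetric])
qed

text \<open>The weight 1 / \<open>alpha\<close> cancels the factor \<open>alpha\<close> of the
  Gaussian mean, and the Riemannian density remains.\<close>

lemma area_formula:
  assumes h[measurable]: "h \<in> borel_measurable borel"
  shows "\<exists>g\<in>borel_measurable borel.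
    (AE z in lborel. fiber_sum (\<lambda>u. h u * ennreal (1 / alpha CARD('n) M (\<psi> u))) z = g z) \<and>
    (\<integral>\<^sup>+z. g z * ennreal (gmat (fst z) * gvec (snd z)) \<partial>lborel) =
    (\<integral>\<^sup>+u. h u * indicator U u * ennreal (sqrt (det (metric_tensor \<psi> u))) \<partial>lborel)"
proof -
  have eq: "fiber_sum (\<lambda>u. h u * ennreal (1 / alpha CARD('n) M (\<psi> u))) z = fiber_sum (\<lambda>u. h u * \<alpha>inv u) z" for z
    unfolding fiber_sum_def
    by (intro nn_integral_cong) (auto simp: indicator_def fiber_def ainv_eq(1))
  have "(\<integral>\<^sup>+u. (h u * \<alpha>inv u) * indicator U u * gauss_det (\<psi>\<^sub>0 u) (J\<^sub>0 u) \<partial>lborel) =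
    (\<integral>\<^sup>+u. h u * indicator U u * ennreal (sqrt (det (metric_tensor \<psi> u))) \<partial>lborel)"
    by (intro nn_integral_cong) (auto simp: indicator_def ainv_eq(2)[symmetric] mult.assoc)
  then show ?thesis using fiber_sum_area[of "\<lambda>u. h u * \<alpha>inv u"] unfolding eq by simp
qed

end

section \<open>The volume measure and integration over random sections\<close>

lemma gaussian_density_eq: "gaussian_density z = gmat (fst z) * gvec (snd z)"
  by (simp add: gaussian_density_def gmat_def gvec_def case_prod_beta)

lemma gaussian_density_measurable [measurable]:
  "gaussian_density \<in> borel_measurable (borel :: ((real^'N^'n) \<times> (real^'n)) measure)"
  unfolding gaussian_density_eq[abs_def] by measurable

lemma gaussian_density_pos: "0 < gaussian_density z"
  by (auto simp: gaussian_density_def case_prod_beta intro!: mult_pos_pos prod_pos normal_density_pos)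

definition section_sum :: "(real^'N) set \<Rightarrow> (real^'N \<Rightarrow> ennreal) \<Rightarrow> (real^'N^'n) \<times> (real^'n) \<Rightarrow> ennreal" where
  "section_sum M h z = (\<integral>\<^sup>+x. h x * ennreal (1 / alpha CARD('n) M x) \<partial>count_space (M \<inter> linear_section (fst z) (snd z)))"

context parametrized
begin

lemma image_psi: "openin (top_of_set M) (\<psi> ` U)" "\<psi> ` U \<subseteq> M" "inj_on \<psi> U"
proof -
  show o: "openin (top_of_set M) (\<psi> ` U)" using lp by (simp add: local_parametrization_def)
  then show "\<psi> ` U \<subseteq> M" by (rule openin_imp_subset)
  show "inj_on \<psi> U"
    using lp unfolding local_parametrization_def homeomorphism_def by (metis inj_on_inverseI)
qed

lemma psi_measurable_restrict: "\<psi> \<in> measurable (restrict_space borel U) (restrict_space borel M)"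
proof (rule measurable_restrict_space2)
  show "\<psi> \<in> space (restrict_space borel U) \<rightarrow> M" using image_psi(2) by (auto simp: space_restrict_space)
  show "\<psi> \<in> borel_measurable (restrict_space borel U)" by (rule borel_measurable_continuous_on_restrict[OF cont_psi])
qed

text \<open>As \<open>\<psi>\<close> is injective, the points of the section inside the patch
  correspond to the parameters in the fibre; the indicator of S suppresses all other points.\<close>

lemma section_sum_patch:
  assumes h: "h \<in> borel_measurable (restrict_space borel M)"
    and S: "S \<in> sets (restrict_space borel M)" "S \<subseteq> \<psi> ` U"
  shows "\<exists>g\<in>borel_measurable borel.
    (AE z in (lborel :: ((real^'N^'n) \<times> (real^'n)) measure). section_sum M (\<lambda>x. h x * indicator S x) z = g z) \<and>
    (\<integral>\<^sup>+z. g z * ennreal (gaussian_density z) \<partial>lborel) =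
    (\<integral>\<^sup>+u. h (\<psi> u) * indicator S (\<psi> u) * indicator U u * ennreal (sqrt (det (metric_tensor \<psi> u))) \<partial>lborel)"
proof -
  let ?h = "\<lambda>u. h (\<psi> u) * indicator S (\<psi> u) * indicator U u"
  have "(\<lambda>x. h x * indicator S x) \<in> borel_measurable (restrict_space borel M)"
    using h S(1) by simp
  then have "(\<lambda>u. h (\<psi> u) * indicator S (\<psi> u)) \<in> borel_measurable (restrict_space borel U)"
    by (rule measurable_compose[OF psi_measurable_restrict])
  then have hm: "?h \<in> borel_measurable borel"
    by (subst (asm) borel_measurable_restrict_space_iff_ennreal) auto
  have sf: "section_sum M (\<lambda>x. h x * indicator S x) z = fiber_sum (\<lambda>u. ?h u * ennreal (1 / alpha CARD('n) M (\<psi> u))) z" for z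
  proof -
    let ?f = "\<lambda>x. h x * indicator S x * ennreal (1 / alpha CARD('n) M x)"
    have "section_sum M (\<lambda>x. h x * indicator S x) z = (\<integral>\<^sup>+x. ?f x \<partial>count_space (\<psi> ` fiber z))"
      unfolding section_sum_def
    proof (rule nn_integral_count_space_eq)
      fix x assume "x \<in> M \<inter> linear_section (fst z) (snd z) - \<psi> ` fiber z"
      then have "x \<notin> S" using S(2) by (auto simp: fiber_def linear_section_def)
      then show "?f x = 0" by simp
    next
      fix x assume "x \<in> \<psi> ` fiber z - M \<inter> linear_section (fst z) (snd z)"
      then show "?f x = 0" using image_psi(2) by (auto simp: fiber_def linear_section_def)
    qed
    also have "\<dots> = (\<integral>\<^sup>+u. ?f (\<psi> u) \<partial>count_space (fiber z))"
      using inj_on_subset[OF image_psi(3), of "fiber z"]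
      by (intro nn_integral_bij_count_space[symmetric] inj_on_imp_bij_betw) (auto simp: fiber_def)
    also have "\<dots> = (\<integral>\<^sup>+u. ?f (\<psi> u) * indicator (fiber z) u \<partial>count_space UNIV)"
      by (cases "fiber z = UNIV") (simp_all add: nn_integral_count_space_indicator)
    also have "\<dots> = fiber_sum (\<lambda>u. ?h u * ennreal (1 / alpha CARD('n) M (\<psi> u))) z"
      unfolding fiber_sum_def by (intro nn_integral_cong) (auto simp: indicator_def fiber_def)
    finally show ?thesis .
  qed
  have ind: "(\<integral>\<^sup>+u. ?h u * indicator U u * ennreal (sqrt (det (metric_tensor \<psi> u))) \<partial>lborel) =
    (\<integral>\<^sup>+u. ?h u * ennreal (sqrt (det (metric_tensor \<psi> u))) \<partial>lborel)"
    by (intro nn_integral_cong) (simp split: split_indicator)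
  show ?thesis unfolding sf gaussian_density_eq using area_formula[OF hm] unfolding ind .
qed

text \<open>The image is the preimage of E under the continuous inverse, taken within a relatively
  open subset of M.\<close>

lemma image_borel:
  assumes E: "E \<in> sets borel" "E \<subseteq> U"
  shows "\<psi> ` E \<in> sets (restrict_space borel M)"
proof -
  obtain \<phi> where \<phi>: "homeomorphism U (\<psi> ` U) \<psi> \<phi>" using lp by (auto simp: local_parametrization_def)
  obtain W where W: "open W" "\<psi> ` U = M \<inter> W" using image_psi(1) by (auto simp: openin_open)
  have "\<phi> \<in> borel_measurable (restrict_space borel (M \<inter> W))"
    using \<phi> W(2) by (intro borel_measurable_continuous_on_restrict) (simp add: homeomorphism_def)
  then have "\<phi> -` E \<inter> space (restrict_space borel (M \<inter> W)) \<in> sets (restrict_space borel (M \<inter> W))"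
    using E(1) by (rule measurable_sets)
  moreover have "\<phi> -` E \<inter> (M \<inter> W) = \<psi> ` E"
    using \<phi> E(2) unfolding W(2)[symmetric] homeomorphism_def by force
  ultimately obtain B where B: "B \<in> sets borel" "\<psi> ` E = (M \<inter> W) \<inter> B"
    by (auto simp: space_restrict_space sets_restrict_space)
  have "\<psi> ` E = M \<inter> (W \<inter> B)" using B(2) by auto
  then show ?thesis using B(1) W(1) by (auto simp: sets_restrict_space)
qed

text \<open>Tangent vectors have the form J w, and A J is invertible off the critical
  values.\<close>

lemma transversal:
  assumes z: "z \<notin> critical" and u: "u \<in> fiber z" and v: "v \<in> tangent_space M (\<psi> u)" "fst z *v v = 0"
  shows "v = 0"
proof -
  have uU: "u \<in> U" using u by (simp add: fiber_def)
  obtain w where w: "v = J u *v w" using v(1) tangent_space_parametrization[OF am lp uU] by auto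
  have "det (fst z ** J u) \<noteq> 0" using z u by (auto simp: critical_iff)
  then have "inj ((*v) (fst z ** J u))" by (simp add: invertible_det_nz[symmetric] invertible_eq_bij bij_def)
  moreover have "(fst z ** J u) *v w = (fst z ** J u) *v 0"
    using v(2) w by (simp add: matrix_vector_mul_assoc)
  ultimately have "w = 0" by (rule injD)
  then show ?thesis using w by simp
qed

end

lemma local_parametrization_empty: "local_parametrization M {} \<psi>"
  unfolding local_parametrization_def by (auto simp: homeomorphism_def)

section \<open>Gluing the patches: the volume measure and finiteness of sections\<close>

locale manifold =
  fixes M :: "(real^'N) set" and n :: "'n::finite itself"
  assumes am: "algebraic_manifold CARD('n) M"
begin

lemma countable_parametrizations:
  obtains U and \<psi> :: "nat \<Rightarrow> real^'n \<Rightarrow> real^'N" where "\<And>k. parametrized M (U k) (\<psi> k)" "(\<Union>k. \<psi> k ` U k) = M"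
proof -
  define \<F> where "\<F> = {S. \<exists>U (\<psi> :: real^'n \<Rightarrow> real^'N). local_parametrization M U \<psi> \<and> S = \<psi> ` U}"
  have op: "openin (top_of_set M) S" if "S \<in> \<F>" for S
    using that by (auto simp: \<F>_def local_parametrization_def)
  have U\<F>: "\<Union>\<F> = M"
  proof
    show "\<Union>\<F> \<subseteq> M" using op openin_imp_subset by blast
    show "M \<subseteq> \<Union>\<F>"
    proof
      fix x assume "x \<in> M"
      from exists_local_parametrization[OF am this]
      obtain U and \<psi> :: "real^'n \<Rightarrow> real^'N" where "local_parametrization M U \<psi>" "x \<in> \<psi> ` U" by blast
      then show "x \<in> \<Union>\<F>" unfolding \<F>_def by blast
    qed
  qed
  obtain \<F>' where \<F>': "\<F>' \<subseteq> \<F>" "countable \<F>'" "\<Union>\<F>' = \<Union>\<F>"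
    by (rule Lindelof_openin[OF op])
  define S where "S = from_nat_into (insert {} \<F>')"
  have r: "range S = insert {} \<F>'" unfolding S_def using \<F>'(2) by (intro range_from_nat_into) auto
  have "{} \<in> \<F>" unfolding \<F>_def using local_parametrization_empty by blast
  then have "insert {} \<F>' \<subseteq> \<F>" using \<F>'(1) by simp
  then have "S k \<in> \<F>" for k unfolding r[symmetric] using rangeI by (rule subsetD)
  then have "\<forall>k. \<exists>U. \<exists>\<psi> :: real^'n \<Rightarrow> real^'N. local_parametrization M U \<psi> \<and> S k = \<psi> ` U"
    unfolding \<F>_def by blast
  then obtain U and \<psi> :: "nat \<Rightarrow> real^'n \<Rightarrow> real^'N" where U\<psi>: "\<And>k. local_parametrization M (U k) (\<psi> k) \<and> S k = \<psi> k ` U k"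
    by metis
  have "(\<Union>k. S k) = M" using r \<F>'(3) U\<F> by auto
  then show ?thesis using U\<psi> am by (intro that[of U \<psi>]) (auto simp: parametrized_def)
qed

lemma measurable_cover:
  obtains U and \<psi> :: "nat \<Rightarrow> real^'n \<Rightarrow> real^'N" and E where "\<And>k. parametrized M (U k) (\<psi> k)"
    "disjoint_family E" "(\<Union>k. E k) = M" "\<And>k. E k \<subseteq> \<psi> k ` U k" "\<And>k. E k \<in> sets (restrict_space borel M)"
    "(\<Union>k. \<psi> k ` U k) = M"
proof -
  obtain U and \<psi> :: "nat \<Rightarrow> real^'n \<Rightarrow> real^'N" where U: "\<And>k. parametrized M (U k) (\<psi> k)" "(\<Union>k. \<psi> k ` U k) = M"
    by (rule countable_parametrizations) (rule that)
  define E where "E = disjointed (\<lambda>k. \<psi> k ` U k)"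
  have m: "\<psi> k ` U k \<in> sets (restrict_space borel M)" for k
    using parametrized.image_borel[OF U(1)] parametrized.U_borel[OF U(1)] by blast
  show ?thesis
  proof (rule that[OF U(1), of E])
    show "disjoint_family E" unfolding E_def by (rule disjoint_family_disjointed)
    show "(\<Union>k. E k) = M" unfolding E_def UN_disjointed_eq by (rule U(2))
    show "E k \<subseteq> \<psi> k ` U k" for k unfolding E_def by (rule disjointed_subset)
    show "E k \<in> sets (restrict_space borel M)" for k
      unfolding E_def disjointed_def using m by (intro sets.Diff sets.finite_UN) auto
  qed (rule U(2))
qed

abbreviation ssum :: "(real^'N \<Rightarrow> ennreal) \<Rightarrow> (real^'N^'n) \<times> (real^'n) \<Rightarrow> ennreal" where
  "ssum \<equiv> section_sum M"

lemma ssum_cong: "(\<And>x. x \<in> M \<Longrightarrow> h x = h' x) \<Longrightarrow> ssum h z = ssum h' z"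
  unfolding section_sum_def by (intro nn_integral_cong) auto

lemma ssum_cmult: "ssum (\<lambda>x. c * h x) z = c * ssum h z"
  unfolding section_sum_def by (simp add: nn_integral_cmult[symmetric] mult.assoc)

lemma ssum_add: "ssum (\<lambda>x. h x + h' x) z = ssum h z + ssum h' z"
  unfolding section_sum_def by (simp add: nn_integral_add[symmetric] distrib_right)

lemma ssum_suminf: "ssum (\<lambda>x. \<Sum>k. h k x) z = (\<Sum>k. ssum (h k) z)"
  unfolding section_sum_def by (simp add: nn_integral_suminf[symmetric])

lemma ssum_SUP:
  assumes "incseq h"
  shows "ssum (SUP i. h i) z = (SUP i. ssum (h i) z)"
proof -
  have "ssum (SUP i. h i) z = (\<integral>\<^sup>+x. (SUP i. h i x * ennreal (1 / alpha CARD('n) M x)) \<partial>count_space (M \<inter> linear_section (fst z) (snd z)))"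
    unfolding section_sum_def by (intro nn_integral_cong) (simp only: SUP_apply SUP_mult_right_ennreal)
  also have "\<dots> = (SUP i. ssum (h i) z)"
    unfolding section_sum_def
    by (rule nn_integral_monotone_convergence_SUP)
       (use assms in \<open>auto simp: incseq_def le_fun_def intro!: mult_right_mono\<close>)
  finally show ?thesis .
qed

text \<open>M is cut into countably many disjoint Borel pieces, each inside a patch; the section sum
  is the series of the pieces, and countably many exceptional null sets remain null.\<close>

lemma ssum_borel:
  assumes h: "h \<in> borel_measurable (restrict_space borel M)"
  obtains g where "g \<in> borel_measurable borel" "AE z in lborel. ssum h z = g z"
proof -
  obtain U and \<psi> :: "nat \<Rightarrow> real^'n \<Rightarrow> real^'N" and E where C: "\<And>k. parametrized M (U k) (\<psi> k)"
    "disjoint_family E" "(\<Union>k. E k) = M" "\<And>k. E k \<subseteq> \<psi> k ` U k" "\<And>k. E k \<in> sets (restrict_space borel M)"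
    by (rule measurable_cover) (rule that)
  have "\<forall>k. \<exists>g. g \<in> borel_measurable borel \<and> (AE z in lborel. ssum (\<lambda>x. h x * indicator (E k) x) z = g z)"
    using parametrized.section_sum_patch[OF C(1) h C(5,4)] by blast
  from choice[OF this] obtain g
    where g: "\<forall>k. g k \<in> borel_measurable borel \<and> (AE z in lborel. ssum (\<lambda>x. h x * indicator (E k) x) z = g k z)" ..
  have "ssum h z = (\<Sum>k. ssum (\<lambda>x. h x * indicator (E k) x) z)" for z
  proof -
    have "h x = (\<Sum>k. h x * indicator (E k) x)" if "x \<in> M" for x
      using suminf_indicator[OF C(2), of x] C(3) that by simp
    then have "ssum h z = ssum (\<lambda>x. \<Sum>k. h x * indicator (E k) x) z" by (rule ssum_cong)
    then show ?thesis unfolding ssum_suminf .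
  qed
  moreover have "AE z in lborel. \<forall>k. ssum (\<lambda>x. h x * indicator (E k) x) z = g k z"
    using g by (simp add: AE_all_countable)
  ultimately have "AE z in lborel. ssum h z = (\<Sum>k. g k z)"
    by (auto elim!: eventually_mono)
  moreover have "(\<lambda>z. \<Sum>k. g k z) \<in> borel_measurable borel"
    using g by (intro borel_measurable_suminf_order) auto
  ultimately show ?thesis by (intro that)
qed

lemma ssum_measurable:
  assumes "h \<in> borel_measurable (restrict_space borel M)"
  shows "ssum h \<in> borel_measurable lebesgue"
proof -
  obtain g where "g \<in> borel_measurable borel" "AE z in lborel. ssum h z = g z"
    using assms by (rule ssum_borel)
  then show ?thesis by (intro measurable_lebesgue_AE_eq[of g]) auto
qed

lemma density_measurable [measurable]:
  "gaussian_density \<in> borel_measurable (lebesgue :: ((real^'N^'n) \<times> (real^'n)) measure)"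
  by (rule measurable_completion) simp

text \<open>Charts need not be patched together: the mean number of points of E on a random section, weighted
  by 1 / alpha, does not refer to any parametrization.\<close>
definition vol :: "(real^'N) measure" where
  "vol = measure_of M (sets (restrict_space borel M))
    (\<lambda>E. \<integral>\<^sup>+z. ssum (indicator E) z * ennreal (gaussian_density z) \<partial>lebesgue)"

lemma sets_vol: "sets vol = sets (restrict_space borel M)"
proof -
  have "sets (restrict_space borel M) \<subseteq> Pow M"
    using sets.space_closed[of "restrict_space borel M"] by (simp add: space_restrict_space)
  then have "sets vol = sigma_sets M (sets (restrict_space borel M))"
    unfolding vol_def by (rule sets_measure_of)
  also have "\<dots> = sets (restrict_space borel M)"
    using sets.sigma_sets_eq[of "restrict_space borel M"] by (simp add: space_restrict_space)
  finally show ?thesis .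
qed

lemma space_vol: "space vol = M"
  using sets_eq_imp_space_eq[OF sets_vol] by (simp add: space_restrict_space)

lemma emeasure_vol:
  assumes E: "E \<in> sets (restrict_space borel M)"
  shows "emeasure vol E = (\<integral>\<^sup>+z. ssum (indicator E) z * ennreal (gaussian_density z) \<partial>lebesgue)"
proof (rule emeasure_measure_of[OF vol_def])
  show "sets (restrict_space borel M) \<subseteq> Pow M"
    using sets.space_closed[of "restrict_space borel M"] by (simp add: space_restrict_space)
  show "E \<in> sets vol" using E by (simp add: sets_vol)
  show "positive (sets vol) (\<lambda>E. \<integral>\<^sup>+z. ssum (indicator E) z * ennreal (gaussian_density z) \<partial>lebesgue)"
    by (simp add: positive_def section_sum_def)
  show "countably_additive (sets vol) (\<lambda>E. \<integral>\<^sup>+z. ssum (indicator E) z * ennreal (gaussian_density z) \<partial>lebesgue)"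
  proof (rule countably_additiveI)
    fix A :: "nat \<Rightarrow> (real^'N) set"
    assume A: "range A \<subseteq> sets vol" "disjoint_family A"
    have "(\<Sum>i. \<integral>\<^sup>+z. ssum (indicator (A i)) z * ennreal (gaussian_density z) \<partial>lebesgue) =
      (\<integral>\<^sup>+z. (\<Sum>i. ssum (indicator (A i)) z * ennreal (gaussian_density z)) \<partial>lebesgue)"
      using A(1) by (intro nn_integral_suminf[symmetric] borel_measurable_times_ennreal ssum_measurable
          measurable_compose[OF density_measurable measurable_ennreal]) (auto simp: sets_vol)
    also have "\<dots> = (\<integral>\<^sup>+z. ssum (indicator (\<Union>i. A i)) z * ennreal (gaussian_density z) \<partial>lebesgue)"
      unfolding ennreal_suminf_multc ssum_suminf[symmetric]
      by (simp add: suminf_indicator[OF A(2)])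
    finally show "(\<Sum>i. \<integral>\<^sup>+z. ssum (indicator (A i)) z * ennreal (gaussian_density z) \<partial>lebesgue) =
      (\<integral>\<^sup>+z. ssum (indicator (\<Union>i. A i)) z * ennreal (gaussian_density z) \<partial>lebesgue)" .
  qed
qed

lemma nn_integral_vol:
  assumes h: "h \<in> borel_measurable vol"
  shows "(\<integral>\<^sup>+x. h x \<partial>vol) = (\<integral>\<^sup>+z. ssum h z * ennreal (gaussian_density z) \<partial>lebesgue)"
proof -
  have m: "(\<lambda>z. ssum f z * ennreal (gaussian_density z)) \<in> borel_measurable lebesgue"
    if "f \<in> borel_measurable vol" for f
    using that sets_vol
    by (intro borel_measurable_times_ennreal ssum_measurable measurable_compose[OF density_measurable measurable_ennreal])
      (simp cong: measurable_cong_sets)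
  show ?thesis using h
  proof (induction rule: borel_measurable_induct)
    case (cong f g)
    have "(\<integral>\<^sup>+x. f x \<partial>vol) = (\<integral>\<^sup>+x. g x \<partial>vol)" using cong(3) by (rule nn_integral_cong)
    moreover have "ssum f z = ssum g z" for z using cong(3) by (intro ssum_cong) (simp add: space_vol)
    ultimately show ?case using cong by simp
  next
    case (set A)
    then show ?case by (simp add: emeasure_vol sets_vol)
  next
    case (mult u c)
    then show ?case by (simp add: nn_integral_cmult ssum_cmult mult.assoc m)
  next
    case (add u v)
    then show ?case by (simp add: nn_integral_add ssum_add distrib_right m)
  next
    case (seq U)
    have inc: "incseq U" by (rule seq)
    have "(\<integral>\<^sup>+x. (SUP i. U i) x \<partial>vol) = (SUP i. \<integral>\<^sup>+x. U i x \<partial>vol)"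
      unfolding SUP_apply using seq(1) inc by (intro nn_integral_monotone_convergence_SUP) auto
    also have "\<dots> = (SUP i. \<integral>\<^sup>+z. ssum (U i) z * ennreal (gaussian_density z) \<partial>lebesgue)"
      using seq by simp
    also have "\<dots> = (\<integral>\<^sup>+z. (SUP i. ssum (U i) z * ennreal (gaussian_density z)) \<partial>lebesgue)"
    proof (rule nn_integral_monotone_convergence_SUP[symmetric])
      have "ssum (U i) z \<le> ssum (U j) z" if "i \<le> j" for i j z
        unfolding section_sum_def using inc that
        by (intro nn_integral_mono mult_right_mono) (auto simp: incseq_def le_fun_def)
      then show "incseq (\<lambda>i z. ssum (U i) z * ennreal (gaussian_density z))"
        by (auto simp: incseq_def le_fun_def intro!: mult_right_mono)
    qed (use seq m in auto)
    also have "\<dots> = (\<integral>\<^sup>+z. ssum (SUP i. U i) z * ennreal (gaussian_density z) \<partial>lebesgue)"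
      by (simp add: ssum_SUP[OF inc] SUP_mult_right_ennreal)
    finally show ?case .
  qed
qed

text \<open>This is \<open>section_sum_patch\<close> for the constant 1; injectivity of the
  parametrization turns the indicator of the image into that of E.\<close>

lemma is_volume_measure_vol: "is_volume_measure TYPE('n) M vol"
  unfolding is_volume_measure_def
proof (intro conjI allI impI ballI)
  show "sets vol = sets (restrict_space borel M)" by (rule sets_vol)
  fix U and \<psi> :: "real^'n \<Rightarrow> real^'N" and E :: "(real^'n) set"
  assume lp: "local_parametrization M U \<psi>" and E: "E \<in> sets borel" "E \<subseteq> U"
  interpret parametrized M U \<psi> using am lp by unfold_locales
  have S: "\<psi> ` E \<in> sets (restrict_space borel M)" by (rule image_borel[OF E])
  from section_sum_patch[OF borel_measurable_const[of 1] S] E(2)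
  obtain g where g: "g \<in> borel_measurable borel" "AE z in lborel. ssum (indicator (\<psi> ` E)) z = g z"
    "(\<integral>\<^sup>+z. g z * ennreal (gaussian_density z) \<partial>lborel) =
     (\<integral>\<^sup>+u. indicator (\<psi> ` E) (\<psi> u) * indicator U u * ennreal (sqrt (det (metric_tensor \<psi> u))) \<partial>lborel)"
    by auto
  have "emeasure vol (\<psi> ` E) = (\<integral>\<^sup>+z. ssum (indicator (\<psi> ` E)) z * ennreal (gaussian_density z) \<partial>lborel)"
    by (simp add: emeasure_vol[OF S] nn_integral_completion)
  also have "\<dots> = (\<integral>\<^sup>+z. g z * ennreal (gaussian_density z) \<partial>lborel)"
    using g(2) by (intro nn_integral_cong_AE) (auto elim!: eventually_mono)
  also have "\<dots> = (\<integral>\<^sup>+u. indicator (\<psi> ` E) (\<psi> u) * indicator U u * ennreal (sqrt (det (metric_tensor \<psi> u))) \<partial>lborel)"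
    by (rule g(3))
  also have "\<dots> = (\<integral>\<^sup>+u\<in>E. ennreal (sqrt (det (metric_tensor \<psi> u))) \<partial>lborel)"
  proof (rule nn_integral_cong)
    fix u
    have "\<psi> u \<in> \<psi> ` E \<and> u \<in> U \<longleftrightarrow> u \<in> E" using E(2) image_psi(3) by (auto simp: inj_on_def)
    then show "indicator (\<psi> ` E) (\<psi> u) * indicator U u * ennreal (sqrt (det (metric_tensor \<psi> u))) =
      ennreal (sqrt (det (metric_tensor \<psi> u))) * indicator E u"
      by (auto simp: indicator_def)
  qed
  finally show "emeasure vol (\<psi> ` E) = (\<integral>\<^sup>+u\<in>E. ennreal (sqrt (det (metric_tensor \<psi> u))) \<partial>lborel)" .
qed

text \<open>Every Borel subset of M is a countable disjoint union of images of Borel sets under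
  parametrizations, and their measures are prescribed. This settles the definite description in
  \<open>volume_measure\<close>.\<close>

lemma volume_measure_unique:
  assumes "is_volume_measure TYPE('n) M \<mu>"
  shows "\<mu> = vol"
proof -
  obtain U and \<psi> :: "nat \<Rightarrow> real^'n \<Rightarrow> real^'N" and E where C: "\<And>k. parametrized M (U k) (\<psi> k)"
    "disjoint_family E" "(\<Union>k. E k) = M" "\<And>k. E k \<subseteq> \<psi> k ` U k" "\<And>k. E k \<in> sets (restrict_space borel M)"
    by (rule measurable_cover) (rule that)
  have sets: "sets \<mu> = sets vol" using assms by (simp add: is_volume_measure_def sets_vol)
  show ?thesis
  proof (rule measure_eqI[OF sets])
    fix A assume "A \<in> sets \<mu>"
    then have A: "A \<in> sets (restrict_space borel M)" by (simp add: sets sets_vol)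
    have patch: "emeasure \<mu> (A \<inter> E k) = emeasure vol (A \<inter> E k)" for k
    proof -
      interpret P: parametrized M "U k" "\<psi> k" by (rule C(1))
      let ?F = "\<psi> k -` (A \<inter> E k) \<inter> U k"
      have "A \<inter> E k \<in> sets (restrict_space borel M)" using A C(5) by auto
      from measurable_sets[OF P.psi_measurable_restrict this]
      have F: "?F \<in> sets borel" by (auto simp: space_restrict_space sets_restrict_space)
      have img: "\<psi> k ` ?F = A \<inter> E k" using C(4)[of k] by auto
      have "emeasure \<nu> (\<psi> k ` ?F) = (\<integral>\<^sup>+u\<in>?F. ennreal (sqrt (det (metric_tensor (\<psi> k) u))) \<partial>lborel)"
        if "is_volume_measure TYPE('n) M \<nu>" for \<nu>
        using that P.lp F unfolding is_volume_measure_def by blast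
      from this[OF assms] this[OF is_volume_measure_vol] show ?thesis unfolding img by simp
    qed
    have dA: "disjoint_family (\<lambda>k. A \<inter> E k)" using C(2) by (auto simp: disjoint_family_on_def)
    have rA: "range (\<lambda>k. A \<inter> E k) \<subseteq> sets vol" using A C(5) by (auto simp: sets_vol)
    have "A \<subseteq> M" using sets.sets_into_space[OF A] by (simp add: space_restrict_space)
    then have UA: "A = (\<Union>k. A \<inter> E k)" using C(3) by auto
    have "emeasure \<mu> A = (\<Sum>k. emeasure \<mu> (A \<inter> E k))"
      using suminf_emeasure[of "\<lambda>k. A \<inter> E k" \<mu>] rA dA sets UA by simp
    also have "\<dots> = emeasure vol A"
      using suminf_emeasure[OF rA dA] patch UA by simp
    finally show "emeasure \<mu> A = emeasure vol A" .
  qed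
qed

lemma volume_measure_eq: "volume_measure TYPE('n) M = completion vol"
proof -
  have "(THE \<mu>. is_volume_measure TYPE('n) M \<mu>) = vol"
    using is_volume_measure_vol volume_measure_unique by (rule the_equality)
  then show ?thesis by (simp add: volume_measure_def)
qed

text \<open>Countably many patches cover M. Off the union of their critical sets every point of the
  section is transversal.\<close>

lemma AE_finite_section:
  "AE z in (lborel :: ((real^'N^'n) \<times> (real^'n)) measure). finite (M \<inter> linear_section (fst z) (snd z))"
proof -
  obtain U and \<psi> :: "nat \<Rightarrow> real^'n \<Rightarrow> real^'N" where C: "\<And>k. parametrized M (U k) (\<psi> k)" "(\<Union>k. \<psi> k ` U k) = M"
    by (rule countable_parametrizations) (rule that)
  have "AE z in lborel. \<forall>k. z \<notin> parametrized.critical (U k) (\<psi> k)"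
    using AE_not_in[OF parametrized.critical_null[OF C(1)]] by (simp add: AE_all_countable)
  then show ?thesis
  proof eventually_elim
    case (elim z)
    show ?case
    proof (rule finite_transversal_intersection[OF am])
      fix x v assume x: "x \<in> M" "fst z *v x = snd z" and v: "v \<in> tangent_space M x" "fst z *v v = 0"
      obtain k u where ku: "u \<in> U k" "x = \<psi> k u" using x(1) C(2) by blast
      interpret P: parametrized M "U k" "\<psi> k" by (rule C(1))
      have "u \<in> P.fiber z" using ku x(2) by (simp add: P.fiber_def)
      then show "v = 0" using P.transversal[of z u v] elim v ku(2) by simp
    qed
  qed
qed

lemma alpha_pos:
  assumes "x \<in> M"
  shows "0 < alpha CARD('n) M x"
proof -
  from exists_local_parametrization[OF am assms]
  obtain U and \<psi> :: "real^'n \<Rightarrow> real^'N" where "local_parametrization M U \<psi>" "x \<in> \<psi> ` U" by blast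
  then show ?thesis using gauss_det_parametrization(2)[OF am] by auto
qed

text \<open>The volume of S is a mean of section sums with positive density, so if it is 0, almost
  all of these sums vanish; their terms at points of S are positive.\<close>

lemma null_set_section:
  assumes S: "S \<in> null_sets vol"
  shows "AE z in (lborel :: ((real^'N^'n) \<times> (real^'n)) measure). M \<inter> linear_section (fst z) (snd z) \<inter> S = {}"
proof -
  have Sm: "S \<in> sets (restrict_space borel M)" using S by (auto simp: null_sets_def sets_vol)
  obtain g where g: "g \<in> borel_measurable borel" "AE z in lborel. ssum (indicator S) z = g z"
    by (rule ssum_borel[OF borel_measurable_indicator[OF Sm]])
  have "0 = emeasure vol S" using S by auto
  also have "\<dots> = (\<integral>\<^sup>+z. ssum (indicator S) z * ennreal (gaussian_density z) \<partial>lborel)"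
    by (simp add: emeasure_vol[OF Sm] nn_integral_completion)
  also have "\<dots> = (\<integral>\<^sup>+z. g z * ennreal (gaussian_density z) \<partial>lborel)"
    using g(2) by (intro nn_integral_cong_AE) (auto elim!: eventually_mono)
  finally have "AE z in lborel. g z * ennreal (gaussian_density z) = 0"
    using g(1) by (subst (asm) eq_commute, subst (asm) nn_integral_0_iff_AE) auto
  with g(2) show ?thesis
  proof eventually_elim
    case (elim z)
    then have 0: "ssum (indicator S) z = 0" using gaussian_density_pos[of z] by (simp add: ennreal_eq_0_iff)
    show ?case
    proof (rule ccontr)
      assume "M \<inter> linear_section (fst z) (snd z) \<inter> S \<noteq> {}"
      then obtain x where x: "x \<in> M" "x \<in> linear_section (fst z) (snd z)" "x \<in> S" by blast
      have "indicator S y * ennreal (1 / alpha CARD('n) M y) = 0" if "y \<in> M \<inter> linear_section (fst z) (snd z)" for y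
        using 0 that unfolding section_sum_def by (simp add: nn_integral_0_iff_AE AE_count_space)
      from this[of x] x alpha_pos[OF x(1)] show False by (simp add: ennreal_eq_0_iff)
    qed
  qed
qed

text \<open>A function measurable for the completion differs from a Borel one on a null set, which
  almost every section misses.\<close>

lemma completion_vol:
  assumes h: "h \<in> borel_measurable (completion vol)"
  shows "ssum h \<in> borel_measurable lebesgue"
    and "(\<integral>\<^sup>+x. h x \<partial>completion vol) = (\<integral>\<^sup>+z. ssum h z * ennreal (gaussian_density z) \<partial>lebesgue)"
proof -
  obtain h' where h': "h' \<in> borel_measurable vol" "AE x in vol. h x = h' x"
    using completion_ex_borel_measurable[OF h] by blast
  obtain N where N: "N \<in> null_sets vol" "{x\<in>space vol. h x \<noteq> h' x} \<subseteq> N"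
    using h'(2) by (auto simp: eventually_ae_filter)
  have ae: "AE z in lborel. ssum h z = ssum h' z"
    using null_set_section[OF N(1)]
  proof eventually_elim
    case (elim z)
    show ?case unfolding section_sum_def
      using elim N(2) by (intro nn_integral_cong) (auto simp: space_vol)
  qed
  have "h' \<in> borel_measurable (restrict_space borel M)"
    using h'(1) sets_vol by (simp cong: measurable_cong_sets)
  then obtain g where g: "g \<in> borel_measurable borel" "AE z in lborel. ssum h' z = g z" by (rule ssum_borel)
  have "AE z in lborel. ssum h z = g z" using ae g(2) by eventually_elim simp
  then show "ssum h \<in> borel_measurable lebesgue" using g(1) by (intro measurable_lebesgue_AE_eq[of g]) auto
  have "(\<integral>\<^sup>+x. h x \<partial>completion vol) = (\<integral>\<^sup>+x. h' x \<partial>vol)"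
    unfolding nn_integral_completion using h'(2) by (rule nn_integral_cong_AE)
  also have "\<dots> = (\<integral>\<^sup>+z. ssum h' z * ennreal (gaussian_density z) \<partial>lebesgue)" by (rule nn_integral_vol[OF h'(1)])
  also have "\<dots> = (\<integral>\<^sup>+z. ssum h z * ennreal (gaussian_density z) \<partial>lebesgue)"
    unfolding nn_integral_completion using ae by (intro nn_integral_cong_AE) (auto elim!: eventually_mono)
  finally show "(\<integral>\<^sup>+x. h x \<partial>completion vol) = (\<integral>\<^sup>+z. ssum h z * ennreal (gaussian_density z) \<partial>lebesgue)" .
qed

end

section \<open>The expectation of \<open>f_bar\<close> and the distribution of the sampled
  point\<close>

locale manifold_integrand = manifold M n for M :: "(real^'N) set" and n :: "'n::finite itself" +
  fixes f :: "real^'N \<Rightarrow> real"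
  assumes f_nonneg: "\<And>x. x \<in> M \<Longrightarrow> 0 \<le> f x"
    and f_integrable: "integrable (completion vol) f"
begin

lemma f_measurable [measurable]: "f \<in> borel_measurable (completion vol)"
  using f_integrable by (rule borel_measurable_integrable)

lemma space_completion_vol: "space (completion vol) = M"
  by (simp add: space_vol)

lemma nn_integral_f: "(\<integral>\<^sup>+x. ennreal (f x) \<partial>completion vol) = ennreal (\<integral>x. f x \<partial>completion vol)"
  using f_nonneg space_completion_vol by (intro nn_integral_eq_integral f_integrable AE_I2) auto

lemma f_bar_eq: "f_bar M f z = (\<Sum>x\<in>M \<inter> linear_section (fst z) (snd z). f x / alpha CARD('n) M x)"
  for z :: "(real^'N^'n) \<times> (real^'n)"
  by (simp add: f_bar_def case_prod_beta)

lemma f_bar_nonneg: "0 \<le> f_bar M f z" for z :: "(real^'N^'n) \<times> (real^'n)"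
  unfolding f_bar_eq using f_nonneg alpha_pos by (intro sum_nonneg divide_nonneg_pos) auto

lemma ssum_f_bar:
  assumes "finite (M \<inter> linear_section (fst z) (snd z))"
  shows "ssum (\<lambda>x. ennreal (f x)) z = ennreal (f_bar M f z)"
proof -
  have "ssum (\<lambda>x. ennreal (f x)) z =
    (\<Sum>x\<in>M \<inter> linear_section (fst z) (snd z). ennreal (f x) * ennreal (1 / alpha CARD('n) M x))"
    unfolding section_sum_def by (rule nn_integral_count_space_finite[OF assms])
  also have "\<dots> = (\<Sum>x\<in>M \<inter> linear_section (fst z) (snd z). ennreal (f x / alpha CARD('n) M x))"
    using f_nonneg alpha_pos by (intro sum.cong refl) (simp add: ennreal_mult'[symmetric])
  also have "\<dots> = ennreal (f_bar M f z)"
    unfolding f_bar_eq using f_nonneg alpha_pos by (intro sum_ennreal divide_nonneg_pos) auto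
  finally show ?thesis .
qed

lemma AE_ssum_f_bar: "AE z in lborel. ssum (\<lambda>x. ennreal (f x)) z = ennreal (f_bar M f z)"
  using AE_finite_section by eventually_elim (rule ssum_f_bar)

lemma f_bar_measurable [measurable]:
  "f_bar M f \<in> borel_measurable (lebesgue :: ((real^'N^'n) \<times> (real^'n)) measure)"
proof -
  have "ssum (\<lambda>x. ennreal (f x)) \<in> borel_measurable lebesgue" by (rule completion_vol(1)) measurable
  from completion_ex_borel_measurable[OF this]
  obtain g where g: "g \<in> borel_measurable lborel" "AE z in lborel. ssum (\<lambda>x. ennreal (f x)) z = g z" by blast
  have "AE z in lborel. f_bar M f z = enn2real (g z)"
    using g(2) AE_ssum_f_bar
  proof eventually_elim
    case (elim z)
    then show ?case using f_bar_nonneg[of z] enn2real_ennreal[of "f_bar M f z"] by metis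
  qed
  moreover have "(\<lambda>z. enn2real (g z)) \<in> borel_measurable lborel" using g(1) by measurable
  ultimately show ?thesis by (intro measurable_lebesgue_AE_eq)
qed

lemma nn_integral_f_bar:
  "(\<integral>\<^sup>+z. ennreal (f_bar M f z) * ennreal (gaussian_density z) \<partial>(lebesgue :: ((real^'N^'n) \<times> (real^'n)) measure)) =
    ennreal (\<integral>x. f x \<partial>completion vol)"
proof -
  have "(\<integral>\<^sup>+z. ennreal (f_bar M f z) * ennreal (gaussian_density z) \<partial>(lebesgue :: ((real^'N^'n) \<times> (real^'n)) measure)) =
    (\<integral>\<^sup>+z. ssum (\<lambda>x. ennreal (f x)) z * ennreal (gaussian_density z) \<partial>lebesgue)"
    unfolding nn_integral_completion using AE_ssum_f_bar by (intro nn_integral_cong_AE) (auto elim!: eventually_mono)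
  also have "\<dots> = (\<integral>\<^sup>+x. ennreal (f x) \<partial>completion vol)"
    by (rule completion_vol(2)[symmetric]) measurable
  finally show ?thesis unfolding nn_integral_f .
qed

lemma f_bar_integral:
  "integrable gaussian_measure (f_bar M f :: (real^'N^'n) \<times> (real^'n) \<Rightarrow> real)"
  "(\<integral>x. f x \<partial>completion vol) = (\<integral>z. f_bar M f z \<partial>(gaussian_measure :: ((real^'N^'n) \<times> (real^'n)) measure))"
proof -
  let ?G = "gaussian_measure :: ((real^'N^'n) \<times> (real^'n)) measure"
  have m: "f_bar M f \<in> borel_measurable ?G" unfolding gaussian_measure_def by simp
  have "(\<integral>\<^sup>+z. ennreal (f_bar M f z) \<partial>?G) =
    (\<integral>\<^sup>+z. ennreal (gaussian_density z) * ennreal (f_bar M f z) \<partial>(lebesgue :: ((real^'N^'n) \<times> (real^'n)) measure))"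
    unfolding gaussian_measure_def by (rule nn_integral_density) measurable
  then have e: "(\<integral>\<^sup>+z. ennreal (f_bar M f z) \<partial>?G) = ennreal (\<integral>x. f x \<partial>completion vol)"
    unfolding nn_integral_f_bar[symmetric] by (simp add: mult.commute)
  show i: "integrable ?G (f_bar M f)"
    using m e f_bar_nonneg by (intro integrableI_nonneg) auto
  have "0 \<le> (\<integral>x. f x \<partial>completion vol)"
    using f_nonneg space_completion_vol by (intro Bochner_Integration.integral_nonneg) auto
  moreover have "0 \<le> (\<integral>z. f_bar M f z \<partial>?G)"
    using f_bar_nonneg by (intro Bochner_Integration.integral_nonneg) auto
  moreover have "(\<integral>\<^sup>+z. ennreal (f_bar M f z) \<partial>?G) = ennreal (\<integral>z. f_bar M f z \<partial>?G)"
    using f_bar_nonneg by (intro nn_integral_eq_integral i) auto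
  ultimately show "(\<integral>x. f x \<partial>completion vol) = (\<integral>z. f_bar M f z \<partial>?G)" using e by simp
qed

lemma point_choice_eq:
  "point_choice M f z = distr (point_measure (M \<inter> linear_section (fst z) (snd z))
    (\<lambda>x. ennreal (f x / alpha CARD('n) M x / f_bar M f z))) (completion vol) (\<lambda>x. x)"
  for z :: "(real^'N^'n) \<times> (real^'n)"
  by (simp add: point_choice_def case_prod_beta volume_measure_eq)

lemma sets_point_choice: "sets (point_choice M f z) = sets (completion vol)" for z :: "(real^'N^'n) \<times> (real^'n)"
  by (simp add: point_choice_eq)

text \<open>No exceptional z arises: if \<open>f_bar\<close> is 0, then division by 0 makes both
  sides 0, even on an infinite section with infinite sum.\<close>

lemma emeasure_point_choice:
  fixes z :: "(real^'N^'n) \<times> (real^'n)"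
  assumes E: "E \<in> sets (completion vol)"
  shows "emeasure (point_choice M f z) E = ssum (\<lambda>x. ennreal (f x) * indicator E x) z * ennreal (1 / f_bar M f z)"
proof -
  let ?L = "M \<inter> linear_section (fst z) (snd z)"
  let ?w = "\<lambda>x. ennreal (f x / alpha CARD('n) M x / f_bar M f z)"
  have m: "(\<lambda>x. x) \<in> point_measure ?L ?w \<rightarrow>\<^sub>M completion vol"
    by (simp add: measurable_point_measure_eq1 space_vol)
  have "emeasure (point_choice M f z) E = emeasure (point_measure ?L ?w) (E \<inter> ?L)"
    unfolding point_choice_eq using emeasure_distr[OF m E] by (simp add: space_point_measure vimage_def)
  also have "\<dots> = (\<integral>\<^sup>+x. ?w x * indicator (E \<inter> ?L) x \<partial>count_space ?L)"
    unfolding point_measure_def by (rule emeasure_density) auto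
  also have "\<dots> = (\<integral>\<^sup>+x. (ennreal (f x) * indicator E x * ennreal (1 / alpha CARD('n) M x)) * ennreal (1 / f_bar M f z) \<partial>count_space ?L)"
  proof (rule nn_integral_cong)
    fix x assume "x \<in> space (count_space ?L)"
    then have x: "x \<in> ?L" by simp
    have "?w x = ennreal (f x) * ennreal (1 / alpha CARD('n) M x) * ennreal (1 / f_bar M f z)"
      using x f_nonneg[of x] alpha_pos[of x] f_bar_nonneg[of z] by (simp add: ennreal_mult[symmetric])
    then show "?w x * indicator (E \<inter> ?L) x =
      ennreal (f x) * indicator E x * ennreal (1 / alpha CARD('n) M x) * ennreal (1 / f_bar M f z)"
      using x by (simp split: split_indicator)
  qed
  also have "\<dots> = ssum (\<lambda>x. ennreal (f x) * indicator E x) z * ennreal (1 / f_bar M f z)"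
    unfolding section_sum_def by (rule nn_integral_multc) simp
  finally show ?thesis .
qed

lemma emeasure_point_choice_space:
  fixes z :: "(real^'N^'n) \<times> (real^'n)"
  shows "emeasure (point_choice M f z) (space (point_choice M f z)) = (if f_bar M f z = 0 then 0 else 1)"
proof -
  have s: "space (point_choice M f z) = space (completion vol)"
    by (rule sets_eq_imp_space_eq[OF sets_point_choice])
  have "ssum (\<lambda>x. ennreal (f x) * indicator (space (completion vol)) x) z = ssum (\<lambda>x. ennreal (f x)) z"
    by (rule ssum_cong) (simp add: space_vol)
  then have e: "emeasure (point_choice M f z) (space (point_choice M f z)) =
      ssum (\<lambda>x. ennreal (f x)) z * ennreal (1 / f_bar M f z)"
    unfolding s emeasure_point_choice[OF sets.top] by (rule arg_cong)
  show ?thesis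
  proof (cases "f_bar M f z = 0")
    case False
    \<comment> \<open>On an infinite section \<open>sum\<close> is 0, so a nonzero
      \<open>f_bar\<close> certifies finiteness.\<close>
    then have "finite (M \<inter> linear_section (fst z) (snd z))" unfolding f_bar_eq by (meson sum.infinite)
    then show ?thesis using False f_bar_nonneg[of z] by (simp add: e ssum_f_bar ennreal_mult[symmetric])
  qed (simp add: e)
qed

context
  assumes pos: "0 < (\<integral>x. f x \<partial>completion vol)"
begin

lemma psi_eq:
  "psi M f z = f_bar M f z * gaussian_density z * (1 / (\<integral>x. f x \<partial>completion vol))"
  for z :: "(real^'N^'n) \<times> (real^'n)"
  by (simp add: psi_def f_bar_integral(2)[symmetric])

lemma ennreal_psi:
  "ennreal (psi M f z) = ennreal (f_bar M f z) * ennreal (gaussian_density z) * ennreal (1 / (\<integral>x. f x \<partial>completion vol))"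
  for z :: "(real^'N^'n) \<times> (real^'n)"
  unfolding psi_eq using f_bar_nonneg[of z] gaussian_density_pos[of z] pos
  by (simp add: ennreal_mult[symmetric] del: times_divide_eq_right)

lemma psi_measurable [measurable]:
  "psi M f \<in> borel_measurable (lebesgue :: ((real^'N^'n) \<times> (real^'n)) measure)"
  unfolding psi_eq[abs_def] by measurable

text \<open>\<open>subprob_space\<close> demands a nonempty space.\<close>

lemma M_nonempty: "M \<noteq> {}"
proof
  assume "M = {}"
  then have "(\<integral>x. f x \<partial>completion vol) = (\<integral>x. 0 \<partial>completion vol)"
    using space_vol by (intro Bochner_Integration.integral_cong refl) auto
  then show False using pos by simp
qed

lemma prob_space_psi: "prob_space (psi_measure M f :: ((real^'N^'n) \<times> (real^'n)) measure)"
proof (rule prob_spaceI)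
  let ?I = "\<integral>x. f x \<partial>completion vol"
  have "emeasure (psi_measure M f) (space (psi_measure M f :: ((real^'N^'n) \<times> (real^'n)) measure)) =
    (\<integral>\<^sup>+z. ennreal (psi M f z) \<partial>(lebesgue :: ((real^'N^'n) \<times> (real^'n)) measure))"
    unfolding psi_measure_def space_density by (simp add: emeasure_density cong: nn_integral_cong)
  also have "\<dots> = ennreal ?I * ennreal (1 / ?I)"
    unfolding ennreal_psi nn_integral_f_bar[symmetric] by (rule nn_integral_multc) measurable
  also have "\<dots> = 1" using pos by (simp add: ennreal_mult[symmetric])
  finally show "emeasure (psi_measure M f) (space (psi_measure M f :: ((real^'N^'n) \<times> (real^'n)) measure)) = 1" .
qed

lemma ssum_indicator_measurable:
  assumes [measurable]: "E \<in> sets (completion vol)"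
  shows "ssum (\<lambda>x. ennreal (f x) * indicator E x) \<in> borel_measurable lebesgue"
  by (intro completion_vol(1)) measurable

lemma point_choice_measurable:
  "point_choice M f \<in> (psi_measure M f :: ((real^'N^'n) \<times> (real^'n)) measure) \<rightarrow>\<^sub>M subprob_algebra (completion vol)"
proof (rule measurable_subprob_algebra)
  fix z :: "(real^'N^'n) \<times> (real^'n)"
  have "space (point_choice M f z) = M"
    using sets_eq_imp_space_eq[OF sets_point_choice] by (simp add: space_vol)
  then show "subprob_space (point_choice M f z)"
    using M_nonempty emeasure_point_choice_space[of z] by (intro subprob_spaceI) auto
  show "sets (point_choice M f z) = sets (completion vol)" by (rule sets_point_choice)
next
  fix E assume E: "E \<in> sets (completion vol)"
  show "(\<lambda>z. emeasure (point_choice M f z) E) \<in>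
    borel_measurable (psi_measure M f :: ((real^'N^'n) \<times> (real^'n)) measure)"
    unfolding emeasure_point_choice[OF E] psi_measure_def measurable_density_eq1
    by (intro borel_measurable_times_ennreal ssum_indicator_measurable[OF E]) measurable
qed

lemma AE_prob_space_point_choice:
  "AE z in (psi_measure M f :: ((real^'N^'n) \<times> (real^'n)) measure). prob_space (point_choice M f z)"
proof -
  have "prob_space (point_choice M f z)" if "0 < psi M f z" for z :: "(real^'N^'n) \<times> (real^'n)"
    using that by (intro prob_spaceI) (auto simp: emeasure_point_choice_space psi_eq)
  then show ?thesis unfolding psi_measure_def by (subst AE_density) auto
qed

text \<open>The factor \<open>f_bar\<close> of \<open>psi\<close> cancels against its reciprocal in
  the choice of the point. What remains is the mean of the section sums of f restricted to E, that
  is, the integral of f over E.\<close>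

lemma distributed_bind_point_choice:
  "distributed ((psi_measure M f :: ((real^'N^'n) \<times> (real^'n)) measure) \<bind> point_choice M f) (completion vol) (\<lambda>x. x)
    (\<lambda>x. ennreal (f x / (\<integral>y. f y \<partial>completion vol)))"
proof -
  let ?\<Psi> = "psi_measure M f :: ((real^'N^'n) \<times> (real^'n)) measure"
  let ?I = "\<integral>y. f y \<partial>completion vol"
  have ne: "space ?\<Psi> \<noteq> {}" by (rule prob_space.not_empty[OF prob_space_psi])
  have sets: "sets (?\<Psi> \<bind> point_choice M f) = sets (completion vol)"
    by (rule sets_bind[OF sets_point_choice ne])
  have "?\<Psi> \<bind> point_choice M f = density (completion vol) (\<lambda>x. ennreal (f x / ?I))"
  proof (rule measure_eqI)
    show "sets (?\<Psi> \<bind> point_choice M f) = sets (density (completion vol) (\<lambda>x. ennreal (f x / ?I)))"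
      by (simp add: sets)
  next
    fix E assume "E \<in> sets (?\<Psi> \<bind> point_choice M f)"
    then have E[measurable]: "E \<in> sets (completion vol)" by (simp add: sets)
    let ?s = "\<lambda>z. ssum (\<lambda>x. ennreal (f x) * indicator E x) z"
    note sm = ssum_indicator_measurable[OF E]
    have "emeasure (?\<Psi> \<bind> point_choice M f) E = (\<integral>\<^sup>+z. emeasure (point_choice M f z) E \<partial>?\<Psi>)"
      by (rule emeasure_bind[OF ne point_choice_measurable E])
    also have "\<dots> = (\<integral>\<^sup>+z. ?s z * ennreal (1 / f_bar M f z) \<partial>?\<Psi>)"
      unfolding emeasure_point_choice[OF E] ..
    also have "\<dots> = (\<integral>\<^sup>+z. ennreal (psi M f z) * (?s z * ennreal (1 / f_bar M f z)) \<partial>lebesgue)"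
      unfolding psi_measure_def
      by (intro nn_integral_density borel_measurable_times_ennreal sm) measurable
    also have "\<dots> = (\<integral>\<^sup>+z. ?s z * ennreal (gaussian_density z) * ennreal (1 / ?I) \<partial>lebesgue)"
      unfolding nn_integral_completion
    proof (rule nn_integral_cong_AE, use AE_finite_section in eventually_elim)
      case (elim z)
      \<comment> \<open>Where \<open>f_bar\<close> is 0 nothing can be cancelled, but then this
        bound makes the sum over E vanish too.\<close>
      have le: "?s z \<le> ennreal (f_bar M f z)"
        unfolding ssum_f_bar[OF elim, symmetric] section_sum_def
        by (intro nn_integral_mono mult_right_mono) (auto split: split_indicator)
      show ?case
      proof (cases "f_bar M f z = 0")
        case False
        then have "ennreal (f_bar M f z) * ennreal (1 / f_bar M f z) = 1"
          using f_bar_nonneg[of z] by (simp add: ennreal_mult[symmetric])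
        moreover have "ennreal (psi M f z) * (?s z * ennreal (1 / f_bar M f z)) =
          ?s z * ennreal (gaussian_density z) * ennreal (1 / ?I) * (ennreal (f_bar M f z) * ennreal (1 / f_bar M f z))"
          unfolding ennreal_psi by (simp only: ac_simps)
        ultimately show ?thesis by simp
      qed (use le in \<open>simp add: ennreal_psi\<close>)
    qed
    also have "\<dots> = (\<integral>\<^sup>+z. ?s z * ennreal (gaussian_density z) \<partial>lebesgue) * ennreal (1 / ?I)"
      by (intro nn_integral_multc borel_measurable_times_ennreal sm) measurable
    also have "(\<integral>\<^sup>+z. ?s z * ennreal (gaussian_density z) \<partial>lebesgue) = (\<integral>\<^sup>+x. ennreal (f x) * indicator E x \<partial>completion vol)"
      by (intro completion_vol(2)[symmetric]) measurable
    also have "\<dots> * ennreal (1 / ?I) = (\<integral>\<^sup>+x. ennreal (f x) * indicator E x * ennreal (1 / ?I) \<partial>completion vol)"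
      by (intro nn_integral_multc[symmetric]) measurable
    also have "\<dots> = (\<integral>\<^sup>+x. ennreal (f x / ?I) * indicator E x \<partial>completion vol)"
    proof (rule nn_integral_cong)
      fix x assume "x \<in> space (completion vol)"
      then have "ennreal (f x / ?I) = ennreal (f x) * ennreal (1 / ?I)"
        using f_nonneg[of x] pos by (simp add: space_vol ennreal_mult[symmetric])
      then show "ennreal (f x) * indicator E x * ennreal (1 / ?I) = ennreal (f x / ?I) * indicator E x"
        by (simp only: ac_simps)
    qed
    also have "\<dots> = emeasure (density (completion vol) (\<lambda>x. ennreal (f x / ?I))) E"
      by (intro emeasure_density[symmetric]) measurable
    finally show "emeasure (?\<Psi> \<bind> point_choice M f) E = emeasure (density (completion vol) (\<lambda>x. ennreal (f x / ?I))) E" .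
  qed
  then show ?thesis
    unfolding distributed_def using sets by (simp add: distr_id2 measurable_ident_sets)
qed

end

end

theorem theorem1p1:
  fixes M :: "(real ^ 'N) set" and f :: "real ^ 'N \<Rightarrow> real"
    and vol :: "(real ^ 'N) measure"
    and gauss \<Psi> :: "((real ^ 'N ^ 'n) \<times> (real ^ 'n)) measure"
  defines "vol \<equiv> volume_measure TYPE('n) M"
    and "gauss \<equiv> gaussian_measure"
    and "\<Psi> \<equiv> psi_measure M f"
  assumes "algebraic_manifold CARD('n) M"
    and "\<And>x. x \<in> M \<Longrightarrow> 0 \<le> f x"
    and "integrable vol f"
  shows "(integrable gauss (f_bar M f) \<and>
          (\<integral>x. f x \<partial>vol) = (\<integral>z. f_bar M f z \<partial>gauss)) \<and>
         (0 < (\<integral>x. f x \<partial>vol) \<longrightarrow>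
            prob_space \<Psi> \<and>
            point_choice M f \<in> \<Psi> \<rightarrow>\<^sub>M subprob_algebra vol \<and>
            (AE z in \<Psi>. prob_space (point_choice M f z)) \<and>
            distributed (\<Psi> \<bind> point_choice M f) vol (\<lambda>x. x)
              (\<lambda>x. ennreal (f x / (\<integral>y. f y \<partial>vol))))"
proof -
  interpret A: manifold M "TYPE('n)" by unfold_locales fact
  have v: "vol = completion A.vol" unfolding vol_def by (rule A.volume_measure_eq)
  interpret manifold_integrand M "TYPE('n)" f
    by unfold_locales (use assms(5,6) v in auto)
  show ?thesis
    unfolding v gauss_def \<Psi>_def
    using f_bar_integral prob_space_psi point_choice_measurable AE_prob_space_point_choice distributed_bind_point_choice
    by blast
qed


end
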